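(* Let $\alpha=\infty$ (Dirichlet boundary condition), and for complex-valued $q\in L^1(\mathbb{R}_+)$ let $(\nu,\psi)$ be the spectral pair of $H(q,\infty)$. For any (fixed) $\lambda=k^2>0$, $k>0$, as $\|q\|_{L^1}\to0$ we have $$\frac{\mathrm{d}\nu}{\mathrm{d}\lambda}(\lambda)=\frac{1}{2\pi}\left(k-\int_0^\infty \sin(2ky)\,\mathrm{Re}\,q(y)\,\mathrm{d}y\right)+\mathcal{O}(\|q\|_{L^1}^2)$$ and $$\psi(\lambda)=1+\frac{2\mathrm{i}}{k}\int_0^\infty \mathrm{e}^{-ky}\sin(ky)\,\mathrm{Im}\,q(y)\,\mathrm{d}y+\mathcal{O}(\|q\|_{L^1}^2).$$
   Context: **Basic notation.** $\mathbb{R}_+=(0,\infty)$; $\epsilon=\begin{pmatrix}0&1\\1&0\end{pmatrix}$, $Q=\begin{pmatrix}0&q\\ \overline q&0\end{pmatrix}$. The constant implied by $\mathcal{O}(\|q\|_{L^1}^2)$ may depend on $k$. **Operators.** $H=H(q,\infty)$ acts in $L^2(\mathbb{R}_+)$ by $Hf=-f''+qf$ on the domain of all $f\in L^2(\mathbb{R}_+)$ with $f,f'$ (locally) absolutely continuous, $-f''+qf\in L^2(\mathbb{R}_+)$ and $f(0)=0$ (such $f$ extend to $C^1$ functions on $[0,\infty)$). $H$ is closed and densely defined. The hermitisation $\mathbf{H}=\begin{pmatrix}0&H\\H^*&0\end{pmatrix}$ on $\mathrm{Dom}\,H^*\oplus\mathrm{Dom}\,H$ is self-adjoint in $L^2(\mathbb{R}_+;\mathbb{C}^2)$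 and acts as $\mathbf{H}F=-\epsilon F''+QF$ with boundary condition $F(0)=0$. **Spectral pair.** Let $\Phi(\cdot,\lambda),\Theta(\cdot,\lambda)$ be the $2\times2$ matrix-valued solutions of $-\epsilon F''+QF=\lambda F$ with $\Phi'(0)=-I$, $\Phi(0)=0$, $\Theta'(0)=0$, $\Theta(0)=\epsilon$. For every $\lambda\in\mathbb{C}\setminus\mathbb{R}$ there is a unique $2\times2$ matrix $M_\infty(\lambda)$ such that both columns of $\Theta(\cdot,\lambda)-\Phi(\cdot,\lambda)M_\infty(\lambda)$ are in $L^2(\mathbb{R}_+;\mathbb{C}^2)$. $M_\infty$ is a matrix Herglotz–Nevanlinna function, so $M_\infty(\lambda)=\mathrm{Re}\,M_\infty(\mathrm{i})+\int_{\mathbb{R}}\bigl(\frac1{t-\lambda}-\frac{t}{1+t^2}\bigr)\mathrm{d}\Sigma(t)$, $\mathrm{Im}\,\lambda>0$, with a unique $2\times2$ matrix-valued measure $\Sigma$ on $\mathbb{R}$ (here $\mathrm{Re}\,M=\frac12(M+M^* )$). It has the structure $\mathrm{d}\Sigma=\begin{pmatrix}1&\psi\\ \overline\psi&1\end{pmatrix}\mathrm{d}\nu$, where $\nu$ is an even positive measure on $\mathbb{R}$ and $\psi\in L^\infty(\nu)$ is odd with $|\psi|\le1$ $\nu$-a.e. The pair $(\nu,\psi)$ is the spectral pair of $H$. On $(0,\infty)$ away from the eigenvalues of $\mathbf{H}$ (which can accumulate only at $0$), $\Sigma$ is absolutely continuous with a continuous density; pointwise values of $\mathrm{d}\nu/\mathrm{d}\lambda$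 and $\psi$ there refer to this continuous version, i.e. $\frac{\mathrm{d}\Sigma}{\mathrm{d}\lambda}(\lambda)=\begin{pmatrix}1&\psi(\lambda)\\ \overline{\psi(\lambda)}&1\end{pmatrix}\frac{\mathrm{d}\nu}{\mathrm{d}\lambda}(\lambda)$. *)

theory Defs
  imports "HOL-Analysis.Analysis"
begin

type_synonym cmat = "complex^2^2"

definition eps :: cmat where
  "eps = vector [vector [0, 1], vector [1, 0]]"

definition Qmat :: "complex \<Rightarrow> cmat" where
  "Qmat z = vector [vector [0, z], vector [cnj z, 0]]"

definition adjmat :: "cmat \<Rightarrow> cmat" where
  "adjmat M = (\<chi> i j. cnj (M $ j $ i))"

definition Re_mat :: "cmat \<Rightarrow> cmat" where
  "Re_mat M = (1 / 2) *\<^sub>R (M + adjmat M)"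

definition L1_norm :: "(real \<Rightarrow> complex) \<Rightarrow> real" where
  "L1_norm q = (LINT x:{0<..}|lebesgue. norm (q x))"

definition in_L2 :: "(real \<Rightarrow> complex^2) \<Rightarrow> bool" where
  "in_L2 f \<longleftrightarrow> set_borel_measurable lebesgue {0<..} f \<and>
     set_integrable lebesgue {0<..} (\<lambda>x. (norm (f x))\<^sup>2)"

text \<open>The usual epsilon-delta condition. A division of a set \<open>T\<close> is a finite family of
  nonoverlapping compact intervals with union \<open>T\<close>; here \<open>T\<close> is an arbitrary subset of
  \<open>{a..b}\<close>, so \<open>d\<close> ranges over all finite nonoverlapping families of
  compact subintervals of \<open>{a..b}\<close>.\<close>

definition abs_cont_on :: "real \<Rightarrow> real \<Rightarrow> (real \<Rightarrow> 'a::real_normed_vector) \<Rightarrow> bool" where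
  "abs_cont_on a b f \<longleftrightarrow>
     (\<forall>e>0. \<exists>\<delta>>0. \<forall>d T. d division_of T \<and> T \<subseteq> {a..b} \<and> (\<Sum>I\<in>d. Sup I - Inf I) < \<delta>
        \<longrightarrow> (\<Sum>I\<in>d. norm (f (Sup I) - f (Inf I))) < e)"

text \<open>\<open>F\<close> is a solution of \<open>- eps F'' + Q F = \<mu> F\<close> on the half-line and \<open>F'\<close> is its
  derivative. As \<open>q\<close> is only integrable, \<open>F'\<close> is required to be locally absolutely
  continuous on \<open>[0, \<infinity>)\<close> and the equation to hold almost everywhere; for such \<open>q\<close> the solutions
  are continuously differentiable up to \<open>0\<close>. Scalars act on matrices as \<open>mat c ** A\<close>.\<close>

definition solution :: "(real \<Rightarrow> complex) \<Rightarrow> complex \<Rightarrow> (real \<Rightarrow> cmat) \<Rightarrow> (real \<Rightarrow> cmat) \<Rightarrow> bool" where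
  "solution q \<mu> F F' \<longleftrightarrow>
     (\<forall>x\<ge>0. (F has_vector_derivative F' x) (at x within {0..})) \<and>
     (\<forall>b>0. abs_cont_on 0 b F') \<and>
     (AE x in lebesgue. x > 0 \<longrightarrow>
        (\<exists>F''. (F' has_vector_derivative F'') (at x) \<and>
               - (eps ** F'') + Qmat (q x) ** F x = mat \<mu> ** F x))"

definition is_Weyl_matrix :: "(real \<Rightarrow> complex) \<Rightarrow> complex \<Rightarrow> cmat \<Rightarrow> bool" where
  "is_Weyl_matrix q \<mu> M \<longleftrightarrow>
     (\<exists>\<Phi> \<Phi>' \<Theta> \<Theta>'.
        solution q \<mu> \<Phi> \<Phi>' \<and> \<Phi> 0 = 0 \<and> \<Phi>' 0 = - mat 1 \<and>
        solution q \<mu> \<Theta> \<Theta>' \<and> \<Theta> 0 = eps \<and> \<Theta>' 0 = 0 \<and>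
        (\<forall>j. in_L2 (\<lambda>x. column j (\<Theta> x - \<Phi> x ** M))))"

text \<open>Meaningful for nonreal \<open>\<mu>\<close>, where the matrix is unique.\<close>

definition Weyl_M :: "(real \<Rightarrow> complex) \<Rightarrow> complex \<Rightarrow> cmat" where
  "Weyl_M q \<mu> = (THE M. is_Weyl_matrix q \<mu> M)"

definition pair_mat :: "complex \<Rightarrow> cmat" where
  "pair_mat p = vector [vector [1, p], vector [cnj p, 1]]"

text \<open>The matrix-valued measure \<open>d\<Sigma> = pair_mat \<psi> d\<nu>\<close>, to be evaluated on bounded Borel sets.\<close>

definition Sigma_measure :: "real measure \<Rightarrow> (real \<Rightarrow> complex) \<Rightarrow> real set \<Rightarrow> cmat" where
  "Sigma_measure \<nu> \<psi> A = (LINT t:A|\<nu>. pair_mat (\<psi> t))"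

text \<open>The function \<open>\<psi>\<close> is an element of \<open>L\<^sup>\<infinity>(\<nu>)\<close>, hence is determined only up to \<open>\<nu>\<close>-null sets.
  The integrability of \<open>1 / (1 + t\<^sup>2)\<close> is the convergence of the Herglotz-Nevanlinna
  integral at \<open>\<mu> = \<i>\<close>.\<close>

definition spectral_pair :: "(real \<Rightarrow> complex) \<Rightarrow> real measure \<Rightarrow> (real \<Rightarrow> complex) \<Rightarrow> bool" where
  "spectral_pair q \<nu> \<psi> \<longleftrightarrow>
     sets \<nu> = sets borel \<and> integrable \<nu> (\<lambda>t. 1 / (1 + t\<^sup>2)) \<and> distr \<nu> borel uminus = \<nu> \<and>
     \<psi> \<in> borel_measurable borel \<and> (AE t in \<nu>. cmod (\<psi> t) \<le> 1) \<and> (AE t in \<nu>. \<psi> (- t) = - \<psi> t) \<and>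
     (\<forall>\<mu>. Im \<mu> > 0 \<longrightarrow>
        Weyl_M q \<mu> = Re_mat (Weyl_M q \<i>) +
          (LINT t|\<nu>. mat (1 / (complex_of_real t - \<mu>) - complex_of_real (t / (1 + t\<^sup>2)))
                       ** pair_mat (\<psi> t)))"

text \<open>\<open>pair_values \<nu> \<psi> \<mu> n p\<close>: in a neighbourhood of \<open>\<mu>\<close> the measure \<open>\<Sigma>\<close> is absolutely continuous
  with a continuous density, whose value at \<open>\<mu>\<close> is given by \<open>n = d\<nu>/d\<mu>\<close> and \<open>p = \<psi>(\<mu>)\<close> in
  the sense of continuous versions. The density at \<open>\<mu>\<close> is unique, so
  \<open>n\<close> is unique, and \<open>p\<close> is unique if \<open>n \<noteq> 0\<close>.\<close>

definition pair_values ::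
  "real measure \<Rightarrow> (real \<Rightarrow> complex) \<Rightarrow> real \<Rightarrow> real \<Rightarrow> complex \<Rightarrow> bool" where
  "pair_values \<nu> \<psi> \<mu> n p \<longleftrightarrow>
     (\<exists>r>0. \<exists>\<rho>::real \<Rightarrow> cmat. continuous_on (cball \<mu> r) \<rho> \<and>
        (\<forall>A\<in>sets borel. A \<subseteq> cball \<mu> r \<longrightarrow> Sigma_measure \<nu> \<psi> A = (LINT t:A|lborel. \<rho> t)) \<and>
        \<rho> \<mu> = n *\<^sub>R pair_mat p)"

end

theory Submission
  imports Defs
begin

text \<open>In the coordinates \<open>u = F\<^sub>1 + F\<^sub>2\<close>, \<open>v = F\<^sub>1 - F\<^sub>2\<close> the free system decouples: with
  \<open>\<mu> = z\<^sup>2\<close> the equation reads \<open>u'' = - z\<^sup>2 u + Re q u - \<i> Im q v\<close> and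
  \<open>v'' = z\<^sup>2 v + Re q v - \<i> Im q u\<close>, with decaying free solutions \<open>exp (\<i> z x)\<close> and
  \<open>exp (- z x)\<close>. For small \<open>q\<close> the decaying solution with prescribed value at \<open>0\<close> is the fixed
  point of the integral equation built from the free Dirichlet Green function. After division by
  \<open>exp (- Im z x)\<close> its kernel is bounded uniformly up to \<open>Im z = 0\<close>, so the contraction can be run
  in the bounded continuous functions of \<open>(x, z)\<close> jointly; hence the Weyl matrix extends continuously
  to the real axis near \<open>k\<^sup>2\<close>, and its first order expansion in \<open>q\<close> is explicit. Stieltjes
  inversion identifies the density of the spectral measure there with \<open>1 / pi\<close> times the imaginary
  part of the boundary value.\<close>

section \<open>Absolute continuity and primitives\<close>

text \<open>As \<open>q\<close> is only integrable, second derivatives are controlled merely almost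
  everywhere. The equation is therefore handled as an integral identity (\<open>primitive\<close>),
  and matched with the epsilon-delta absolute continuity of \<open>solution\<close> by a fundamental
  theorem of calculus. \<open>Weyl_M\<close> is a definite description, so more than the decaying
  solution is required: existence also needs \<open>\<Phi>\<close>, which comes from the same
  contraction with a Volterra kernel and a growing weight, and uniqueness comes from a constant
  Wronskian. The Weyl matrix is the derivative at \<open>0\<close> of the decaying matrix solution
  with value \<open>eps\<close> at \<open>0\<close>; in rotated coordinates its columns start at
  \<open>(1, \<sigma>)\<close> with \<open>\<sigma> = -1\<close> and \<open>\<sigma> = 1\<close>.
  One weight serves both components because \<open>Im z \<le> Re z\<close> for the roots
  \<open>z\<close> in question. The weighted kernels are bounded by \<open>2 / k\<close>, and
  \<open>16 Q \<le> k\<close>, with \<open>Q\<close> the norm of \<open>q\<close> in L1, makes the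
  contraction factor \<open>1 / 2\<close>. That the density has equal diagonal entries is inherited
  from \<open>pair_mat\<close>, not read off from the expansion.\<close>

text \<open>The gauge is chosen so that intervals tagged outside \<open>N\<close> obey the estimate
  given by the derivative, while those tagged in \<open>N\<close> lie in an open set of measure
  below the \<open>\<delta>\<close> of absolute continuity, so that the increments of
  \<open>f\<close> over them are small in total.\<close>

lemma abs_cont_on_has_integral:
  fixes f g :: "real \<Rightarrow> 'a::banach"
  assumes "a \<le> b" and ac: "abs_cont_on a b f" and N: "negligible N"
    and der: "\<And>x. x \<in> {a..b} - N \<Longrightarrow> (f has_vector_derivative g x) (at x within {a..b})"
  shows "(g has_integral f b - f a) {a..b}"
proof -
  define g0 where "g0 = (\<lambda>x. if x \<in> N then 0 else g x)"
  have "(g0 has_integral f b - f a) {a..b}"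
    unfolding has_integral_real
  proof (intro allI impI)
    fix e :: real assume e: "e > 0"
    \<comment> \<open>The \<open>+ 1\<close> keeps the denominator positive when
      \<open>a = b\<close>.\<close>
    define e1 where "e1 = e / (2 * (b - a + 1))"
    have e1: "e1 > 0" using e \<open>a \<le> b\<close> by (auto simp: e1_def intro!: divide_pos_pos)
    from ac e have "\<exists>\<delta>>0. \<forall>d T. d division_of T \<and> T \<subseteq> {a..b} \<and> (\<Sum>I\<in>d. Sup I - Inf I) < \<delta>
        \<longrightarrow> (\<Sum>I\<in>d. norm (f (Sup I) - f (Inf I))) < e / 2"
      unfolding abs_cont_on_def by (elim allE[of _ "e / 2"]) simp
    then obtain \<delta> where \<delta>: "\<delta> > 0" and ac': "\<forall>d T. d division_of T \<and> T \<subseteq> {a..b} \<and>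
        (\<Sum>I\<in>d. Sup I - Inf I) < \<delta> \<longrightarrow> (\<Sum>I\<in>d. norm (f (Sup I) - f (Inf I))) < e / 2" by blast
    have Nl: "N \<in> sets lebesgue" and N0: "emeasure lebesgue N = 0"
      using N by (auto simp: negligible_iff_null_sets null_sets_def)
    obtain U where U: "open U" "N \<subseteq> U" "U - N \<in> lmeasurable" "emeasure lebesgue (U - N) < ennreal \<delta>"
      using sets_lebesgue_outer_open[OF Nl \<delta>] by blast
    have "emeasure lebesgue U = emeasure lebesgue (U - N)"
      using N U by (intro emeasure_Diff_null_set[symmetric]) (auto simp: negligible_iff_null_sets)
    then have U\<delta>: "emeasure lebesgue U < ennreal \<delta>" using U(4) by simp
    have U': "U \<in> lmeasurable" using U(1) U\<delta>
      by (intro fmeasurableI) (auto simp: less_top[symmetric] intro: order_less_trans)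
    have mU: "measure lebesgue U < \<delta>" using U\<delta> \<delta> U'
      by (simp add: emeasure_eq_measure2 ennreal_less_iff)
    have "\<exists>d>0. (x \<in> N \<longrightarrow> ball x d \<subseteq> U) \<and> (x \<in> {a..b} - N \<longrightarrow>
        (\<forall>y\<in>{a..b}. norm (y - x) < d \<longrightarrow> norm (f y - f x - (y - x) *\<^sub>R g x) \<le> e1 / 1 * norm (y - x)))" for x
    proof (cases "x \<in> N")
      case True then show ?thesis using U(1,2) by (meson DiffD2 openE subsetD)
    next
      case False
      show ?thesis
      proof (cases "x \<in> {a..b}")
        case True
        with False der have "(f has_derivative (\<lambda>h. h *\<^sub>R g x)) (at x within {a..b})"
          by (auto simp: has_vector_derivative_def)
        then show ?thesis using e1 False unfolding has_derivative_within_alt by auto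
      qed (use False in \<open>auto intro!: exI[of _ 1]\<close>)
    qed
    then obtain D where D: "\<And>x. D x > 0" "\<And>x. x \<in> N \<Longrightarrow> ball x (D x) \<subseteq> U"
      "\<And>x y. x \<in> {a..b} - N \<Longrightarrow> y \<in> {a..b} \<Longrightarrow> norm (y - x) < D x \<Longrightarrow> norm (f y - f x - (y - x) *\<^sub>R g x) \<le> e1 * norm (y - x)"
      by (simp only: div_by_1) metis
    show "\<exists>\<gamma>. gauge \<gamma> \<and> (\<forall>\<D>. \<D> tagged_division_of {a..b} \<and> \<gamma> fine \<D> \<longrightarrow>
              norm ((\<Sum>(x, k)\<in>\<D>. measure lborel k *\<^sub>R g0 x) - (f b - f a)) < e)"
    proof (intro exI conjI allI impI)
      show "gauge (\<lambda>x. ball x (D x))" using D(1) by (simp add: gauge_ball_dependent)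
      fix p assume "p tagged_division_of {a..b} \<and> (\<lambda>x. ball x (D x)) fine p"
      then have p: "p tagged_division_of {a..b}" and fine: "\<And>x k. (x,k) \<in> p \<Longrightarrow> k \<subseteq> ball x (D x)"
        by (auto simp: fine_def)
      have finp: "finite p" using p by auto
      have pk: "\<exists>u v. k = {u..v} \<and> u \<le> v \<and> x \<in> {u..v} \<and> {u..v} \<subseteq> {a..b}" if "(x,k) \<in> p" for x k
        using tagged_division_ofD(2,3,4)[OF p that] by (metis atLeastAtMost_iff box_real(2) order_trans)
      define p1 where "p1 = {z\<in>p. fst z \<in> N}"
      have sub: "(\<Sum>(x,k)\<in>p. measure lborel k *\<^sub>R g0 x - (f (Sup k) - f (Inf k)))
          = (\<Sum>(x,k)\<in>p. measure lborel k *\<^sub>R g0 x) - (f b - f a)"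
        using additive_tagged_division_1[OF \<open>a \<le> b\<close> p, of f]
        by (simp add: split_beta sum_subtractf)
      have t1: "norm (measure lborel k *\<^sub>R g0 x - (f (Sup k) - f (Inf k))) \<le> e1 * measure lborel k"
        if xk: "(x,k) \<in> p" "x \<notin> N" for x k
      proof -
        obtain u v where k: "k = {u..v}" "u \<le> v" "x \<in> {u..v}" "{u..v} \<subseteq> {a..b}" using pk[OF xk(1)] by blast
        have bl: "u \<in> ball x (D x)" "v \<in> ball x (D x)" using fine[OF xk(1)] k(1,2) by (metis atLeastAtMost_iff order_refl subsetD)+
        have 1: "norm (f v - f x - (v - x) *\<^sub>R g x) \<le> e1 * norm (v - x)"
          using k xk bl by (intro D(3)) (auto simp: dist_real_def abs_if split: if_splits)
        have 2: "norm (f u - f x - (u - x) *\<^sub>R g x) \<le> e1 * norm (u - x)"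
          using k xk bl by (intro D(3)) (auto simp: dist_real_def abs_if split: if_splits)
        \<comment> \<open>Splitting the increment at the tag leaves two errors, each at most
          \<open>e1\<close> times the distance to an end point; these distances add up to the
          length.\<close>
        have 3: "measure lborel k *\<^sub>R g0 x - (f (Sup k) - f (Inf k)) =
          (f u - f x - (u - x) *\<^sub>R g x) - (f v - f x - (v - x) *\<^sub>R g x)"
          using k(1,2) xk(2) by (simp add: g0_def scaleR_diff_left)
        have "norm (measure lborel k *\<^sub>R g0 x - (f (Sup k) - f (Inf k))) \<le> e1 * norm (u - x) + e1 * norm (v - x)"
          unfolding 3 by (rule order_trans[OF norm_triangle_ineq4 add_mono, OF 2 1])
        also have "\<dots> = e1 * measure lborel k" using k(1-3) by (simp add: right_diff_distrib)
        finally show ?thesis .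
      qed
      have t2: "(\<Sum>(x,k)\<in>p1. norm (f (Sup k) - f (Inf k))) < e / 2"
      proof -
        have "p1 tagged_partial_division_of {a..b}"
          using tagged_partial_division_subset[of p "{a..b}" p1] p by (auto simp: p1_def tagged_division_of_def)
        from tagged_partial_division_of_Union_self[OF this]
        have p1: "p1 tagged_division_of (\<Union>(snd ` p1))" .
        have div: "snd ` p1 division_of (\<Union>(snd ` p1))" by (rule division_of_tagged_division[OF p1])
        have subT: "\<Union>(snd ` p1) \<subseteq> {a..b}"
        proof
          fix y assume "y \<in> \<Union>(snd ` p1)"
          then obtain x k where "(x,k) \<in> p" "y \<in> k" by (auto simp: p1_def)
          then show "y \<in> {a..b}" using tagged_division_ofD(3)[OF p] by blast
        qed
        have subU: "\<Union>(snd ` p1) \<subseteq> U"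
        proof
          fix y assume "y \<in> \<Union>(snd ` p1)"
          then obtain x k where "(x,k) \<in> p" "x \<in> N" "y \<in> k" by (auto simp: p1_def)
          then show "y \<in> U" using D(2) fine by blast
        qed
        have "(\<Sum>I\<in>snd ` p1. Sup I - Inf I) = (\<Sum>I\<in>snd ` p1. measure lebesgue I)"
        proof (rule sum.cong[OF refl])
          fix I assume "I \<in> snd ` p1"
          then obtain x where "(x, I) \<in> p" by (auto simp: p1_def)
          from pk[OF this] show "Sup I - Inf I = measure lebesgue I" by auto
        qed
        also have "\<dots> = measure lebesgue (\<Union>(snd ` p1))"
          by (rule content_division[OF div])
        also have "\<dots> \<le> measure lebesgue U"
          using subU U' div by (intro measure_mono_fmeasurable) (auto intro!: fmeasurableD lmeasurable_division)
        finally have less: "(\<Sum>I\<in>snd ` p1. norm (f (Sup I) - f (Inf I))) < e / 2"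
          using mU div subT by (intro ac'[rule_format, OF conjI[OF div conjI]]) auto
        \<comment> \<open>Absolute continuity sums over intervals, the gauge estimate over tagged
          pairs. An interval can carry several tags only if it is degenerate, and \<open>G\<close>
          is 0 on degenerate intervals; the empty one is set to 0 by hand, since \<open>Sup\<close>
          and \<open>Inf\<close> mean nothing there.\<close>
        define G where "G k = (if k = {} then 0 else norm (f (Sup k) - f (Inf k)))" for k
        have "(\<Sum>(x,k)\<in>p1. G k) = (\<Sum>I\<in>snd ` p1. G I)"
        proof (rule sum.over_tagged_division_lemma[OF p1])
          fix u v :: real assume "box u v = {}"
          then show "G (cbox u v) = 0"
            by (cases "u = v") (auto simp: G_def)
        qed
        moreover have "k \<noteq> {}" if "(x,k) \<in> p1" for x k using that pk[of x k] by (auto simp: p1_def)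
        then have "(\<Sum>(x,k)\<in>p1. G k) = (\<Sum>(x,k)\<in>p1. norm (f (Sup k) - f (Inf k)))"
          "(\<Sum>I\<in>snd ` p1. G I) = (\<Sum>I\<in>snd ` p1. norm (f (Sup I) - f (Inf I)))"
          by (auto simp: G_def split_beta intro!: sum.cong)
        ultimately show ?thesis using less by simp
      qed
      have sumc: "(\<Sum>(x,k)\<in>p. measure lborel k) = b - a"
        using additive_content_tagged_division[of p a b] p \<open>a \<le> b\<close> by simp
      have "norm ((\<Sum>(x,k)\<in>p. measure lborel k *\<^sub>R g0 x) - (f b - f a))
          \<le> (\<Sum>(x,k)\<in>p. norm (measure lborel k *\<^sub>R g0 x - (f (Sup k) - f (Inf k))))"
        unfolding sub[symmetric] using sum_norm_le[of p] by (simp add: split_beta norm_sum)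
      also have "\<dots> \<le> (\<Sum>(x,k)\<in>p. e1 * measure lborel k + (if x \<in> N then norm (f (Sup k) - f (Inf k)) else 0))"
      proof (rule sum_mono, clarify)
        fix x k assume "(x,k) \<in> p"
        then show "norm (measure lborel k *\<^sub>R g0 x - (f (Sup k) - f (Inf k)))
           \<le> e1 * measure lborel k + (if x \<in> N then norm (f (Sup k) - f (Inf k)) else 0)"
          using t1[of x k] e1 by (auto simp: g0_def norm_minus_commute)
      qed
      also have "\<dots> = (\<Sum>(x,k)\<in>p. e1 * measure lborel k) + (\<Sum>z\<in>p. if fst z \<in> N then norm (f (Sup (snd z)) - f (Inf (snd z))) else 0)"
        by (simp add: split_beta sum.distrib)
      also have "(\<Sum>z\<in>p. if fst z \<in> N then norm (f (Sup (snd z)) - f (Inf (snd z))) else 0)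
           = (\<Sum>(x,k)\<in>p1. norm (f (Sup k) - f (Inf k)))"
        unfolding p1_def using finp by (simp add: sum.inter_filter split_beta)
      also have "(\<Sum>(x,k)\<in>p. e1 * measure lborel k) = e1 * (b - a)"
        using sumc by (simp add: split_beta sum_distrib_left[symmetric])
      also have "e1 * (b - a) \<le> e / 2"
        using \<open>a \<le> b\<close> e by (simp add: e1_def field_simps)
      finally show "norm ((\<Sum>(x, k)\<in>p. measure lborel k *\<^sub>R g0 x) - (f b - f a)) < e"
        using t2 by linarith
    qed
  qed
  then show ?thesis
    by (rule has_integral_spike[OF N, rotated]) (auto simp: g0_def)
qed

text \<open>Averages over \<open>{x..x + h}\<close> give the right derivative; the same theorem for
  the reflected function gives the left one, and the two exceptional sets are united.\<close>

lemma AE_has_vector_derivative_integral: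
  fixes g :: "real \<Rightarrow> 'b::euclidean_space"
  assumes int: "\<And>a b. g integrable_on {a..b}"
  obtains N where "negligible N"
    "\<And>x a. x \<notin> N \<Longrightarrow> a < x \<Longrightarrow> ((\<lambda>t. integral {a..t} g) has_vector_derivative g x) (at x)"
proof -
  have ex: "\<exists>N. negligible N \<and> (\<forall>x e. x \<notin> N \<longrightarrow> 0 < e \<longrightarrow>
      (\<exists>d>0. \<forall>h. 0 < h \<and> h < d \<longrightarrow> norm (integral {x..x + h} f /\<^sub>R h - f x) < e))"
    if f: "\<And>a b. f integrable_on {a..b}" for f :: "real \<Rightarrow> 'b"
  proof (rule integrable_ccontinuous_explicit[of f])
    show "f integrable_on cbox a b" for a b using f by simp
    fix N assume "negligible N" and *: "\<And>x e. \<lbrakk>x \<notin> N; 0 < e\<rbrakk> \<Longrightarrow>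
      \<exists>d>0. \<forall>h. 0 < h \<and> h < d \<longrightarrow> norm (integral (cbox x (x + h *\<^sub>R One)) f /\<^sub>R h ^ DIM(real) - f x) < e"
    then show ?thesis by (intro exI[of _ N] conjI allI impI) simp_all
  qed
  have int': "(\<lambda>x. g (- x)) integrable_on {a..b}" for a b
    using int[of "-b" "-a"] Henstock_Kurzweil_Integration.integrable_reflect_real[of g "-a" "-b"] by simp
  obtain N1 where N1: "negligible N1" "\<And>x e. \<lbrakk>x \<notin> N1; 0 < e\<rbrakk> \<Longrightarrow>
      \<exists>d>0. \<forall>h. 0 < h \<and> h < d \<longrightarrow> norm (integral {x..x + h} g /\<^sub>R h - g x) < e"
    using ex[OF int] by auto
  obtain N2 where N2: "negligible N2" "\<And>x e. \<lbrakk>x \<notin> N2; 0 < e\<rbrakk> \<Longrightarrow>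
      \<exists>d>0. \<forall>h. 0 < h \<and> h < d \<longrightarrow> norm (integral {x..x + h} (\<lambda>x. g (- x)) /\<^sub>R h - g (- x)) < e"
    using ex[OF int'] by auto
  have scale: "norm (I - h *\<^sub>R y) \<le> e * h" if "norm (I /\<^sub>R h - y) < e" "h > 0" for I y :: 'b and h e
  proof -
    have "norm (I - h *\<^sub>R y) = norm (h *\<^sub>R (I /\<^sub>R h - y))" using that by (simp add: algebra_simps)
    also have "\<dots> = h * norm (I /\<^sub>R h - y)" using that by simp
    finally show ?thesis using that by (simp add: mult.commute)
  qed
  show thesis
  proof
    show "negligible (N1 \<union> uminus ` N2)"
      using N1(1) N2(1) by (auto intro!: negligible_differentiable_image_negligible derivative_intros simp: differentiable_on_def)
    fix x a assume x: "x \<notin> N1 \<union> uminus ` N2" "a < x"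
    then have "x \<notin> N1" "- x \<notin> N2" by (auto simp: image_iff)
    show "((\<lambda>t. integral {a..t} g) has_vector_derivative g x) (at x)"
      unfolding has_vector_derivative_def has_derivative_within_alt
    proof (intro conjI allI impI)
      fix e :: real assume e: "e > 0"
      obtain d1 where d1: "d1 > 0" "\<And>h. 0 < h \<Longrightarrow> h < d1 \<Longrightarrow> norm (integral {x..x + h} g /\<^sub>R h - g x) < e"
        using N1(2)[OF \<open>x \<notin> N1\<close> e] by auto
      obtain d2 where d2: "d2 > 0" "\<And>h. 0 < h \<Longrightarrow> h < d2 \<Longrightarrow> norm (integral {-x..-x + h} (\<lambda>x. g (- x)) /\<^sub>R h - g x) < e"
        using N2(2)[OF \<open>- x \<notin> N2\<close> e] by auto
      show "\<exists>d>0. \<forall>y\<in>UNIV. norm (y - x) < d \<longrightarrow>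
         norm (integral {a..y} g - integral {a..x} g - (y - x) *\<^sub>R g x) \<le> e * norm (y - x)"
      proof (intro exI[of _ "min (min d1 d2) (x - a)"] conjI ballI impI)
        show "min (min d1 d2) (x - a) > 0" using d1 d2 x by auto
        fix y assume y: "norm (y - x) < min (min d1 d2) (x - a)"
        consider "y = x" | "y > x" | "y < x" by linarith
        then show "norm (integral {a..y} g - integral {a..x} g - (y - x) *\<^sub>R g x) \<le> e * norm (y - x)"
        proof cases
          case 2
          have c: "integral {a..x} g + integral {x..y} g = integral {a..y} g"
            using 2 x int by (intro Henstock_Kurzweil_Integration.integral_combine) auto
          moreover have "norm (integral {x..x + (y - x)} g - (y - x) *\<^sub>R g x) \<le> e * (y - x)"
            using 2 y by (intro scale d1(2)) auto
          ultimately show ?thesis using 2 by (simp add: c[symmetric])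
        next
          case 3
          have c: "integral {a..y} g + integral {y..x} g = integral {a..x} g"
            using 3 y x int by (intro Henstock_Kurzweil_Integration.integral_combine) auto
          moreover have "norm (integral {-x..-x + (x - y)} (\<lambda>x. g (- x)) - (x - y) *\<^sub>R g x) \<le> e * (x - y)"
            using 3 y by (intro scale d2(2)) auto
          moreover have "integral {-x..-x + (x - y)} (\<lambda>x. g (- x)) = integral {y..x} g"
            using Henstock_Kurzweil_Integration.integral_reflect_real[of x y g] by simp
          ultimately have "norm (- (integral {a..y} g - integral {a..x} g - (y - x) *\<^sub>R g x)) \<le> e * (x - y)"
            by (simp add: c[symmetric] algebra_simps)
          then show ?thesis using 3 unfolding norm_minus_cancel by simp
        qed auto
      qed
    qed (rule bounded_linear_scaleR_left)
  qed
qed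

section \<open>Absolutely continuous functions in integral form\<close>

text \<open>Absolute continuity of \<open>f\<close> with derivative \<open>g\<close>, encoded as an
  integral identity so that no pointwise derivative has to be carried along. Absolute integrability
  is demanded because, unlike gauge integrability, it survives multiplication by continuous
  functions.\<close>

definition primitive :: "(real \<Rightarrow> complex) \<Rightarrow> (real \<Rightarrow> complex) \<Rightarrow> bool" where
  "primitive f g \<longleftrightarrow> (\<forall>x\<ge>0. g absolutely_integrable_on {0..x} \<and> (g has_integral f x - f 0) {0..x})"

lemma primitive_absint: "primitive f g \<Longrightarrow> g absolutely_integrable_on {0..x}"
  by (cases "x \<ge> 0") (auto simp: primitive_def)

lemma primitive_has_integral: "primitive f g \<Longrightarrow> x \<ge> 0 \<Longrightarrow> (g has_integral f x - f 0) {0..x}"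
  by (auto simp: primitive_def)

lemma primitive_eq: "primitive f g \<Longrightarrow> x \<ge> 0 \<Longrightarrow> f x = f 0 + integral {0..x} g"
  using primitive_has_integral[of f g x] by (simp add: integral_unique)

lemma primitive_add: "primitive f f' \<Longrightarrow> primitive g g' \<Longrightarrow> primitive (\<lambda>x. f x + g x) (\<lambda>x. f' x + g' x)"
  unfolding primitive_def
proof (intro allI impI conjI)
  fix x :: real
  assume f: "\<forall>x\<ge>0. f' absolutely_integrable_on {0..x} \<and> (f' has_integral f x - f 0) {0..x}"
    and g: "\<forall>x\<ge>0. g' absolutely_integrable_on {0..x} \<and> (g' has_integral g x - g 0) {0..x}" and x: "0 \<le> x"
  show "(\<lambda>x. f' x + g' x) absolutely_integrable_on {0..x}" using f g x by (intro set_integral_add(1)) auto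
  have "((\<lambda>x. f' x + g' x) has_integral (f x - f 0) + (g x - g 0)) {0..x}"
    using f g x by (intro has_integral_add) auto
  then show "((\<lambda>x. f' x + g' x) has_integral f x + g x - (f 0 + g 0)) {0..x}" by (simp add: algebra_simps)
qed

lemma primitive_cmult: "primitive f f' \<Longrightarrow> primitive (\<lambda>x. c * f x) (\<lambda>x. c * f' x)"
  unfolding primitive_def
proof (intro allI impI conjI)
  fix x :: real
  assume f: "\<forall>x\<ge>0. f' absolutely_integrable_on {0..x} \<and> (f' has_integral f x - f 0) {0..x}" and x: "0 \<le> x"
  show "(\<lambda>x. c * f' x) absolutely_integrable_on {0..x}" using f x by (intro set_integrable_mult_right) auto
  have "((\<lambda>x. c * f' x) has_integral c * (f x - f 0)) {0..x}"
    using f x by (intro has_integral_mult_right) auto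
  then show "((\<lambda>x. c * f' x) has_integral c * f x - c * f 0) {0..x}" by (simp add: algebra_simps)
qed

lemma primitive_diff: "primitive f f' \<Longrightarrow> primitive g g' \<Longrightarrow> primitive (\<lambda>x. f x - g x) (\<lambda>x. f' x - g' x)"
  using primitive_add[of f f' "\<lambda>x. (-1) * g x" "\<lambda>x. (-1) * g' x"] primitive_cmult[of g g' "-1"] by simp

lemma primitive_cong:
  assumes "primitive f g" "\<And>x. x \<ge> 0 \<Longrightarrow> f' x = f x" "\<And>x. x \<ge> 0 \<Longrightarrow> g' x = g x"
  shows "primitive f' g'"
  unfolding primitive_def
proof (intro allI impI conjI)
  fix x :: real assume x: "0 \<le> x"
  show "g' absolutely_integrable_on {0..x}"
    using primitive_absint[OF assms(1), of x] assms(3)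
    by (subst set_integrable_cong[OF refl refl, of _ g' g]) auto
  show "(g' has_integral f' x - f' 0) {0..x}"
    using primitive_has_integral[OF assms(1) x] assms x
    by (subst has_integral_cong[of _ g' g]) auto
qed

lemma primitive_const: "primitive (\<lambda>x. c) (\<lambda>x. 0)"
  by (auto simp: primitive_def)

lemma primitive_integral:
  assumes "\<And>x. g absolutely_integrable_on {0..x}"
  shows "primitive (\<lambda>x. integral {0..x} g) g"
  using assms unfolding primitive_def by (simp add: integrable_integral set_lebesgue_integral_eq_integral(1))

lemma primitive_continuous:
  assumes "primitive f g" shows "continuous_on {0..} f"
proof -
  have "isCont (\<lambda>x. f (max 0 x)) x" for x
  proof -
    have "continuous_on {0..max 0 x + 1} (\<lambda>x. f 0 + integral {0..x} g)"
      using primitive_absint[OF assms] by (intro continuous_intros indefinite_integral_continuous_1)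
         (simp add: set_lebesgue_integral_eq_integral(1))
    then have "continuous_on {0..max 0 x + 1} f"
      by (rule continuous_on_eq) (rule primitive_eq[OF assms, symmetric], simp)
    then have "continuous_on {..<max 0 x + 1} (\<lambda>x. f (max 0 x))"
      by (rule continuous_on_compose2) (auto intro!: continuous_intros)
    then show ?thesis by (rule continuous_on_interior) (simp add: interior_open)
  qed
  then have "continuous_on {0..} (\<lambda>x. f (max 0 x))" by (simp add: continuous_at_imp_continuous_on)
  then show ?thesis by (rule continuous_on_eq) auto
qed

lemma primitive_AE:
  assumes "primitive f g"
  shows "AE x in lebesgue. x > 0 \<longrightarrow> (f has_vector_derivative g x) (at x)"
proof -
  \<comment> \<open>Differentiation of integrals asks for integrability on every interval, so
    \<open>g\<close> is extended by 0 to negative arguments.\<close>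
  define g0 where "g0 = (\<lambda>x. if x \<in> {0..} then g x else 0)"
  have "g0 integrable_on {a..b}" for a b
  proof -
    have "g integrable_on {0..b}" using primitive_absint[OF assms] by (simp add: set_lebesgue_integral_eq_integral(1))
    then have "g integrable_on {max 0 a..b}" by (rule integrable_on_subinterval) auto
    moreover have "{0..} \<inter> {a..b} = {max 0 a..b}" by auto
    ultimately show ?thesis unfolding g0_def integrable_restrict_Int by simp
  qed
  then obtain N where N: "negligible N"
    "\<And>x a. x \<notin> N \<Longrightarrow> a < x \<Longrightarrow> ((\<lambda>t. integral {a..t} g0) has_vector_derivative g0 x) (at x)"
    using AE_has_vector_derivative_integral[of g0] by blast
  have "(f has_vector_derivative g x) (at x)" if "x \<notin> N" "x > 0" for x
  proof -
    have "((\<lambda>t. f 0 + integral {0..t} g0) has_vector_derivative (0 + g0 x)) (at x)"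
      using that N by (intro has_vector_derivative_add has_vector_derivative_const)
    then have d: "((\<lambda>t. f 0 + integral {0..t} g0) has_vector_derivative g x) (at x)"
      using that by (simp add: g0_def)
    show ?thesis
    proof (rule has_vector_derivative_transform_within_open[OF d open_greaterThan[of 0]])
      fix t :: real assume t: "t \<in> {0<..}"
      have "integral {0..t} g0 = integral {0..t} g"
        by (rule Henstock_Kurzweil_Integration.integral_cong) (auto simp: g0_def)
      then show "f 0 + integral {0..t} g0 = f t" using primitive_eq[OF assms, of t] t by simp
    qed (use that in auto)
  qed
  moreover have "AE x in lebesgue. x \<notin> N" using N(1)
    by (intro AE_not_in) (simp add: negligible_iff_null_sets)
  ultimately show ?thesis by (auto elim!: eventually_mono)
qed

text \<open>Cut \<open>norm g\<close> at a height \<open>n\<close>: the excess has small integral by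
  dominated convergence, and the bounded part contributes at most its height times the total length
  of the intervals.\<close>

lemma primitive_abs_cont:
  assumes "primitive f g" shows "abs_cont_on 0 b f"
  unfolding abs_cont_on_def
proof (intro allI impI)
  fix e :: real assume e: "e > 0"
  define h where "h = (\<lambda>x. norm (g x))"
  define k where "k n = (\<lambda>x. h x - min (h x) (real n))" for n
  have g: "g absolutely_integrable_on {0..b}" by (rule primitive_absint[OF assms])
  then have h: "h absolutely_integrable_on {0..b}" unfolding h_def by (rule set_integrable_norm)
  have mint: "(\<lambda>x. min (h x) (real n)) absolutely_integrable_on {0..b}" for n
    using h by (intro absolutely_integrable_min_1) (auto intro!: absolutely_integrable_on_const)
  have kint: "k n absolutely_integrable_on {0..b}" for n
    unfolding k_def using h mint by (rule set_integral_diff(1))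
  have "(\<lambda>n. integral {0..b} (k n)) \<longlonglongrightarrow> integral {0..b} (\<lambda>x. 0::real)"
  proof (rule dominated_convergence(2)[where h = h])
    show "k n integrable_on {0..b}" for n using kint by (simp add: set_lebesgue_integral_eq_integral(1))
    show "h integrable_on {0..b}" using h by (simp add: set_lebesgue_integral_eq_integral(1))
    show "norm (k n x) \<le> h x" for n x by (auto simp: k_def h_def)
    show "(\<lambda>n. k n x) \<longlonglongrightarrow> 0" for x
    proof (rule tendsto_eventually)
      obtain n0 where "h x \<le> real n0" using real_arch_simple by blast
      then show "\<forall>\<^sub>F n in sequentially. k n x = 0"
        by (intro eventually_sequentiallyI[of n0]) (auto simp: k_def)
    qed
  qed
  then have "(\<lambda>n. integral {0..b} (k n)) \<longlonglongrightarrow> 0" by simp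
  from LIMSEQ_D[OF this, of "e/2"] e obtain n where n: "\<bar>integral {0..b} (k n)\<bar> < e / 2" by auto
  define K where "K = real n + 1"
  have K: "K > 0" by (simp add: K_def)
  show "\<exists>\<delta>>0. \<forall>d T. d division_of T \<and> T \<subseteq> {0..b} \<and> (\<Sum>I\<in>d. Sup I - Inf I) < \<delta> \<longrightarrow> (\<Sum>I\<in>d. norm (f (Sup I) - f (Inf I))) < e"
  proof (intro exI[of _ "e / (2 * K)"] conjI allI impI)
    show "e / (2 * K) > 0" using e K by simp
    fix d T assume dT: "d division_of T \<and> T \<subseteq> {0..b} \<and> (\<Sum>I\<in>d. Sup I - Inf I) < e / (2 * K)"
    then have d: "d division_of T" and T: "T \<subseteq> {0..b}" by auto
    have I: "norm (f (Sup I) - f (Inf I)) \<le> integral I (k n) + K * (Sup I - Inf I)"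
      and Ik: "k n integrable_on I" if Id: "I \<in> d" for I
    proof -
      obtain u v where uv: "I = {u..v}" "u \<le> v" "{u..v} \<subseteq> {0..b}"
        using division_ofD(2,3,4)[OF d Id] T by (metis atLeastatMost_empty_iff2 box_real(2) order_trans)
      then have u0: "0 \<le> u" "v \<le> b" using uv by auto
      have gi: "g integrable_on {0..v}" using primitive_absint[OF assms] by (simp add: set_lebesgue_integral_eq_integral(1))
      have c: "integral {0..u} g + integral {u..v} g = integral {0..v} g"
        using uv u0 gi by (intro Henstock_Kurzweil_Integration.integral_combine) auto
      then have "f v - f u = integral {u..v} g"
        using primitive_eq[OF assms, of u] primitive_eq[OF assms, of v] uv u0 by (simp add: c[symmetric])
      moreover have guv: "g absolutely_integrable_on {u..v}" using g uv by (metis absolutely_integrable_on_subinterval)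
      moreover have huv: "h integrable_on {u..v}" unfolding h_def
        using set_integrable_norm[OF guv] by (simp add: set_lebesgue_integral_eq_integral(1))
      ultimately have "norm (f v - f u) \<le> integral {u..v} h"
        unfolding h_def by (simp add: integral_norm_bound_integral set_lebesgue_integral_eq_integral(1))
      also have kuv: "k n integrable_on {u..v}"
        using absolutely_integrable_on_subinterval[OF kint uv(3)] by (simp add: set_lebesgue_integral_eq_integral(1))
      have "integral {u..v} h \<le> integral {u..v} (\<lambda>x. k n x + K)"
        using huv kuv by (intro integral_le integrable_add) (auto simp: k_def K_def)
      also have "\<dots> = integral {u..v} (k n) + K * (v - u)"
        using kuv uv by (subst Henstock_Kurzweil_Integration.integral_add) auto
      finally show "norm (f (Sup I) - f (Inf I)) \<le> integral I (k n) + K * (Sup I - Inf I)" using uv by simp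
      show "k n integrable_on I" using kuv uv by simp
    qed
    have "(\<Sum>I\<in>d. norm (f (Sup I) - f (Inf I))) \<le> (\<Sum>I\<in>d. integral I (k n) + K * (Sup I - Inf I))"
      using I by (rule sum_mono)
    also have "\<dots> = integral T (k n) + K * (\<Sum>I\<in>d. Sup I - Inf I)"
      using integral_combine_division_bottomup[OF d Ik] by (simp add: sum.distrib sum_distrib_left)
    also have "integral T (k n) \<le> integral {0..b} (k n)"
      using T integrable_combine_division[OF d Ik] kint
      by (intro integral_subset_le) (auto simp: set_lebesgue_integral_eq_integral(1) k_def)
    also have "\<dots> < e / 2" using n by linarith
    also have "K * (\<Sum>I\<in>d. Sup I - Inf I) \<le> e / 2" using dT K by (simp add: field_simps)
    finally show "(\<Sum>I\<in>d. norm (f (Sup I) - f (Inf I))) < e" by simp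
  qed
qed

text \<open>Together with \<open>primitive_AE\<close> and \<open>primitive_abs_cont\<close>, this
  matches \<open>primitive\<close> with the notion of derivative used in
  \<open>solution\<close>.\<close>

lemma abs_cont_imp_primitive:
  assumes ac: "\<And>b. b > 0 \<Longrightarrow> abs_cont_on 0 b f"
    and ae: "AE x in lebesgue. x > 0 \<longrightarrow> (f has_vector_derivative g x) (at x)"
    and int: "\<And>b. g absolutely_integrable_on {0..b}"
  shows "primitive f g"
  unfolding primitive_def
proof (intro allI impI conjI int)
  fix x :: real assume "0 \<le> x"
  obtain N where N: "N \<in> null_sets lebesgue" "{x \<in> space lebesgue. \<not> (x > 0 \<longrightarrow> (f has_vector_derivative g x) (at x))} \<subseteq> N"
    using ae unfolding eventually_ae_filter by blast
  show "(g has_integral f x - f 0) {0..x}"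
  proof (cases "x = 0")
    case False
    show ?thesis
    proof (rule abs_cont_on_has_integral[where N = "insert 0 N"])
      \<comment> \<open>The derivative is known only for positive arguments, so 0 joins the
        exceptional set.\<close>
      show "negligible (insert 0 N)" using N(1) by (simp add: negligible_iff_null_sets)
      show "(f has_vector_derivative g t) (at t within {0..x})" if "t \<in> {0..x} - insert 0 N" for t
      proof -
        have "t > 0" "t \<notin> N" using that by auto
        then have "(f has_vector_derivative g t) (at t)" using N(2) by auto
        then show ?thesis by (rule has_vector_derivative_at_within)
      qed
    qed (use False \<open>0 \<le> x\<close> ac in auto)
  qed auto
qed

lemma abs_cont_on_mult:
  fixes f g :: "real \<Rightarrow> complex"
  assumes f: "abs_cont_on a b f" "continuous_on {a..b} f" and g: "abs_cont_on a b g" "continuous_on {a..b} g"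
  shows "abs_cont_on a b (\<lambda>x. f x * g x)"
  unfolding abs_cont_on_def
proof (intro allI impI)
  fix e :: real assume e: "e > 0"
  obtain B where B: "B > 0" "\<And>x. x \<in> {a..b} \<Longrightarrow> norm (f x) \<le> B" "\<And>x. x \<in> {a..b} \<Longrightarrow> norm (g x) \<le> B"
  proof -
    have "bounded (f ` {a..b} \<union> g ` {a..b})"
      using f g by (simp add: compact_imp_bounded compact_continuous_image)
    then obtain B where "B > 0" "\<forall>x\<in>f ` {a..b} \<union> g ` {a..b}. norm x \<le> B" by (auto simp: bounded_pos)
    then show thesis by (intro that[of B]) auto
  qed
  define e' where "e' = e / (2 * B)"
  have e': "e' > 0" using e B by (simp add: e'_def)
  obtain d1 where d1: "d1 > 0" "\<forall>d T. d division_of T \<and> T \<subseteq> {a..b} \<and> (\<Sum>I\<in>d. Sup I - Inf I) < d1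
        \<longrightarrow> (\<Sum>I\<in>d. norm (f (Sup I) - f (Inf I))) < e'" using f(1)[unfolded abs_cont_on_def, THEN spec, of e'] e' by (elim impE exE conjE) (simp, rule that)
  obtain d2 where d2: "d2 > 0" "\<forall>d T. d division_of T \<and> T \<subseteq> {a..b} \<and> (\<Sum>I\<in>d. Sup I - Inf I) < d2
        \<longrightarrow> (\<Sum>I\<in>d. norm (g (Sup I) - g (Inf I))) < e'" using g(1)[unfolded abs_cont_on_def, THEN spec, of e'] e' by (elim impE exE conjE) (simp, rule that)
  show "\<exists>\<delta>>0. \<forall>d T. d division_of T \<and> T \<subseteq> {a..b} \<and> (\<Sum>I\<in>d. Sup I - Inf I) < \<delta> \<longrightarrow> (\<Sum>I\<in>d. norm (f (Sup I) * g (Sup I) - f (Inf I) * g (Inf I))) < e"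
  proof (intro exI[of _ "min d1 d2"] conjI allI impI)
    fix d T assume dT: "d division_of T \<and> T \<subseteq> {a..b} \<and> (\<Sum>I\<in>d. Sup I - Inf I) < min d1 d2"
    have "norm (f (Sup I) * g (Sup I) - f (Inf I) * g (Inf I)) \<le> B * norm (f (Sup I) - f (Inf I)) + B * norm (g (Sup I) - g (Inf I))"
      if Id: "I \<in> d" for I
    proof -
      obtain u v where uv: "I = {u..v}" "u \<le> v" "{u..v} \<subseteq> {a..b}"
        using division_ofD(2,3,4)[OF conjunct1[OF dT] Id] dT by (metis atLeastatMost_empty_iff2 box_real(2) order_trans)
      then have uv': "u \<in> {a..b}" "v \<in> {a..b}" by auto
      have "f v * g v - f u * g u = g v * (f v - f u) + f u * (g v - g u)" by (simp add: algebra_simps)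
      then have "norm (f v * g v - f u * g u) \<le> norm (g v * (f v - f u)) + norm (f u * (g v - g u))"
        by (simp only: norm_triangle_ineq)
      also have "\<dots> \<le> B * norm (f v - f u) + B * norm (g v - g u)"
        unfolding norm_mult using B uv' by (intro add_mono mult_right_mono) auto
      finally show ?thesis using uv by simp
    qed
    then have "(\<Sum>I\<in>d. norm (f (Sup I) * g (Sup I) - f (Inf I) * g (Inf I)))
      \<le> (\<Sum>I\<in>d. B * norm (f (Sup I) - f (Inf I)) + B * norm (g (Sup I) - g (Inf I)))" by (rule sum_mono)
    also have "\<dots> = B * (\<Sum>I\<in>d. norm (f (Sup I) - f (Inf I))) + B * (\<Sum>I\<in>d. norm (g (Sup I) - g (Inf I)))"
      by (simp add: sum.distrib sum_distrib_left)
    also have "\<dots> < B * e' + B * e'"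
    proof (intro add_strict_mono mult_strict_left_mono B)
      show "(\<Sum>I\<in>d. norm (f (Sup I) - f (Inf I))) < e'" by (rule d1(2)[rule_format, of d T]) (use dT in simp)
      show "(\<Sum>I\<in>d. norm (g (Sup I) - g (Inf I))) < e'" by (rule d2(2)[rule_format, of d T]) (use dT in simp)
    qed
    also have "\<dots> = e" using B by (simp add: e'_def)
    finally show "(\<Sum>I\<in>d. norm (f (Sup I) * g (Sup I) - f (Inf I) * g (Inf I))) < e" .
  qed (use d1 d2 in auto)
qed

lemma absint_continuous_mult:
  fixes f g :: "real \<Rightarrow> complex"
  assumes "continuous_on {0..x} f" "g absolutely_integrable_on {0..x}"
  shows "(\<lambda>x. f x * g x) absolutely_integrable_on {0..x}"
proof (rule absolutely_integrable_bounded_measurable_product[of "(*)"])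
  show "bilinear ((*) :: complex \<Rightarrow> complex \<Rightarrow> complex)"
    by (simp add: bilinear_conv_bounded_bilinear bounded_bilinear_mult)
  show "f \<in> borel_measurable (lebesgue_on {0..x})"
    using assms by (intro continuous_imp_measurable_on_sets_lebesgue) auto
  show "bounded (f ` {0..x})" using assms by (simp add: compact_imp_bounded compact_continuous_image)
qed (use assms in auto)

text \<open>Integration by parts without continuous derivatives: the product is absolutely
  continuous and the product rule holds almost everywhere.\<close>

lemma primitive_mult:
  assumes "primitive f f'" "primitive g g'"
  shows "primitive (\<lambda>x. f x * g x) (\<lambda>x. f x * g' x + f' x * g x)"
proof (rule abs_cont_imp_primitive)
  have c: "continuous_on {0..b} f" "continuous_on {0..b} g" for b
    using assms[THEN primitive_continuous] by (auto elim: continuous_on_subset)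
  show "abs_cont_on 0 b (\<lambda>x. f x * g x)" for b
    using assms c by (intro abs_cont_on_mult primitive_abs_cont)
  show "AE x in lebesgue. x > 0 \<longrightarrow> ((\<lambda>x. f x * g x) has_vector_derivative (f x * g' x + f' x * g x)) (at x)"
    using assms[THEN primitive_AE] by eventually_elim (simp add: has_vector_derivative_mult)
  show "(\<lambda>x. f x * g' x + f' x * g x) absolutely_integrable_on {0..b}" for b
    using absint_continuous_mult[OF c(1) primitive_absint[OF assms(2)], of b]
      absint_continuous_mult[OF c(2) primitive_absint[OF assms(1)], of b]
    by (intro set_integral_add(1)) (auto simp: mult.commute)
qed

lemma primitive_zero: "primitive f (\<lambda>x. 0) \<Longrightarrow> x \<ge> 0 \<Longrightarrow> f x = f 0"
  by (drule (1) primitive_eq) simp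

lemma primitive_of_deriv:
  assumes "\<And>x. x \<ge> 0 \<Longrightarrow> (f has_vector_derivative g x) (at x within {0..})" "continuous_on {0..} g"
  shows "primitive f g"
  unfolding primitive_def
proof (intro allI impI conjI)
  fix x :: real assume x: "x \<ge> 0"
  show "g absolutely_integrable_on {0..x}"
    by (rule absolutely_integrable_continuous_real) (rule continuous_on_subset[OF assms(2)], auto)
  show "(g has_integral f x - f 0) {0..x}"
    by (rule fundamental_theorem_of_calculus[OF x]) (rule has_vector_derivative_within_subset[OF assms(1)], auto)
qed

lemma primitive_deriv:
  assumes "primitive f g" "continuous_on {0..} g" "x \<ge> 0"
  shows "(f has_vector_derivative g x) (at x within {0..})"
proof -
  have "((\<lambda>u. integral {0..u} g) has_vector_derivative g x) (at x within {0..x+1})"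
    using assms by (intro integral_has_vector_derivative) (auto elim: continuous_on_subset)
  then have "((\<lambda>u. f 0 + integral {0..u} g) has_vector_derivative (0 + g x)) (at x within {0..x+1})"
    by (intro has_vector_derivative_add has_vector_derivative_const)
  then have "((\<lambda>u. f 0 + integral {0..u} g) has_vector_derivative g x) (at x within {0..x+1})" by simp
  then have "(f has_vector_derivative g x) (at x within {0..x+1})"
    by (rule has_vector_derivative_transform[rotated 2]) (use assms in simp, rule primitive_eq[OF assms(1)], simp)
  moreover have "at x within {0..x+1} = at x within {0..}"
    by (rule at_within_nhd[of x "{..<x+1}"]) (use assms in auto)
  ultimately show ?thesis by simp
qed

section \<open>The integral equation\<close>

text \<open>Dominated convergence along sequences. It shows that the integral operators preserve
  continuity in \<open>(x, z)\<close> and that the derivatives at 0 are continuous in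
  \<open>z\<close> up to the real axis.\<close>

lemma continuous_on_integral_param:
  fixes f :: "'p::metric_space \<Rightarrow> real \<Rightarrow> 'b::{banach,second_countable_topology}"
  assumes cont: "\<And>y. continuous_on S (\<lambda>p. f p y)" and meas: "\<And>p. p \<in> S \<Longrightarrow> f p \<in> borel_measurable lborel"
    and h: "integrable lborel h" and bound: "\<And>p y. p \<in> S \<Longrightarrow> norm (f p y) \<le> h y"
  shows "continuous_on S (\<lambda>p. LINT y|lborel. f p y)"
  unfolding continuous_on_sequentially
proof (intro allI ballI impI)
  fix x a assume "a \<in> S" "(\<forall>n. x n \<in> S) \<and> x \<longlonglongrightarrow> a"
  then have a: "a \<in> S" and x: "\<And>n. x n \<in> S" "x \<longlonglongrightarrow> a" by auto
  have "(\<lambda>n. LINT y|lborel. f (x n) y) \<longlonglongrightarrow> (LINT y|lborel. f a y)"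
  proof (rule integral_dominated_convergence[where w = h])
    show "AE y in lborel. (\<lambda>n. f (x n) y) \<longlonglongrightarrow> f a y"
      using cont a x unfolding continuous_on_sequentially by (auto simp: comp_def)
  qed (use a x meas h bound in auto)
  then show "((\<lambda>p. LINT y|lborel. f p y) \<circ> x) \<longlonglongrightarrow> (LINT y|lborel. f a y)" by (simp add: comp_def)
qed

section \<open>The potential in rotated coordinates and the contraction\<close>

text \<open>The potential term \<open>eps ** Qmat z\<close> is diagonal with entries
  \<open>cnj z\<close> and \<open>z\<close>. This is its first component in the coordinates
  \<open>F\<^sub>1 + F\<^sub>2\<close>, \<open>F\<^sub>1 - F\<^sub>2\<close>; the second is the same
  expression with \<open>u\<close> and \<open>v\<close> exchanged.\<close>

definition rot_pot :: "complex \<Rightarrow> complex \<Rightarrow> complex \<Rightarrow> complex" where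
  "rot_pot z u v = of_real (Re z) * u - \<i> * of_real (Im z) * v"

lemma norm_rot_pot: "norm (rot_pot z u v) \<le> norm z * (norm u + norm v)"
proof -
  have "norm (rot_pot z u v) \<le> \<bar>Re z\<bar> * norm u + \<bar>Im z\<bar> * norm v"
    unfolding rot_pot_def by (rule order_trans[OF norm_triangle_ineq4]) (simp add: norm_mult)
  also have "\<dots> \<le> norm z * norm u + norm z * norm v"
    by (intro add_mono mult_right_mono abs_Re_le_cmod abs_Im_le_cmod) auto
  finally show ?thesis by (simp add: algebra_simps)
qed

lemma rot_pot_diff: "rot_pot z u v - rot_pot z u' v' = rot_pot z (u - u') (v - v')"
  by (simp add: rot_pot_def algebra_simps)

lemma rot_pot_mult: "rot_pot z (c * u) (c * v) = c * rot_pot z u v"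
  by (simp add: rot_pot_def algebra_simps)

lemma rot_pot_measurable [measurable]:
  "f \<in> borel_measurable M \<Longrightarrow> u \<in> borel_measurable M \<Longrightarrow> v \<in> borel_measurable M \<Longrightarrow>
    (\<lambda>y. rot_pot (f y) (u y) (v y)) \<in> borel_measurable M"
  unfolding rot_pot_def
  by (intro borel_measurable_diff borel_measurable_times borel_measurable_const)
     (auto intro: borel_measurable_continuous_on[OF continuous_on_of_real] borel_measurable_continuous_on
       intro!: continuous_intros)

lemma rot_pot_integral_bound:
  fixes q g u v :: "real \<Rightarrow> complex"
  assumes q: "integrable lborel q" and g: "g \<in> borel_measurable lborel" and K: "\<And>y. norm (g y) \<le> K"
    and m: "u \<in> borel_measurable lborel" "v \<in> borel_measurable lborel"
    and B: "\<And>y. norm (u y) \<le> B" "\<And>y. norm (v y) \<le> B"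
  shows "integrable lborel (\<lambda>y. g y * rot_pot (q y) (u y) (v y))"
    and "norm (LINT y|lborel. g y * rot_pot (q y) (u y) (v y)) \<le> 2 * K * B * (LINT y|lborel. norm (q y))"
    and "norm (g y * rot_pot (q y) (u y) (v y)) \<le> 2 * K * B * norm (q y)"
proof -
  note [measurable] = g m
  have [measurable]: "q \<in> borel_measurable lborel" using q by auto
  have K0: "K \<ge> 0" using K[of 0] norm_ge_zero order_trans by blast
  have b: "norm (g y * rot_pot (q y) (u y) (v y)) \<le> 2 * K * B * norm (q y)" for y
  proof -
    have "norm (g y * rot_pot (q y) (u y) (v y)) \<le> K * (norm (q y) * (norm (u y) + norm (v y)))"
      unfolding norm_mult using K[of y] norm_rot_pot K0 by (intro mult_mono) auto
    also have "\<dots> \<le> K * (norm (q y) * (B + B))"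
      using B K0 by (intro mult_left_mono add_mono) auto
    finally show ?thesis by (simp add: algebra_simps)
  qed
  then show "norm (g y * rot_pot (q y) (u y) (v y)) \<le> 2 * K * B * norm (q y)" .
  have qi: "integrable lborel (\<lambda>y. 2 * K * B * norm (q y))" using q by auto
  then show i: "integrable lborel (\<lambda>y. g y * rot_pot (q y) (u y) (v y))"
    by (rule Bochner_Integration.integrable_bound) (auto intro!: AE_I2 order_trans[OF b])
  have "norm (LINT y|lborel. g y * rot_pot (q y) (u y) (v y)) \<le> (LINT y|lborel. 2 * K * B * norm (q y))"
    using i qi b by (intro order_trans[OF integral_norm_bound] integral_mono) auto
  then show "norm (LINT y|lborel. g y * rot_pot (q y) (u y) (v y)) \<le> 2 * K * B * (LINT y|lborel. norm (q y))"
    by simp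
qed

text \<open>Banach's fixed point theorem for pairs of bounded continuous functions of
  \<open>(x, z)\<close>. With \<open>Q\<close> the norm of \<open>q\<close> in L1, each component of
  the operator has Lipschitz constant \<open>2 K Q\<close>, so the pair has
  \<open>4 K Q \<le> 1 / 2\<close>. The kernels must be continuous and bounded on all of real times
  complex, which is why they are extended before each use.\<close>

lemma integral_system_solution:
  fixes q :: "real \<Rightarrow> complex" and g1 g2 :: "real \<times> complex \<Rightarrow> real \<Rightarrow> complex"
  assumes q: "integrable lborel q" and small: "8 * K * (LINT y|lborel. norm (q y)) \<le> 1"
    and g1: "\<And>y. continuous_on UNIV (\<lambda>p. g1 p y)" "\<And>p. g1 p \<in> borel_measurable lborel" "\<And>p y. norm (g1 p y) \<le> K"
    and g2: "\<And>y. continuous_on UNIV (\<lambda>p. g2 p y)" "\<And>p. g2 p \<in> borel_measurable lborel" "\<And>p y. norm (g2 p y) \<le> K"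
    and f1: "continuous_on UNIV f1" "\<And>p. norm (f1 p) \<le> B0"
    and f2: "continuous_on UNIV f2" "\<And>p. norm (f2 p) \<le> B0"
  obtains u v :: "real \<times> complex \<Rightarrow> complex"
  where "continuous_on UNIV u" "continuous_on UNIV v" "\<And>p. norm (u p) \<le> 4 * B0" "\<And>p. norm (v p) \<le> 4 * B0"
    "\<And>p. u p = f1 p + (LINT y|lborel. g1 p y * rot_pot (q y) (u (y, snd p)) (v (y, snd p)))"
    "\<And>p. v p = f2 p + (LINT y|lborel. g2 p y * rot_pot (q y) (v (y, snd p)) (u (y, snd p)))"
proof -
  define I where "I g a b p = (LINT y|lborel. g p y * rot_pot (q y) (a (y, snd p)) (b (y, snd p)))"
    for g :: "real \<times> complex \<Rightarrow> real \<Rightarrow> complex" and a b :: "real \<times> complex \<Rightarrow> complex" and p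
  have sect: "(\<lambda>y. a (y, z)) \<in> borel_measurable lborel" if "continuous_on UNIV a" for a :: "real \<times> complex \<Rightarrow> complex" and z
  proof -
    have "continuous_on UNIV (\<lambda>y. a (y, z))"
      by (rule continuous_on_compose2[OF that]) (auto intro!: continuous_intros)
    then show ?thesis using borel_measurable_continuous_onI by simp
  qed
  have Ic: "continuous_on UNIV (I g a b)"
    if g: "\<And>y. continuous_on UNIV (\<lambda>p. g p y)" "\<And>p. g p \<in> borel_measurable lborel" "\<And>p y. norm (g p y) \<le> K"
      and a: "continuous_on UNIV a" "\<And>p. norm (a p) \<le> B" and b: "continuous_on UNIV b" "\<And>p. norm (b p) \<le> B" for g a b B
    unfolding I_def
  proof (rule continuous_on_integral_param[where h = "\<lambda>y. 2 * K * B * norm (q y)"])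
    have ab: "continuous_on UNIV (\<lambda>p. a (y, snd p))" "continuous_on UNIV (\<lambda>p. b (y, snd p))" for y
      by (rule continuous_on_compose2[OF a(1)], auto intro!: continuous_intros)
        (rule continuous_on_compose2[OF b(1)], auto intro!: continuous_intros)
    show "continuous_on UNIV (\<lambda>p. g p y * rot_pot (q y) (a (y, snd p)) (b (y, snd p)))" for y
      unfolding rot_pot_def using ab g(1) by (intro continuous_intros)
    show "integrable lborel (\<lambda>y. 2 * K * B * norm (q y))" using q by auto
    fix p
    show "(\<lambda>y. g p y * rot_pot (q y) (a (y, snd p)) (b (y, snd p))) \<in> borel_measurable lborel"
      using rot_pot_integral_bound(1)[OF q g(2,3) sect[OF a(1)] sect[OF b(1)] a(2) b(2)] by (rule borel_measurable_integrable)
    show "norm (g p y * rot_pot (q y) (a (y, snd p)) (b (y, snd p))) \<le> 2 * K * B * norm (q y)" for y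
      using rot_pot_integral_bound(3)[OF q g(2,3) sect[OF a(1)] sect[OF b(1)] a(2) b(2)] .
  qed
  have Ib: "norm (I g a b p) \<le> 2 * K * B * (LINT y|lborel. norm (q y))"
    if g: "\<And>p. g p \<in> borel_measurable lborel" "\<And>p y. norm (g p y) \<le> K"
      and a: "continuous_on UNIV a" "\<And>p. norm (a p) \<le> B" and b: "continuous_on UNIV b" "\<And>p. norm (b p) \<le> B" for g a b B p
    unfolding I_def by (rule rot_pot_integral_bound(2)[OF q g sect[OF a(1)] sect[OF b(1)] a(2) b(2)])
  have Id: "I g a b p - I g a' b' p = I g (\<lambda>x. a x - a' x) (\<lambda>x. b x - b' x) p"
    if g: "\<And>p. g p \<in> borel_measurable lborel" "\<And>p y. norm (g p y) \<le> K"
      and "continuous_on UNIV a" "\<And>p. norm (a p) \<le> B" "continuous_on UNIV b" "\<And>p. norm (b p) \<le> B"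
        "continuous_on UNIV a'" "\<And>p. norm (a' p) \<le> B'" "continuous_on UNIV b'" "\<And>p. norm (b' p) \<le> B'" for g a b a' b' B B' p
    unfolding I_def rot_pot_diff[symmetric] right_diff_distrib
    by (rule Bochner_Integration.integral_diff[symmetric]; rule rot_pot_integral_bound(1)[OF q g sect sect]; fact that)
  define Q where "Q = (LINT y|lborel. norm (q y))"
  have Q0: "Q \<ge> 0" unfolding Q_def by (rule integral_nonneg_AE) auto
  define T0 where "T0 F = (\<lambda>p. (f1 p + I g1 (\<lambda>x. fst (F x)) (\<lambda>x. snd (F x)) p, f2 p + I g2 (\<lambda>x. snd (F x)) (\<lambda>x. fst (F x)) p))"
    for F :: "real \<times> complex \<Rightarrow> complex \<times> complex"
  define T where "T F = Bcontfun (T0 (apply_bcontfun F))" for F :: "(real \<times> complex) \<Rightarrow>\<^sub>C (complex \<times> complex)"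
  have cF: "continuous_on UNIV (\<lambda>x. fst (F x))" "continuous_on UNIV (\<lambda>x. snd (F x))"
    for F :: "(real \<times> complex) \<Rightarrow>\<^sub>C (complex \<times> complex)"
    by (intro continuous_intros continuous_on_apply_bcontfun)+
  have bF: "norm (fst (F x)) \<le> norm F" "norm (snd (F x)) \<le> norm F" for F :: "(real \<times> complex) \<Rightarrow>\<^sub>C (complex \<times> complex)" and x
    using norm_bounded[of F x] norm_fst_le[of "fst (F x)" "snd (F x)"] norm_snd_le[of "snd (F x)" "fst (F x)"] by auto
  have npair: "norm z \<le> norm (fst z) + norm (snd z)" for z :: "complex \<times> complex"
    using norm_Pair_le[of "fst z" "snd z"] by simp
  have T0: "T0 (apply_bcontfun F) \<in> bcontfun" for F
  proof (rule bcontfun_normI)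
    show "continuous_on UNIV (T0 F)" unfolding T0_def
      using Ic[OF g1 cF(1) bF(1) cF(2) bF(2)] Ic[OF g2 cF(2) bF(2) cF(1) bF(1)] f1 f2
      by (intro continuous_intros)
    fix p
    have "norm (fst (T0 F p)) \<le> B0 + 2 * K * norm F * Q"
      using f1(2)[of p] Ib[where g = g1, OF g1(2,3) cF(1)[of F] bF(1)[of F] cF(2)[of F] bF(2)[of F], where p = p] unfolding T0_def Q_def
      by (auto intro: order_trans[OF norm_triangle_ineq add_mono])
    moreover have "norm (snd (T0 F p)) \<le> B0 + 2 * K * norm F * Q"
      using f2(2)[of p] Ib[where g = g2, OF g2(2,3) cF(2)[of F] bF(2)[of F] cF(1)[of F] bF(1)[of F], where p = p] unfolding T0_def Q_def
      by (auto intro: order_trans[OF norm_triangle_ineq add_mono])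
    ultimately show "norm (T0 F p) \<le> 2 * (B0 + 2 * K * norm F * Q)" using npair[of "T0 F p"] by (simp add: algebra_simps)
  qed
  then have appT: "apply_bcontfun (T F) = T0 (apply_bcontfun F)" for F
    unfolding T_def by (rule Bcontfun_inverse)
  have "4 * K * Q \<le> 1 / 2" using small by (simp add: Q_def)
  have contr: "dist (T F) (T G) \<le> 1 / 2 * dist F G" for F G
  proof (rule dist_bound)
    fix p
    have d: "norm (fst (F x) - fst (G x)) \<le> dist F G" "norm (snd (F x) - snd (G x)) \<le> dist F G" for x
      using bF[of "F - G" x] by (simp_all add: dist_norm)
    have c: "continuous_on UNIV (\<lambda>x. fst (F x) - fst (G x))" "continuous_on UNIV (\<lambda>x. snd (F x) - snd (G x))"
      using cF by (intro continuous_intros; simp)+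
    have "norm (fst (T F p) - fst (T G p)) \<le> 2 * K * dist F G * Q"
      using Ib[where g = g1, OF g1(2,3) c(1) d(1) c(2) d(2), where p = p]
        Id[where g = g1, OF g1(2,3) cF(1)[of F] bF(1)[of F] cF(2)[of F] bF(2)[of F] cF(1)[of G] bF(1)[of G] cF(2)[of G] bF(2)[of G], where p = p]
      by (simp add: appT T0_def Q_def)
    moreover have "norm (snd (T F p) - snd (T G p)) \<le> 2 * K * dist F G * Q"
      using Ib[where g = g2, OF g2(2,3) c(2) d(2) c(1) d(1), where p = p]
        Id[where g = g2, OF g2(2,3) cF(2)[of F] bF(2)[of F] cF(1)[of F] bF(1)[of F] cF(2)[of G] bF(2)[of G] cF(1)[of G] bF(1)[of G], where p = p]
      by (simp add: appT T0_def Q_def)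
    ultimately have "dist (T F p) (T G p) \<le> (4 * K * Q) * dist F G"
      using npair[of "T F p - T G p"] by (simp add: dist_norm algebra_simps)
    also have "\<dots> \<le> 1 / 2 * dist F G"
      using \<open>4 * K * Q \<le> 1 / 2\<close> by (intro mult_right_mono) auto
    finally show "dist (T F p) (T G p) \<le> 1 / 2 * dist F G" .
  qed
  obtain F where F: "T F = F"
    using banach_fix_type[of "1/2" T] contr by auto
  define u where "u x = fst (F x)" for x
  define v where "v x = snd (F x)" for x
  have eq: "u p = f1 p + I g1 u v p" "v p = f2 p + I g2 v u p" for p
    using fun_cong[OF appT[of F], of p] unfolding F
    by (simp_all add: T0_def u_def[abs_def, symmetric] v_def[abs_def, symmetric] prod_eq_iff) (simp_all add: u_def v_def)
  \<comment> \<open>The fixed point equation gives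
    \<open>norm F \<le> 2 B0 + norm F / 2\<close>.\<close>
  have "norm F \<le> 4 * B0"
  proof -
    have "norm F \<le> 2 * B0 + 1 / 2 * norm F"
    proof (rule norm_bound)
      fix p
      have "norm (u p) \<le> B0 + 2 * K * norm F * Q" 
        using f1(2)[of p] Ib[where g = g1, OF g1(2,3) cF(1)[of F] bF(1)[of F] cF(2)[of F] bF(2)[of F], where p = p] unfolding eq(1)[of p] Q_def
        by (intro order_trans[OF norm_triangle_ineq add_mono]) (simp_all add: u_def[abs_def] v_def[abs_def])
      moreover have "norm (v p) \<le> B0 + 2 * K * norm F * Q" 
        using f2(2)[of p] Ib[where g = g2, OF g2(2,3) cF(2)[of F] bF(2)[of F] cF(1)[of F] bF(1)[of F], where p = p] unfolding eq(2)[of p] Q_def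
        by (intro order_trans[OF norm_triangle_ineq add_mono]) (simp_all add: u_def[abs_def] v_def[abs_def])
      moreover have "(4 * K * Q) * norm F \<le> 1 / 2 * norm F"
        using \<open>4 * K * Q \<le> 1 / 2\<close> by (intro mult_right_mono) auto
      ultimately show "norm (F p) \<le> 2 * B0 + 1 / 2 * norm F"
        using npair[of "F p"] by (simp add: u_def v_def algebra_simps)
    qed
    then show ?thesis by simp
  qed
  show thesis
  proof
    show "continuous_on UNIV u" "continuous_on UNIV v" unfolding u_def v_def using cF by auto
    show "norm (u p) \<le> 4 * B0" "norm (v p) \<le> 4 * B0" for p
      using bF[of F p] \<open>norm F \<le> 4 * B0\<close> by (auto simp: u_def v_def)
  qed (fact eq[unfolded I_def])+
qed

section \<open>The Dirichlet Green function of the free equation\<close>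

lemma primitive_exp: "primitive (\<lambda>x. exp (w * of_real x)) (\<lambda>x. w * exp (w * of_real x))"
proof (rule primitive_of_deriv)
  fix x :: real
  have "((\<lambda>z. exp (w * z)) has_field_derivative w * exp (w * of_real x)) (at (of_real x))"
    by (auto intro!: derivative_eq_intros)
  then show "((\<lambda>x. exp (w * of_real x)) has_vector_derivative w * exp (w * of_real x)) (at x within {0..})"
    by (rule has_vector_derivative_real_field)
qed (auto intro!: continuous_intros)

text \<open>The constants are left free so that one formula serves the decaying solution, where
  \<open>\<alpha>\<close> cancels the limit of \<open>A\<close> at infinity, and the solution
  vanishing at 0, where \<open>\<alpha> = \<beta>\<close>.\<close>

lemma variation_of_parameters:
  fixes h :: "real \<Rightarrow> complex" and \<alpha> \<beta> :: complex
  assumes w: "w \<noteq> 0" and h: "\<And>x. h absolutely_integrable_on {0..x}"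
  defines "A \<equiv> \<lambda>x. integral {0..x} (\<lambda>t. exp (- w * of_real t) * h t)"
    and "B \<equiv> \<lambda>x. integral {0..x} (\<lambda>t. exp (w * of_real t) * h t)"
  defines "u \<equiv> \<lambda>x. (exp (w * of_real x) * (\<alpha> + A x) - exp (- w * of_real x) * (\<beta> + B x)) / (2 * w)"
    and "u' \<equiv> \<lambda>x. (exp (w * of_real x) * (\<alpha> + A x) + exp (- w * of_real x) * (\<beta> + B x)) / 2"
  shows "primitive u u'" "primitive u' (\<lambda>x. w\<^sup>2 * u x + h x)"
proof -
  have e: "primitive (\<lambda>x. integral {0..x} (\<lambda>t. exp (s * of_real t) * h t)) (\<lambda>t. exp (s * of_real t) * h t)" for s
    by (intro primitive_integral absint_continuous_mult h continuous_intros)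
  have gen: "primitive (\<lambda>x. exp (- s * of_real x) * (\<gamma> + integral {0..x} (\<lambda>t. exp (s * of_real t) * h t)))
      (\<lambda>x. h x - s * (exp (- s * of_real x) * (\<gamma> + integral {0..x} (\<lambda>t. exp (s * of_real t) * h t))))" for s \<gamma>
    by (rule primitive_cong[OF primitive_mult[OF primitive_exp[of "-s"] primitive_add[OF primitive_const[of \<gamma>] e[of s]]]])
       (simp_all add: exp_minus field_simps)
  have A: "primitive (\<lambda>x. exp (w * of_real x) * (\<alpha> + A x)) (\<lambda>x. h x + w * (exp (w * of_real x) * (\<alpha> + A x)))"
    using gen[of "-w" \<alpha>] unfolding A_def by simp
  have B: "primitive (\<lambda>x. exp (- w * of_real x) * (\<beta> + B x)) (\<lambda>x. h x - w * (exp (- w * of_real x) * (\<beta> + B x)))"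
    using gen[of "w" \<beta>] unfolding B_def by simp
  show "primitive u u'"
    by (rule primitive_cong[OF primitive_cmult[OF primitive_diff[OF A B], of "1 / (2 * w)"]])
       (simp_all add: u_def u'_def field_simps w)
  show "primitive u' (\<lambda>x. w\<^sup>2 * u x + h x)"
    by (rule primitive_cong[OF primitive_cmult[OF primitive_add[OF A B], of "1 / 2"]])
       (simp_all add: u_def u'_def field_simps w power2_eq_square)
qed

text \<open>The Dirichlet Green function of \<open>u'' - w\<^sup>2 u\<close> on the half-line, for \<open>Re w \<ge> 0\<close>.\<close>

definition green :: "complex \<Rightarrow> real \<Rightarrow> real \<Rightarrow> complex" where
  "green w x y = - (exp (- w * of_real \<bar>x - y\<bar>) - exp (- w * of_real (x + y))) / (2 * w)"

lemma set_integrable_lborel_absint: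
  fixes f :: "real \<Rightarrow> complex"
  assumes "set_integrable lborel S f"
  shows "f absolutely_integrable_on S"
  using assms unfolding set_integrable_def
  by (simp add: integrable_completion borel_measurable_integrable)

lemma norm_exp_decay:
  assumes "Re w \<ge> 0" "t \<ge> 0" shows "norm (exp (- w * of_real t)) \<le> 1"
  using assms by (simp add: norm_exp_eq_Re)

text \<open>Splitting the kernel at \<open>y = x\<close> and writing the tail beyond
  \<open>x\<close> as \<open>H\<close> minus the part up to \<open>x\<close> turns the Green
  integral into the variation of parameters formula with both constants equal to
  \<open>- H\<close>.\<close>

lemma green_integral:
  fixes h :: "real \<Rightarrow> complex"
  assumes w: "w \<noteq> 0" "Re w \<ge> 0" and h: "integrable lborel h" "\<And>y. y \<le> 0 \<Longrightarrow> h y = 0" and x: "x \<ge> 0"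
  defines "H \<equiv> LINT y|lborel. exp (- w * of_real y) * h y"
  shows "(LINT y|lborel. green w x y * h y) =
     (exp (w * of_real x) * (- H + integral {0..x} (\<lambda>t. exp (- w * of_real t) * h t))
     - exp (- w * of_real x) * (- H + integral {0..x} (\<lambda>t. exp (w * of_real t) * h t))) / (2 * w)"
proof -
  have [measurable]: "h \<in> borel_measurable lborel" using h by auto
  have iH: "integrable lborel (\<lambda>y. exp (- w * of_real y) * h y)"
  proof (rule Bochner_Integration.integrable_bound[OF h(1)])
    show "AE y in lborel. norm (exp (- w * of_real y) * h y) \<le> norm (h y)"
    proof (rule AE_I2)
      fix y show "norm (exp (- w * of_real y) * h y) \<le> norm (h y)"
        using h(2)[of y] norm_exp_decay[OF w(2), of y] by (cases "y \<le> 0") (auto simp: norm_mult intro!: mult_left_le_one_le)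
    qed
  qed measurable
  have iI: "set_integrable lborel {0..x} (\<lambda>y. exp (s * of_real y) * h y)" for s
  proof -
    have "(\<lambda>y. exp (s * of_real y) * h y) absolutely_integrable_on {0..x}"
      by (intro absint_continuous_mult set_integrable_lborel_absint continuous_intros)
         (auto simp: set_integrable_def intro: integrable_mult_indicator h)
    then show ?thesis unfolding set_integrable_def
      by (subst (asm) integrable_completion) auto
  qed
  let ?i = "\<lambda>s y. indicator {0..x} y *\<^sub>R (exp (s * of_real y) * h y)"
  have iI': "integrable lborel (?i s)" for s using iI[of s] by (simp add: set_integrable_def)
  have eqI: "(LINT y|lborel. ?i s y) = integral {0..x} (\<lambda>t. exp (s * of_real t) * h t)" for s
    using set_borel_integral_eq_integral(2)[OF iI[of s]] by (simp add: set_lebesgue_integral_def)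
  let ?e = "exp (w * of_real x)" and ?f = "exp (- w * of_real x)"
  have pt: "green w x y * h y = (1 / (2 * w)) * (?e * (?i (- w) y - exp (- w * of_real y) * h y)
       - ?f * (?i w y - exp (- w * of_real y) * h y))" for y
  proof -
    consider "y \<le> 0" | "0 < y" "y \<le> x" | "x < y" by linarith
    then show ?thesis
    proof cases
      case 1 then show ?thesis using h(2)[of y] by simp
    next
      case 2
      then have "\<bar>x - y\<bar> = x - y" by simp
      then have "exp (- w * of_real \<bar>x - y\<bar>) = ?f * exp (w * of_real y)" "exp (- w * of_real (x + y)) = ?f * exp (- w * of_real y)"
        by (simp_all add: exp_add[symmetric] algebra_simps)
      then show ?thesis using 2 w unfolding green_def by (simp add: field_simps)
    next
      case 3
      then have "\<bar>x - y\<bar> = y - x" by simp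
      then have "exp (- w * of_real \<bar>x - y\<bar>) = ?e * exp (- w * of_real y)" "exp (- w * of_real (x + y)) = ?f * exp (- w * of_real y)"
        by (simp_all add: exp_add[symmetric] algebra_simps)
      then show ?thesis using 3 w unfolding green_def by (simp add: field_simps)
    qed
  qed
  define F1 where "F1 = ?i (- w)"
  define F2 where "F2 = ?i w"
  define F3 where "F3 = (\<lambda>y. exp (- w * of_real y) * h y)"
  have F: "integrable lborel F1" "integrable lborel F2" "integrable lborel F3"
    unfolding F1_def F2_def F3_def by (rule iI' iH)+
  have "(LINT y|lborel. green w x y * h y) = (LINT y|lborel. (1 / (2 * w)) * (?e * (F1 y - F3 y) - ?f * (F2 y - F3 y)))"
    unfolding pt F1_def F2_def F3_def ..
  also have "\<dots> = (1 / (2 * w)) * (?e * ((LINT y|lborel. F1 y) - H) - ?f * ((LINT y|lborel. F2 y) - H))"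
    using F unfolding H_def F3_def[symmetric] by (simp del: times_divide_eq_left)
  finally have "(LINT y|lborel. green w x y * h y) = (1 / (2 * w)) * (?e * ((LINT y|lborel. ?i (- w) y) - H)
       - ?f * ((LINT y|lborel. ?i w y) - H))"
    unfolding F1_def F2_def .
  then show ?thesis unfolding eqI by (simp add: field_simps)
qed

text \<open>Both exponentials of the kernel absorb the weight, since
  \<open>Re w \<bar>x - y\<bar>\<close> and \<open>Re w (x + y)\<close> are at least
  \<open>c (x - y)\<close>; two terms of size at most 1 over \<open>2 norm w\<close> give the
  constant.\<close>

lemma green_bound:
  assumes "w \<noteq> 0" "0 \<le> c" "c \<le> Re w" "x \<ge> 0" "y \<ge> 0"
  shows "norm (green w x y * exp (of_real (c * (x - y)))) \<le> 1 / norm w"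
proof -
  have 1: "Re w * \<bar>x - y\<bar> \<ge> c * \<bar>x - y\<bar>" using assms by (intro mult_right_mono) auto
  have 2: "c * \<bar>x - y\<bar> \<ge> c * (x - y)" using assms by (intro mult_left_mono) auto
  have 3: "Re w * (x + y) \<ge> Re w * \<bar>x - y\<bar>" using assms by (intro mult_left_mono) auto
  have "norm (green w x y * exp (of_real (c * (x - y)))) =
     norm (exp (- w * of_real \<bar>x - y\<bar>) - exp (- w * of_real (x + y))) * exp (c * (x - y)) / (2 * norm w)"
    unfolding green_def by (simp add: norm_mult norm_divide norm_exp_eq_Re norm_minus_commute)
  also have "\<dots> \<le> (exp (- (Re w * \<bar>x - y\<bar>)) + exp (- (Re w * (x + y)))) * exp (c * (x - y)) / (2 * norm w)"
    using assms by (intro divide_right_mono mult_right_mono order_trans[OF norm_triangle_ineq4]) (auto simp: norm_exp_eq_Re)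
  also have "\<dots> = (exp (- (Re w * \<bar>x - y\<bar>) + c * (x - y)) + exp (- (Re w * (x + y)) + c * (x - y))) / (2 * norm w)"
    unfolding exp_add by (simp only: distrib_right)
  also have "\<dots> \<le> (1 + 1) / (2 * norm w)"
    using assms 1 2 3 by (intro divide_right_mono add_mono) auto
  finally show ?thesis using assms by simp
qed

text \<open>A nonintegrable \<open>f\<close> has integral 0 by convention, and the integral of
  \<open>g\<close> is nonnegative.\<close>

lemma norm_integral_le:
  fixes f :: "'a \<Rightarrow> 'b::{banach,second_countable_topology}"
  assumes g: "integrable M g" and le: "\<And>x. norm (f x) \<le> g x"
  shows "norm (integral\<^sup>L M f) \<le> integral\<^sup>L M g"
proof (cases "integrable M f")
  case True
  then show ?thesis using g le by (intro order_trans[OF integral_norm_bound integral_mono]) auto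
next
  case False
  have "g x \<ge> 0" for x using order_trans[OF norm_ge_zero le] .
  then show ?thesis using False by (simp add: not_integrable_integral_eq integral_nonneg_AE)
qed

text \<open>The point beyond the equation is that the derivative decays like the weight
  \<open>exp (- c x)\<close>. The formula for \<open>u'\<close> involves \<open>K1 + K2\<close>;
  substituting \<open>K2 = K1 - 2 w G\<close> leaves the tail integral \<open>K1\<close> and the
  Green integral, each bounded by the integral of \<open>M\<close> times the weight after
  multiplying \<open>G\<close> by \<open>w\<close>.\<close>

lemma green_solution:
  fixes h u :: "real \<Rightarrow> complex" and M :: "real \<Rightarrow> real"
  assumes w: "w \<noteq> 0" "0 \<le> c" "c \<le> Re w" and h: "integrable lborel h" "\<And>y. y \<le> 0 \<Longrightarrow> h y = 0"
    and M: "integrable lborel M" "\<And>y. norm (h y) \<le> M y * exp (- (c * y))"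
    and u: "\<And>x. x \<ge> 0 \<Longrightarrow> u x = s * exp (- w * of_real x) + (LINT y|lborel. green w x y * h y)"
  shows "\<exists>u'. primitive u u' \<and> primitive u' (\<lambda>x. w\<^sup>2 * u x + h x) \<and>
    u' 0 = - s * w - (LINT y|lborel. exp (- w * of_real y) * h y) \<and>
    (\<forall>x\<ge>0. norm (u' x) \<le> (norm (s * w) + 2 * (LINT y|lborel. M y)) * exp (- (c * x)))"
proof -
  define H where "H = (LINT y|lborel. exp (- w * of_real y) * h y)"
  define A where "A x = integral {0..x} (\<lambda>t. exp (- w * of_real t) * h t)" for x
  define B where "B x = integral {0..x} (\<lambda>t. exp (w * of_real t) * h t)" for x
  define K1 where "K1 x = exp (w * of_real x) * (- H + A x)" for x
  define K2 where "K2 x = exp (- w * of_real x) * (- H + B x)" for x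
  define G where "G x = (LINT y|lborel. green w x y * h y)" for x
  have Rew: "Re w \<ge> 0" using w by linarith
  have M0: "M y \<ge> 0" for y
    using order_trans[OF norm_ge_zero M(2)[of y]] by (simp add: zero_le_mult_iff)
  have [measurable]: "h \<in> borel_measurable lborel" using h by auto
  have iI: "set_integrable lborel {0..x} h" for x
    using h unfolding set_integrable_def by (auto intro: integrable_mult_indicator)
  have hloc: "h absolutely_integrable_on {0..x}" for x
    by (rule set_integrable_lborel_absint[OF iI])
  have G: "G x = (K1 x - K2 x) / (2 * w)" if "x \<ge> 0" for x
    unfolding G_def K1_def K2_def A_def B_def H_def by (rule green_integral[OF w(1) Rew h that])
  have iH: "integrable lborel (\<lambda>y. exp (- w * of_real y) * h y)"
  proof (rule Bochner_Integration.integrable_bound[OF h(1)])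
    show "AE y in lborel. norm (exp (- w * of_real y) * h y) \<le> norm (h y)"
    proof (rule AE_I2)
      fix y show "norm (exp (- w * of_real y) * h y) \<le> norm (h y)"
        using h(2)[of y] norm_exp_decay[OF Rew, of y] by (cases "y \<le> 0") (auto simp: norm_mult intro!: mult_left_le_one_le)
    qed
  qed measurable
  \<comment> \<open>The part of the integral up to \<open>x\<close> cancels against
    \<open>H\<close>, so only \<open>y > x\<close> remains, where \<open>exp (Re w (x - y))\<close>
    and the decay of \<open>h\<close> combine.\<close>
  have K1b: "norm (K1 x) \<le> (LINT y|lborel. M y) * exp (- (c * x))" if x: "x \<ge> 0" for x
  proof -
    define F1 where "F1 = (\<lambda>y. indicator {0..x} y *\<^sub>R (exp (- w * of_real y) * h y))"
    define F3 where "F3 = (\<lambda>y. exp (- w * of_real y) * h y)"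
    have i: "integrable lborel F1" "integrable lborel F3"
      using iH unfolding F1_def F3_def by (auto intro: integrable_mult_indicator)
    have "set_integrable lborel {0..x} (\<lambda>y. exp (- w * of_real y) * h y)"
      using i(1) unfolding F1_def set_integrable_def .
    from set_borel_integral_eq_integral(2)[OF this] have "A x = (LINT y|lborel. F1 y)"
      by (simp add: A_def F1_def set_lebesgue_integral_def)
    then have "K1 x = (LINT y|lborel. exp (w * of_real x) * (F1 y - F3 y))"
      using i unfolding K1_def H_def F3_def[symmetric] by simp
    also have "norm \<dots> \<le> (LINT y|lborel. norm (exp (w * of_real x) * (F1 y - F3 y)))"
      by (rule integral_norm_bound)
    also have "\<dots> \<le> (LINT y|lborel. M y * exp (- (c * x)))"
    proof (rule integral_mono)
      show "integrable lborel (\<lambda>y. norm (exp (w * of_real x) * (F1 y - F3 y)))" using i by auto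
      show "integrable lborel (\<lambda>y. M y * exp (- (c * x)))" using M by auto
      fix y
      consider "y \<le> 0" | "0 < y" "y \<le> x" | "x < y" by linarith
      then show "norm (exp (w * of_real x) * (F1 y - F3 y)) \<le> M y * exp (- (c * x))"
      proof cases
        case 1 then show ?thesis using M0[of y] h(2)[of y] by (auto simp: F1_def F3_def)
      next
        case 2 then show ?thesis using M0[of y] by (auto simp: F1_def F3_def)
      next
        case 3
        then have "norm (exp (w * of_real x) * (F1 y - F3 y)) = exp (Re w * x - Re w * y) * norm (h y)"
          by (simp add: F1_def F3_def norm_mult norm_inverse norm_exp_eq_Re exp_diff exp_minus divide_inverse)
        also have "\<dots> \<le> exp (Re w * x - Re w * y) * (M y * exp (- (c * y)))"
          using M(2) by (intro mult_left_mono) auto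
        also have "\<dots> = M y * exp (- (c * x)) * exp ((Re w + c) * (x - y))"
          by (simp add: exp_add[symmetric] algebra_simps)
        also have "\<dots> \<le> M y * exp (- (c * x)) * 1"
          using 3 w M0[of y] by (intro mult_left_mono) (auto simp: mult_nonneg_nonpos)
        finally show ?thesis by simp
      qed
    qed
    also have "\<dots> = (LINT y|lborel. M y) * exp (- (c * x))" by simp
    finally show ?thesis .
  qed
  have Gb: "norm (G x) \<le> 1 / norm w * ((LINT y|lborel. M y) * exp (- (c * x)))" if x: "x \<ge> 0" for x
  proof -
    have "norm (G x) \<le> (LINT y|lborel. 1 / norm w * (M y * exp (- (c * x))))"
      unfolding G_def
    proof (rule norm_integral_le)
      show "integrable lborel (\<lambda>y. 1 / norm w * (M y * exp (- (c * x))))" using M by auto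
      show "norm (green w x y * h y) \<le> 1 / norm w * (M y * exp (- (c * x)))" for y
      proof (cases "y \<le> 0")
        case True then show ?thesis using M0[of y] h(2)[of y] by simp
      next
        case False
        have "norm (green w x y * h y) \<le> norm (green w x y) * (M y * exp (- (c * y)))"
          unfolding norm_mult using M(2) by (intro mult_left_mono) auto
        also have "\<dots> = norm (green w x y * exp (of_real (c * (x - y)))) * (M y * exp (- (c * x)))"
          by (simp add: norm_mult norm_divide norm_exp_eq_Re exp_diff exp_minus field_simps)
        also have "\<dots> \<le> 1 / norm w * (M y * exp (- (c * x)))"
          using green_bound[OF w, of x y] x False M0[of y] by (intro mult_right_mono) auto
        finally show ?thesis .
      qed
    qed
    then show ?thesis by simp
  qed
  \<comment> \<open>The constant \<open>- 2 s w - H\<close> absorbs the free solution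
    \<open>s exp (- w x)\<close> into the variation of parameters formula.\<close>
  define u' where "u' x = (exp (w * of_real x) * (- H + A x) + exp (- w * of_real x) * ((- 2 * s * w - H) + B x)) / 2" for x
  have ueq: "u x = (exp (w * of_real x) * (- H + A x) - exp (- w * of_real x) * ((- 2 * s * w - H) + B x)) / (2 * w)" if "x \<ge> 0" for x
    using u[OF that] G[OF that] w unfolding G_def K1_def K2_def by (simp add: field_simps)
  note vp = variation_of_parameters[OF w(1) hloc, where \<alpha> = "- H" and \<beta> = "- 2 * s * w - H", folded A_def B_def]
  have p1: "primitive u u'"
    by (rule primitive_cong[OF vp(1)]) (simp_all add: ueq u'_def)
  have p2: "primitive u' (\<lambda>x. w\<^sup>2 * u x + h x)"
    by (rule primitive_cong[OF vp(2)]) (simp_all add: ueq u'_def)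
  have u'0: "u' 0 = - s * w - H" by (simp add: u'_def A_def B_def)
  have "norm (u' x) \<le> (norm (s * w) + 2 * (LINT y|lborel. M y)) * exp (- (c * x))" if x: "x \<ge> 0" for x
  proof -
    have "u' x = K1 x - w * G x - s * w * exp (- w * of_real x)"
      using G[OF x] w by (simp add: u'_def K1_def K2_def field_simps)
    also have "norm \<dots> \<le> norm (K1 x) + norm (w * G x) + norm (s * w * exp (- w * of_real x))"
      by (intro order_trans[OF norm_triangle_ineq4] add_mono order_refl)
    also have "norm (w * G x) \<le> (LINT y|lborel. M y) * exp (- (c * x))"
      using mult_left_mono[OF Gb[OF x], of "norm w"] w by (simp add: norm_mult)
    also have "norm (s * w * exp (- w * of_real x)) \<le> norm (s * w) * exp (- (c * x))"
      unfolding norm_mult using w x by (intro mult_left_mono) (auto simp: norm_exp_eq_Re mult_right_mono)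
    finally show ?thesis using K1b[OF x] by (simp add: algebra_simps)
  qed
  then show ?thesis using p1 p2 u'0 unfolding H_def by blast
qed

section \<open>Decaying and regular solutions\<close>

text \<open>It contains the square roots of the spectral parameters near \<open>k\<^sup>2\<close> on
  and above the real axis. \<open>Re z \<ge> k / 2\<close> keeps \<open>1 / norm z\<close> below
  \<open>2 / k\<close>, and \<open>Im z \<le> k / 2 \<le> Re z\<close> makes
  \<open>exp (- Im z x)\<close> the slower of the two free decays, hence a common weight.\<close>

definition spectral_strip :: "real \<Rightarrow> complex set" where
  "spectral_strip k = {z. k / 2 \<le> Re z \<and> 0 \<le> Im z \<and> Im z \<le> k / 2}"

text \<open>\<open>q\<close> is a Borel function vanishing off the half-line, so that half-line
  integrals become integrals over \<open>lborel\<close>. The factor 16 is what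
  \<open>integral_system_solution\<close> asks for with kernel bound
  \<open>K = 2 / k\<close>.\<close>

locale small_potential =
  fixes q :: "real \<Rightarrow> complex" and k :: real
  assumes k: "k > 0" and q: "integrable lborel q" and q0: "\<And>y. y \<le> 0 \<Longrightarrow> q y = 0"
    and small: "16 * (LINT y|lborel. norm (q y)) \<le> k"
begin

lemma spectral_strip_norm: "z \<in> spectral_strip k \<Longrightarrow> norm z \<ge> k / 2"
  using abs_Re_le_cmod[of z] by (auto simp: spectral_strip_def)

lemma spectral_strip_nz: "z \<in> spectral_strip k \<Longrightarrow> z \<noteq> 0"
  using k by (auto simp: spectral_strip_def)

lemma absint_rot_pot:
  assumes "continuous_on UNIV a" "continuous_on UNIV b"
  shows "(\<lambda>y. rot_pot (q y) (a y) (b y)) absolutely_integrable_on {0..x}"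
proof -
  have q': "q absolutely_integrable_on {0..x}"
    using q by (intro set_integrable_lborel_absint) (auto simp: set_integrable_def intro: integrable_mult_indicator)
  have "(\<lambda>y. complex_of_real (Re (q y))) absolutely_integrable_on {0..x}"
    "(\<lambda>y. complex_of_real (Im (q y))) absolutely_integrable_on {0..x}"
    using q' by (auto intro!: absolutely_integrable_linear[OF q', unfolded comp_def]
        bounded_linear_compose[OF bounded_linear_of_real] bounded_linear_Re bounded_linear_Im)
  then have "(\<lambda>y. a y * complex_of_real (Re (q y)) - (\<i> * b y) * complex_of_real (Im (q y))) absolutely_integrable_on {0..x}"
    using assms by (intro set_integral_diff(1) absint_continuous_mult continuous_intros) (auto elim: continuous_on_subset)
  then show ?thesis by (simp add: rot_pot_def algebra_simps)
qed

text \<open>For \<open>\<sigma> = -1\<close> and \<open>\<sigma> = 1\<close> the boundary values, in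
  the original coordinates, are the two columns of \<open>eps\<close>. The constant \<open>D\<close>
  may depend on \<open>z\<close>; the bound expresses decay only when
  \<open>Im z > 0\<close>.\<close>

definition weyl_data where
  "weyl_data u u' v v' \<sigma> z \<longleftrightarrow> primitive u u' \<and> primitive v v' \<and>
    primitive u' (\<lambda>x. - z\<^sup>2 * u x + rot_pot (q x) (u x) (v x)) \<and>
    primitive v' (\<lambda>x. z\<^sup>2 * v x + rot_pot (q x) (v x) (u x)) \<and> u 0 = 1 \<and> v 0 = \<sigma> \<and>
    (\<exists>D. \<forall>x\<ge>0. norm (u x) \<le> D * exp (- (Im z * x)) \<and> norm (v x) \<le> D * exp (- (Im z * x)) \<and>
       norm (u' x) \<le> D * exp (- (Im z * x)) \<and> norm (v' x) \<le> D * exp (- (Im z * x)))"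

text \<open>The derivatives at 0 are explicit integrals against the solution, hence continuous in
  \<open>z\<close> down to the real axis. With \<open>Q\<close> the norm of \<open>q\<close> in L1,
  the solution differs from the free one by at most \<open>16 Q / k\<close>: kernel bound
  \<open>2 / k\<close> times the source bound \<open>8 norm q\<close>. Integrating this error
  against \<open>q\<close>, in both components, gives
  \<open>2 Q (16 Q / k) = 32 Q\<^sup>2 / k\<close>.\<close>

lemma weyl_solution:
  assumes \<sigma>: "norm \<sigma> \<le> 1"
  obtains u u' v v' :: "real \<Rightarrow> complex \<Rightarrow> complex" where
    "\<And>z. z \<in> spectral_strip k \<Longrightarrow> weyl_data (\<lambda>x. u x z) (\<lambda>x. u' x z) (\<lambda>x. v x z) (\<lambda>x. v' x z) \<sigma> z"
    "continuous_on (spectral_strip k) (u' 0)" "continuous_on (spectral_strip k) (v' 0)"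
    "\<And>z. z \<in> spectral_strip k \<Longrightarrow> norm (u' 0 z - (\<i> * z - (LINT y|lborel. exp (\<i> * z * of_real y) *
        rot_pot (q y) (exp (\<i> * z * of_real y)) (\<sigma> * exp (- z * of_real y))))) \<le> 32 / k * (LINT y|lborel. norm (q y))\<^sup>2"
    "\<And>z. z \<in> spectral_strip k \<Longrightarrow> norm (v' 0 z - (- \<sigma> * z - (LINT y|lborel. exp (- z * of_real y) *
        rot_pot (q y) (\<sigma> * exp (- z * of_real y)) (exp (\<i> * z * of_real y))))) \<le> 32 / k * (LINT y|lborel. norm (q y))\<^sup>2"
proof -
  define Q where "Q = (LINT y|lborel. norm (q y))"
  have Q0: "Q \<ge> 0" unfolding Q_def by (rule integral_nonneg_AE) auto
  have Qk: "16 * Q \<le> k" using small by (simp add: Q_def)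
  have qm [measurable]: "q \<in> borel_measurable borel" using q by auto
  \<comment> \<open>A retraction of the plane onto the strip. With absolute values on
    \<open>x\<close> and \<open>y\<close>, it makes the weighted kernels continuous and bounded for
    all parameters.\<close>
  define \<kappa> where "\<kappa> z = Complex (max (k/2) (Re z)) (max 0 (min (k/2) (Im z)))" for z
  have \<kappa>s: "\<kappa> z \<in> spectral_strip k" for z using k by (auto simp: \<kappa>_def spectral_strip_def)
  have \<kappa>id: "\<kappa> z = z" if "z \<in> spectral_strip k" for z using that by (auto simp: \<kappa>_def spectral_strip_def complex_eq_iff)
  have \<kappa>c: "continuous_on UNIV \<kappa>" unfolding \<kappa>_def by (intro continuous_intros)
  have \<kappa>c': "continuous_on UNIV (\<lambda>p. \<kappa> (snd p))" for p :: "real \<times> complex"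
    by (rule continuous_on_compose2[OF \<kappa>c]) (auto intro!: continuous_intros)
  define g where "g w p y = green (w (\<kappa> (snd p))) \<bar>fst p\<bar> \<bar>y\<bar> * exp (of_real (Im (\<kappa> (snd p)) * (\<bar>fst p\<bar> - \<bar>y\<bar>)))"
    for w :: "complex \<Rightarrow> complex" and p :: "real \<times> complex" and y
  define f where "f w p = exp (- w (\<kappa> (snd p)) * of_real \<bar>fst p\<bar> + of_real (Im (\<kappa> (snd p)) * \<bar>fst p\<bar>))"
    for w :: "complex \<Rightarrow> complex" and p :: "real \<times> complex"
  \<comment> \<open>What the exponents \<open>- \<i> z\<close> and \<open>z\<close> have in common,
    so that each kernel estimate is proved once.\<close>
  define adm where "adm w \<longleftrightarrow> continuous_on UNIV w \<and> (\<forall>z\<in>spectral_strip k. norm (w z) = norm z \<and> Im z \<le> Re (w z))"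
    for w :: "complex \<Rightarrow> complex"
  have gf: "continuous_on UNIV (\<lambda>p. g w p y)" "g w p \<in> borel_measurable lborel" "norm (g w p y) \<le> 2 / k"
     "continuous_on UNIV (f w)" "norm (f w p) \<le> 1" if w: "adm w" for w p y
  proof -
    have wc: "continuous_on UNIV (\<lambda>p. w (\<kappa> (snd p)))"
      by (rule continuous_on_compose2[OF _ \<kappa>c']) (use w in \<open>auto simp: adm_def\<close>)
    have nz: "w (\<kappa> z) \<noteq> 0" for z using w \<kappa>s[of z] spectral_strip_nz[of "\<kappa> z"] unfolding adm_def by force
    show "continuous_on UNIV (\<lambda>p. g w p y)" unfolding g_def green_def
      by (intro continuous_intros wc \<kappa>c') (use nz in auto)
    show "continuous_on UNIV (f w)" unfolding f_def by (intro continuous_intros wc \<kappa>c')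
    show "g w p \<in> borel_measurable lborel" unfolding g_def[abs_def] green_def by measurable
    have a: "0 \<le> Im (\<kappa> (snd p))" "Im (\<kappa> (snd p)) \<le> Re (w (\<kappa> (snd p)))" "norm (w (\<kappa> (snd p))) \<ge> k / 2"
      using \<kappa>s[of "snd p"] w spectral_strip_norm[OF \<kappa>s[of "snd p"]] by (auto simp: adm_def spectral_strip_def)
    have "norm (g w p y) \<le> 1 / norm (w (\<kappa> (snd p)))"
      unfolding g_def using a nz by (intro green_bound) auto
    also have "\<dots> \<le> 1 / (k / 2)" using a k by (intro divide_left_mono mult_pos_pos) auto
    finally show "norm (g w p y) \<le> 2 / k" by simp
    have "Im (\<kappa> (snd p)) * \<bar>fst p\<bar> \<le> Re (w (\<kappa> (snd p))) * \<bar>fst p\<bar>" using a by (intro mult_right_mono) auto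
    then show "norm (f w p) \<le> 1" unfolding f_def by (simp add: norm_exp_eq_Re)
  qed
  define wa where "wa z = - \<i> * z" for z :: complex
  define wb where "wb z = z" for z :: complex
  have adm: "adm wa" "adm wb" using k
    by (auto simp: adm_def wa_def wb_def spectral_strip_def norm_mult intro!: continuous_intros)
  obtain U V :: "real \<times> complex \<Rightarrow> complex" where UV: "continuous_on UNIV U" "continuous_on UNIV V" "\<And>p. norm (U p) \<le> 4 * 1" "\<And>p. norm (V p) \<le> 4 * 1"
    "\<And>p. U p = f wa p + (LINT y|lborel. g wa p y * rot_pot (q y) (U (y, snd p)) (V (y, snd p)))"
    "\<And>p. V p = \<sigma> * f wb p + (LINT y|lborel. g wb p y * rot_pot (q y) (V (y, snd p)) (U (y, snd p)))"
  proof -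
    note UV_obtain = that
    show ?thesis
    proof (rule integral_system_solution[OF q, of "2 / k" "g wa" "g wb" "f wa" 1 "\<lambda>p. \<sigma> * f wb p"])
      show "8 * (2 / k) * (LINT y|lborel. norm (q y)) \<le> 1" using small k by (simp add: field_simps)
      show "norm (\<sigma> * f wb p) \<le> 1" for p
        using mult_mono[OF \<sigma> gf(5)[OF adm(2), of p]] by (simp add: norm_mult)
      show "continuous_on UNIV (\<lambda>p. \<sigma> * f wb p)" using gf(4)[OF adm(2)] by (intro continuous_intros)
      show ?thesis if "continuous_on UNIV U" "continuous_on UNIV V" "\<And>p. norm (U p) \<le> 4 * 1" "\<And>p. norm (V p) \<le> 4 * 1"
        "\<And>p. U p = f wa p + (LINT y|lborel. g wa p y * rot_pot (q y) (U (y, snd p)) (V (y, snd p)))"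
        "\<And>p. V p = \<sigma> * f wb p + (LINT y|lborel. g wb p y * rot_pot (q y) (V (y, snd p)) (U (y, snd p)))" for U V
        by (rule UV_obtain[OF that])
    qed (rule gf[OF adm(1)] gf[OF adm(2)])+
  qed
  \<comment> \<open>The weight is put back: \<open>U\<close> and \<open>V\<close> are bounded,
    \<open>u\<close> and \<open>v\<close> carry the factor \<open>exp (- Im z x)\<close>.\<close>
  define u where "u x z = exp (of_real (- (Im z * x))) * U (x, z)" for x z
  define v where "v x z = exp (of_real (- (Im z * x))) * V (x, z)" for x z
  have sc: "continuous_on UNIV (\<lambda>x. U (x, z))" "continuous_on UNIV (\<lambda>x. V (x, z))" for z
    by (rule continuous_on_compose2[OF UV(1)], auto intro!: continuous_intros)
       (rule continuous_on_compose2[OF UV(2)], auto intro!: continuous_intros)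
  have uc: "continuous_on UNIV (\<lambda>x. u x z)" "continuous_on UNIV (\<lambda>x. v x z)" for z
    unfolding u_def v_def by (intro continuous_intros sc)+
  have [measurable]: "(\<lambda>x. u x z) \<in> borel_measurable borel" "(\<lambda>x. v x z) \<in> borel_measurable borel" for z
    using uc by (auto intro: borel_measurable_continuous_onI)
  have ub: "norm (u x z) \<le> 4 * exp (- (Im z * x))" "norm (v x z) \<le> 4 * exp (- (Im z * x))" for x z
    using UV(3,4)[of "(x,z)"] unfolding u_def v_def by (simp_all add: norm_mult)
  define hu where "hu z y = rot_pot (q y) (u y z) (v y z)" for z y
  define hv where "hv z y = rot_pot (q y) (v y z) (u y z)" for z y
  have hb: "norm (hu z y) \<le> 8 * norm (q y) * exp (- (Im z * y))" "norm (hv z y) \<le> 8 * norm (q y) * exp (- (Im z * y))" for z y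
    unfolding hu_def hv_def using ub[of y z] mult_left_mono[of "norm (u y z) + norm (v y z)" "8 * exp (- (Im z * y))" "norm (q y)"]
    by (auto intro!: order_trans[OF norm_rot_pot] simp: algebra_simps)
  have h0: "y \<le> 0 \<Longrightarrow> hu z y = 0" "y \<le> 0 \<Longrightarrow> hv z y = 0" for y z by (simp_all add: hu_def hv_def q0 rot_pot_def)
  have hm [measurable]: "hu z \<in> borel_measurable borel" "hv z \<in> borel_measurable borel" for z
    unfolding hu_def[abs_def] hv_def[abs_def] by measurable
  have hi: "integrable lborel (hu z)" "integrable lborel (hv z)" and hb': "norm (hu z y) \<le> 8 * norm (q y)" "norm (hv z y) \<le> 8 * norm (q y)"
    if z: "z \<in> spectral_strip k" for z y
  proof -
    have *: "norm (hu z y) \<le> 8 * norm (q y)" "norm (hv z y) \<le> 8 * norm (q y)" for y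
    proof -
      have "8 * norm (q y) * exp (- (Im z * y)) \<le> 8 * norm (q y) * 1"
        using z q0[of y] by (cases "y \<le> 0") (auto simp: spectral_strip_def intro!: mult_left_le)
      then show "norm (hu z y) \<le> 8 * norm (q y)" "norm (hv z y) \<le> 8 * norm (q y)" using hb[of z y] by auto
    qed
    then show "norm (hu z y) \<le> 8 * norm (q y)" "norm (hv z y) \<le> 8 * norm (q y)" by auto
    have i: "integrable lborel (\<lambda>y. 8 * norm (q y))" using q by auto
    show "integrable lborel (hu z)" by (rule Bochner_Integration.integrable_bound[OF i]) (use * in auto)
    show "integrable lborel (hv z)" by (rule Bochner_Integration.integrable_bound[OF i]) (use * in auto)
  qed
  \<comment> \<open>The ratio of the weights at \<open>x\<close> and \<open>y\<close> is the
    exponential built into \<open>g\<close>. Negative \<open>y\<close>, where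
    \<open>\<bar>y\<bar>\<close> and \<open>y\<close> differ, contribute nothing since
    \<open>q\<close> vanishes there.\<close>
  have key: "exp (of_real (- (Im z * x))) * (LINT y|lborel. g w (x, z) y * rot_pot (q y) (a y) (b y))
      = (LINT y|lborel. green (w z) x y * rot_pot (q y) (exp (of_real (- (Im z * y))) * a y) (exp (of_real (- (Im z * y))) * b y))"
    if "x \<ge> 0" "z \<in> spectral_strip k" for x z w and a b :: "real \<Rightarrow> complex"
  proof -
    have "exp (of_real (- (Im z * x))) * (g w (x, z) y * rot_pot (q y) (a y) (b y))
      = green (w z) x y * rot_pot (q y) (exp (of_real (- (Im z * y))) * a y) (exp (of_real (- (Im z * y))) * b y)" for y
    proof (cases "y \<le> 0")
      case True then show ?thesis by (simp add: q0 rot_pot_def)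
    next
      case False
      have "exp (of_real (- (Im z * x))) * exp (of_real (Im z * (x - y))) = exp (complex_of_real (- (Im z * y)))"
        by (simp add: exp_add[symmetric] algebra_simps)
      then show ?thesis using False that unfolding rot_pot_mult g_def \<kappa>id[OF that(2)] by (simp add: \<kappa>id algebra_simps)
    qed
    then show ?thesis by (simp flip: Bochner_Integration.integral_mult_right_zero)
  qed
  have fkey: "exp (of_real (- (Im z * x))) * f w (x, z) = exp (- w z * of_real x)" if "x \<ge> 0" "z \<in> spectral_strip k" for x z w
    using that unfolding f_def by (simp add: \<kappa>id exp_add[symmetric])
  have ueq: "u x z = 1 * exp (- wa z * of_real x) + (LINT y|lborel. green (wa z) x y * hu z y)" if "x \<ge> 0" "z \<in> spectral_strip k" for x z
  proof -
    have "u x z = (exp (of_real (- (Im z * x))) * f wa (x, z)) + exp (of_real (- (Im z * x))) *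
        (LINT y|lborel. g wa (x, z) y * rot_pot (q y) (U (y, z)) (V (y, z)))"
      unfolding u_def by (subst UV(5)) (simp add: distrib_left)
    then show ?thesis unfolding fkey[OF that] key[OF that] hu_def hv_def u_def v_def by simp
  qed
  have veq: "v x z = \<sigma> * exp (- wb z * of_real x) + (LINT y|lborel. green (wb z) x y * hv z y)" if "x \<ge> 0" "z \<in> spectral_strip k" for x z
  proof -
    have "v x z = \<sigma> * (exp (of_real (- (Im z * x))) * f wb (x, z)) + exp (of_real (- (Im z * x))) *
        (LINT y|lborel. g wb (x, z) y * rot_pot (q y) (V (y, z)) (U (y, z)))"
      unfolding v_def by (subst UV(6)) (simp add: distrib_left)
    then show ?thesis unfolding fkey[OF that] key[OF that] hu_def hv_def u_def v_def by simp
  qed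
  have M: "integrable lborel (\<lambda>y. 8 * norm (q y))" "(LINT y|lborel. 8 * norm (q y)) = 8 * Q"
    using q by (auto simp: Q_def)
  \<comment> \<open>\<open>green_solution\<close> yields a derivative for each \<open>z\<close>
    separately; the choice principle collects them into one function of \<open>z\<close>.\<close>
  have "\<forall>z. \<exists>u'. z \<in> spectral_strip k \<longrightarrow> (primitive (\<lambda>x. u x z) u' \<and> primitive u' (\<lambda>x. (wa z)\<^sup>2 * u x z + hu z x) \<and>
    u' 0 = - 1 * wa z - (LINT y|lborel. exp (- wa z * of_real y) * hu z y) \<and>
    (\<forall>x\<ge>0. norm (u' x) \<le> (norm (1 * wa z) + 2 * (LINT y|lborel. 8 * norm (q y))) * exp (- (Im z * x))))"
  proof (intro allI)
    fix z
    show "\<exists>u'. z \<in> spectral_strip k \<longrightarrow> (primitive (\<lambda>x. u x z) u' \<and> primitive u' (\<lambda>x. (wa z)\<^sup>2 * u x z + hu z x) \<and>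
    u' 0 = - 1 * wa z - (LINT y|lborel. exp (- wa z * of_real y) * hu z y) \<and>
    (\<forall>x\<ge>0. norm (u' x) \<le> (norm (1 * wa z) + 2 * (LINT y|lborel. 8 * norm (q y))) * exp (- (Im z * x))))"
      using green_solution[of "wa z" "Im z" "hu z" "\<lambda>y. 8 * norm (q y)" "\<lambda>x. u x z" 1]
        spectral_strip_nz[of z] hi(1)[of z] h0(1)[of _ z] M(1) hb(1)[of z] ueq[of _ z]
      by (auto simp: wa_def spectral_strip_def)
  qed
  from choice[OF this] obtain ud where ud: "\<And>z. z \<in> spectral_strip k \<Longrightarrow> primitive (\<lambda>x. u x z) (ud z)"
    "\<And>z. z \<in> spectral_strip k \<Longrightarrow> primitive (ud z) (\<lambda>x. (wa z)\<^sup>2 * u x z + hu z x)"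
    "\<And>z. z \<in> spectral_strip k \<Longrightarrow> ud z 0 = - 1 * wa z - (LINT y|lborel. exp (- wa z * of_real y) * hu z y)"
    "\<And>z x. z \<in> spectral_strip k \<Longrightarrow> x \<ge> 0 \<Longrightarrow> norm (ud z x) \<le> (norm (1 * wa z) + 2 * (LINT y|lborel. 8 * norm (q y))) * exp (- (Im z * x))"
    by blast
  have "\<forall>z. \<exists>u'. z \<in> spectral_strip k \<longrightarrow> (primitive (\<lambda>x. v x z) u' \<and> primitive u' (\<lambda>x. (wb z)\<^sup>2 * v x z + hv z x) \<and>
    u' 0 = - \<sigma> * wb z - (LINT y|lborel. exp (- wb z * of_real y) * hv z y) \<and>
    (\<forall>x\<ge>0. norm (u' x) \<le> (norm (\<sigma> * wb z) + 2 * (LINT y|lborel. 8 * norm (q y))) * exp (- (Im z * x))))"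
  proof (intro allI)
    fix z
    show "\<exists>u'. z \<in> spectral_strip k \<longrightarrow> (primitive (\<lambda>x. v x z) u' \<and> primitive u' (\<lambda>x. (wb z)\<^sup>2 * v x z + hv z x) \<and>
    u' 0 = - \<sigma> * wb z - (LINT y|lborel. exp (- wb z * of_real y) * hv z y) \<and>
    (\<forall>x\<ge>0. norm (u' x) \<le> (norm (\<sigma> * wb z) + 2 * (LINT y|lborel. 8 * norm (q y))) * exp (- (Im z * x))))"
      using green_solution[of "wb z" "Im z" "hv z" "\<lambda>y. 8 * norm (q y)" "\<lambda>x. v x z" \<sigma>]
        spectral_strip_nz[of z] hi(2)[of z] h0(2)[of _ z] M(1) hb(2)[of z] veq[of _ z]
      by (auto simp: wb_def spectral_strip_def)
  qed
  from choice[OF this] obtain vd where vd: "\<And>z. z \<in> spectral_strip k \<Longrightarrow> primitive (\<lambda>x. v x z) (vd z)"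
    "\<And>z. z \<in> spectral_strip k \<Longrightarrow> primitive (vd z) (\<lambda>x. (wb z)\<^sup>2 * v x z + hv z x)"
    "\<And>z. z \<in> spectral_strip k \<Longrightarrow> vd z 0 = - \<sigma> * wb z - (LINT y|lborel. exp (- wb z * of_real y) * hv z y)"
    "\<And>z x. z \<in> spectral_strip k \<Longrightarrow> x \<ge> 0 \<Longrightarrow> norm (vd z x) \<le> (norm (\<sigma> * wb z) + 2 * (LINT y|lborel. 8 * norm (q y))) * exp (- (Im z * x))"
    by blast
  have Re0: "Re (wa z) \<ge> 0" "Re (wb z) \<ge> 0" if "z \<in> spectral_strip k" for z
    using that k by (auto simp: wa_def wb_def spectral_strip_def)
  have cont: "continuous_on (spectral_strip k) (\<lambda>z. LINT y|lborel. exp (- w z * of_real y) * h z y)"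
    if w: "continuous_on UNIV w" "\<And>z. z \<in> spectral_strip k \<Longrightarrow> Re (w z) \<ge> 0" and h: "\<And>y. continuous_on UNIV (\<lambda>z. h z y)"
      "\<And>z. h z \<in> borel_measurable borel" "\<And>z y. z \<in> spectral_strip k \<Longrightarrow> norm (h z y) \<le> 8 * norm (q y)" for w :: "complex \<Rightarrow> complex" and h
  proof (rule continuous_on_integral_param[where h = "\<lambda>y. 8 * norm (q y)"])
    show "continuous_on (spectral_strip k) (\<lambda>z. exp (- w z * of_real y) * h z y)" for y
      by (intro continuous_intros continuous_on_subset[OF h(1)] continuous_on_subset[OF w(1)]) auto
    show "(\<lambda>y. exp (- w z * of_real y) * h z y) \<in> borel_measurable lborel" for z
      using h(2)[of z] by measurable
    show "norm (exp (- w z * of_real y) * h z y) \<le> 8 * norm (q y)" if "z \<in> spectral_strip k" for z y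
    proof (cases "y \<le> 0")
      case True then show ?thesis using h(3)[OF that, of y] by (simp add: q0)
    next
      case False
      then show ?thesis using norm_exp_decay[OF w(2)[OF that], of y] h(3)[OF that, of y]
          mult_mono[of "norm (exp (- w z * of_real y))" 1 "norm (h z y)" "8 * norm (q y)"] by (auto simp: norm_mult)
    qed
  qed (rule M)
  have cz: "continuous_on UNIV (\<lambda>z. u y z)" "continuous_on UNIV (\<lambda>z. v y z)" for y
    unfolding u_def v_def
    by (intro continuous_intros continuous_on_compose2[OF UV(1)] continuous_on_compose2[OF UV(2)]; auto)+
  have ch: "continuous_on UNIV (\<lambda>z. hu z y)" "continuous_on UNIV (\<lambda>z. hv z y)" for y
    unfolding hu_def hv_def rot_pot_def by (intro continuous_intros cz)+
  have adm': "continuous_on UNIV wa" "continuous_on UNIV wb" using adm by (auto simp: adm_def)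
  have Gest: "norm (LINT y|lborel. green (w z) x y * h z y) \<le> 16 * Q / k * exp (- (Im z * x))" if "x \<ge> 0" "z \<in> spectral_strip k" "adm w" "h = hu \<or> h = hv" for x z w h
  proof -
    have a: "w z \<noteq> 0" "0 \<le> Im z" "Im z \<le> Re (w z)" "norm (w z) \<ge> k / 2"
      using that spectral_strip_nz[of z] spectral_strip_norm[of z] by (auto simp: adm_def spectral_strip_def)
    have "norm (LINT y|lborel. green (w z) x y * h z y) \<le> (LINT y|lborel. 2 / k * (8 * norm (q y) * exp (- (Im z * x))))"
    proof (rule norm_integral_le)
      show "integrable lborel (\<lambda>y. 2 / k * (8 * norm (q y) * exp (- (Im z * x))))" using q by auto
      show "norm (green (w z) x y * h z y) \<le> 2 / k * (8 * norm (q y) * exp (- (Im z * x)))" for y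
      proof (cases "y \<le> 0")
        case True then show ?thesis using h0[of y z] k that(4) by auto
      next
        case False
        have "norm (green (w z) x y * h z y) \<le> norm (green (w z) x y) * (8 * norm (q y) * exp (- (Im z * y)))"
          unfolding norm_mult using hb[of z y] that(4) by (intro mult_left_mono) auto
        also have "\<dots> = norm (green (w z) x y * exp (of_real (Im z * (x - y)))) * (8 * norm (q y) * exp (- (Im z * x)))"
          by (simp add: norm_mult norm_divide norm_exp_eq_Re exp_diff exp_minus field_simps)
        also have "\<dots> \<le> 1 / norm (w z) * (8 * norm (q y) * exp (- (Im z * x)))"
          using green_bound[OF a(1-3), of x y] that(1) False by (intro mult_right_mono) auto
        also have "\<dots> \<le> 1 / (k / 2) * (8 * norm (q y) * exp (- (Im z * x)))"
          using a k by (intro mult_right_mono divide_left_mono mult_pos_pos) auto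
        finally show ?thesis by simp
      qed
    qed
    also have "\<dots> = 16 * Q / k * exp (- (Im z * x))" by (simp add: Q_def)
    finally show ?thesis .
  qed
  have est1: "norm (u x z - exp (\<i> * z * of_real x)) \<le> 16 * Q / k" "norm (v x z - \<sigma> * exp (- z * of_real x)) \<le> 16 * Q / k" if "x \<ge> 0" "z \<in> spectral_strip k" for x z
  proof -
    have "16 * Q / k * exp (- (Im z * x)) \<le> 16 * Q / k * 1"
      using that Q0 k by (intro mult_left_mono) (auto simp: spectral_strip_def)
    then show "norm (u x z - exp (\<i> * z * of_real x)) \<le> 16 * Q / k" "norm (v x z - \<sigma> * exp (- z * of_real x)) \<le> 16 * Q / k"
      using Gest[OF that adm(1), of hu] Gest[OF that adm(2), of hv] ueq[OF that] veq[OF that]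
      by (simp_all add: wa_def wb_def)
  qed
  have est2: "norm ((LINT y|lborel. exp (- w * of_real y) * rot_pot (q y) (a y) (b y)) - (LINT y|lborel. exp (- w * of_real y) * rot_pot (q y) (a' y) (b' y))) \<le> 32 / k * Q\<^sup>2"
    if w: "Re w \<ge> 0" and m [measurable]: "a \<in> borel_measurable borel" "b \<in> borel_measurable borel" "a' \<in> borel_measurable borel" "b' \<in> borel_measurable borel"
      and d: "\<And>x. x \<ge> 0 \<Longrightarrow> norm (a x - a' x) \<le> 16 * Q / k" "\<And>x. x \<ge> 0 \<Longrightarrow> norm (b x - b' x) \<le> 16 * Q / k"
      and B: "\<And>x. x \<ge> 0 \<Longrightarrow> norm (a x) \<le> 4" "\<And>x. x \<ge> 0 \<Longrightarrow> norm (b x) \<le> 4" "\<And>x. x \<ge> 0 \<Longrightarrow> norm (a' x) \<le> 4" "\<And>x. x \<ge> 0 \<Longrightarrow> norm (b' x) \<le> 4"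
    for w and a b a' b' :: "real \<Rightarrow> complex"
  proof -
    have pb: "norm (exp (- w * of_real y) * rot_pot (q y) (c y) (d y)) \<le> 2 * L * norm (q y)"
      if "\<And>x. x \<ge> 0 \<Longrightarrow> norm (c x) \<le> L" "\<And>x. x \<ge> 0 \<Longrightarrow> norm (d x) \<le> L" for c d :: "real \<Rightarrow> complex" and L y
    proof (cases "y \<le> 0")
      case True then show ?thesis by (simp add: q0 rot_pot_def)
    next
      case False
      have "norm (exp (- w * of_real y) * rot_pot (q y) (c y) (d y)) \<le> 1 * (norm (q y) * (norm (c y) + norm (d y)))"
        unfolding norm_mult using norm_exp_decay[OF w, of y] False norm_rot_pot by (intro mult_mono) auto
      also have "\<dots> \<le> 1 * (norm (q y) * (L + L))" using that[of y] False by (intro mult_left_mono add_mono) auto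
      finally show ?thesis by (simp add: algebra_simps)
    qed
    have pi: "integrable lborel (\<lambda>y. exp (- w * of_real y) * rot_pot (q y) (c y) (d y))"
      if [measurable]: "c \<in> borel_measurable borel" "d \<in> borel_measurable borel" 
        and "\<And>x. x \<ge> 0 \<Longrightarrow> norm (c x) \<le> L" "\<And>x. x \<ge> 0 \<Longrightarrow> norm (d x) \<le> L" for c d :: "real \<Rightarrow> complex" and L
    proof (rule Bochner_Integration.integrable_bound)
      show "integrable lborel (\<lambda>y. 2 * L * norm (q y))" using q by auto
      show "AE y in lborel. norm (exp (- w * of_real y) * rot_pot (q y) (c y) (d y)) \<le> norm (2 * L * norm (q y))"
      proof (rule AE_I2)
        fix y show "norm (exp (- w * of_real y) * rot_pot (q y) (c y) (d y)) \<le> norm (2 * L * norm (q y))"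
          unfolding real_norm_def by (rule order_trans[OF pb[OF that(3,4)] abs_ge_self])
      qed
    qed measurable
    have "(LINT y|lborel. exp (- w * of_real y) * rot_pot (q y) (a y) (b y)) - (LINT y|lborel. exp (- w * of_real y) * rot_pot (q y) (a' y) (b' y))
       = (LINT y|lborel. exp (- w * of_real y) * rot_pot (q y) (a y - a' y) (b y - b' y))"
      unfolding rot_pot_diff[symmetric] right_diff_distrib using m B
      by (intro Bochner_Integration.integral_diff[symmetric] pi[of _ _ 4]) auto
    also have "norm \<dots> \<le> (LINT y|lborel. 2 * (16 * Q / k) * norm (q y))"
      using q pb[of "\<lambda>y. a y - a' y" "16 * Q / k" "\<lambda>y. b y - b' y"] d
      by (intro norm_integral_le) auto
    also have "\<dots> = 32 / k * Q\<^sup>2" by (simp add: Q_def power2_eq_square)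
    finally show ?thesis .
  qed
  have ub4: "norm (u x z) \<le> 4" "norm (v x z) \<le> 4" "norm (exp (\<i> * z * of_real x)) \<le> 4" "norm (\<sigma> * exp (- z * of_real x)) \<le> 4"
    if "x \<ge> 0" "z \<in> spectral_strip k" for x z
  proof -
    have "exp (- (Im z * x)) \<le> 1" using that by (auto simp: spectral_strip_def)
    then show "norm (u x z) \<le> 4" "norm (v x z) \<le> 4" using ub(1)[of x z] ub(2)[of x z] by linarith+
    have n: "norm (exp (\<i> * z * of_real x)) \<le> 1" "norm (exp (- z * of_real x)) \<le> 1"
      using that k by (auto simp: norm_exp_eq_Re spectral_strip_def)
    then show "norm (exp (\<i> * z * of_real x)) \<le> 4" by linarith
    have "norm (\<sigma> * exp (- z * of_real x)) \<le> 1"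
      unfolding norm_mult using mult_mono[OF \<sigma> n(2)] by simp
    then show "norm (\<sigma> * exp (- z * of_real x)) \<le> 4" by linarith
  qed
  show thesis
  proof (rule that[of u "\<lambda>x z. ud z x" v "\<lambda>x z. vd z x"])
    fix z assume z: "z \<in> spectral_strip k"
    have "primitive (\<lambda>x. ud z x) (\<lambda>x. - z\<^sup>2 * u x z + rot_pot (q x) (u x z) (v x z))"
      using ud(2)[OF z] by (simp add: wa_def hu_def power_mult_distrib)
    moreover have "primitive (\<lambda>x. vd z x) (\<lambda>x. z\<^sup>2 * v x z + rot_pot (q x) (v x z) (u x z))"
      using vd(2)[OF z] by (simp add: wb_def hv_def)
    moreover have "u 0 z = 1" "v 0 z = \<sigma>"
    proof -
      \<comment> \<open>The Dirichlet kernel vanishes at \<open>x = 0\<close>, so the boundary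
        values are those of the free solutions.\<close>
      have "green w 0 y * hu z y = 0" "green w 0 y * hv z y = 0" for w y
        using h0[of y z] by (cases "y \<le> 0"; simp add: green_def)+
      then show "u 0 z = 1" "v 0 z = \<sigma>"
        unfolding ueq[OF order_refl z] veq[OF order_refl z] by (simp_all only: integral_zero) simp_all
    qed
    \<comment> \<open>The constant covers the bound 4 for the functions and
      \<open>norm z + 2 * (8 * Q)\<close> for the derivatives, as
      \<open>16 * Q \<le> k\<close>.\<close>
    moreover have "norm (u x z) \<le> (norm z + k + 4) * exp (- (Im z * x))" "norm (v x z) \<le> (norm z + k + 4) * exp (- (Im z * x))"
      "norm (ud z x) \<le> (norm z + k + 4) * exp (- (Im z * x))" "norm (vd z x) \<le> (norm z + k + 4) * exp (- (Im z * x))" if x: "x \<ge> 0" for x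
    proof -
      have "norm (\<sigma> * z) \<le> norm z" using mult_right_mono[OF \<sigma>, of "norm z"] by (simp add: norm_mult)
      then have nn: "norm (1 * wa z) + 2 * (8 * Q) \<le> norm z + k + 4" "norm (\<sigma> * wb z) + 2 * (8 * Q) \<le> norm z + k + 4"
        using Qk by (auto simp: wa_def wb_def norm_mult)
      have "4 * exp (- (Im z * x)) \<le> (norm z + k + 4) * exp (- (Im z * x))"
        using k by (intro mult_right_mono) auto
      then show "norm (u x z) \<le> (norm z + k + 4) * exp (- (Im z * x))" "norm (v x z) \<le> (norm z + k + 4) * exp (- (Im z * x))"
        using ub(1)[of x z] ub(2)[of x z] by linarith+
      show "norm (ud z x) \<le> (norm z + k + 4) * exp (- (Im z * x))"
        by (rule order_trans[OF ud(4)[OF z x, unfolded M(2)] mult_right_mono[OF nn(1)]]) simp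
      show "norm (vd z x) \<le> (norm z + k + 4) * exp (- (Im z * x))"
        by (rule order_trans[OF vd(4)[OF z x, unfolded M(2)] mult_right_mono[OF nn(2)]]) simp
    qed
    ultimately show "weyl_data (\<lambda>x. u x z) (\<lambda>x. ud z x) (\<lambda>x. v x z) (\<lambda>x. vd z x) \<sigma> z"
      unfolding weyl_data_def using ud(1)[OF z] vd(1)[OF z] by blast
  next
    have "continuous_on (spectral_strip k) (\<lambda>z. - 1 * wa z - (LINT y|lborel. exp (- wa z * of_real y) * hu z y))"
      by (intro continuous_intros cont adm' Re0 ch hm hb' continuous_on_subset[OF adm'(1)]) auto
    then show "continuous_on (spectral_strip k) (\<lambda>z. ud z 0)" by (rule continuous_on_eq) (simp add: ud(3))
    have "continuous_on (spectral_strip k) (\<lambda>z. - \<sigma> * wb z - (LINT y|lborel. exp (- wb z * of_real y) * hv z y))"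
      by (intro continuous_intros cont adm' Re0 ch hm hb' continuous_on_subset[OF adm'(2)]) auto
    then show "continuous_on (spectral_strip k) (\<lambda>z. vd z 0)" by (rule continuous_on_eq) (simp add: vd(3))
  next
    fix z assume z: "z \<in> spectral_strip k"
    show "norm (ud z 0 - (\<i> * z - (LINT y|lborel. exp (\<i> * z * of_real y) *
        rot_pot (q y) (exp (\<i> * z * of_real y)) (\<sigma> * exp (- z * of_real y))))) \<le> 32 / k * (LINT y|lborel. norm (q y))\<^sup>2"
      using est2[of "wa z" "\<lambda>y. u y z" "\<lambda>y. v y z" "\<lambda>y. exp (\<i> * z * of_real y)" "\<lambda>y. \<sigma> * exp (- z * of_real y)"]
        Re0(1)[OF z] est1[OF _ z] ub4[OF _ z]
      by (simp add: ud(3)[OF z] hu_def wa_def Q_def norm_minus_commute)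
    show "norm (vd z 0 - (- \<sigma> * z - (LINT y|lborel. exp (- z * of_real y) *
        rot_pot (q y) (\<sigma> * exp (- z * of_real y)) (exp (\<i> * z * of_real y))))) \<le> 32 / k * (LINT y|lborel. norm (q y))\<^sup>2"
      using est2[of "wb z" "\<lambda>y. v y z" "\<lambda>y. u y z" "\<lambda>y. \<sigma> * exp (- z * of_real y)" "\<lambda>y. exp (\<i> * z * of_real y)"]
        Re0(2)[OF z] est1[OF _ z] ub4[OF _ z]
      by (simp add: vd(3)[OF z] hv_def wb_def Q_def norm_minus_commute)
  qed
qed

end

section \<open>Solutions vanishing at the boundary point\<close>

text \<open>This is \<open>sinh (w t) / w\<close>, the kernel of the initial value problem at
  0.\<close>

definition sinh_kernel :: "complex \<Rightarrow> real \<Rightarrow> complex" where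
  "sinh_kernel w t = (exp (w * of_real t) - exp (- w * of_real t)) / (2 * w)"

text \<open>The growth rate is measured by \<open>norm w\<close> instead of \<open>Re w\<close>, so
  that the exponents \<open>- \<i> z\<close> and \<open>z\<close> get the same weight.\<close>

lemma sinh_kernel_bound:
  assumes "w \<noteq> 0" "t \<ge> 0" shows "norm (sinh_kernel w t * exp (of_real (- (norm w * t)))) \<le> 1 / norm w"
proof -
  have 1: "\<bar>Re w * t\<bar> \<le> norm w * t" using assms abs_Re_le_cmod[of w] by (simp add: abs_mult mult_right_mono)
  have "norm (sinh_kernel w t * exp (of_real (- (norm w * t)))) =
     norm (exp (w * of_real t) - exp (- w * of_real t)) * exp (- (norm w * t)) / (2 * norm w)"
    unfolding sinh_kernel_def by (simp add: norm_mult norm_divide)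
  also have "\<dots> \<le> (exp (Re w * t) + exp (- (Re w * t))) * exp (- (norm w * t)) / (2 * norm w)"
    using assms by (intro divide_right_mono mult_right_mono order_trans[OF norm_triangle_ineq4]) (auto simp: norm_exp_eq_Re)
  also have "\<dots> = (exp (Re w * t - norm w * t) + exp (- (Re w * t) - norm w * t)) / (2 * norm w)"
    by (simp add: distrib_right exp_add[symmetric])
  also have "\<dots> \<le> (1 + 1) / (2 * norm w)"
    using assms 1 by (intro divide_right_mono add_mono) auto
  finally show ?thesis using assms by simp
qed

text \<open>The argument \<open>max 0 (x - \<bar>y\<bar>)\<close> encodes Volterra integration: the
  kernel vanishes at 0, so \<open>y > x\<close> drops out and the kernel stays continuous in
  \<open>x\<close>.\<close>

lemma volterra_solution_component:
  fixes h u :: "real \<Rightarrow> complex"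
  assumes w: "w \<noteq> 0" and h: "h \<in> borel_measurable borel" "\<And>x. h absolutely_integrable_on {0..x}" "\<And>y. y \<le> 0 \<Longrightarrow> h y = 0"
    and u: "\<And>x. x \<ge> 0 \<Longrightarrow> u x = s * sinh_kernel w x + (LINT y|lborel. sinh_kernel w (max 0 (x - \<bar>y\<bar>)) * h y)"
  shows "\<exists>u'. primitive u u' \<and> primitive u' (\<lambda>x. w\<^sup>2 * u x + h x) \<and> u' 0 = s"
proof -
  note [measurable] = h(1)
  define A where "A x = integral {0..x} (\<lambda>t. exp (- w * of_real t) * h t)" for x
  define B where "B x = integral {0..x} (\<lambda>t. exp (w * of_real t) * h t)" for x
  have iI: "set_integrable lborel {0..x} (\<lambda>y. exp (s * of_real y) * h y)" for s x
  proof -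
    have "(\<lambda>y. exp (s * of_real y) * h y) absolutely_integrable_on {0..x}"
      by (intro absint_continuous_mult h continuous_intros)
    then show ?thesis unfolding set_integrable_def
      by (subst (asm) integrable_completion) auto
  qed
  let ?i = "\<lambda>x s y. indicator {0..x} y *\<^sub>R (exp (s * of_real y) * h y)"
  have eqI: "(LINT y|lborel. ?i x s y) = integral {0..x} (\<lambda>t. exp (s * of_real t) * h t)" for s x
    using set_borel_integral_eq_integral(2)[OF iI[of x s]] by (simp add: set_lebesgue_integral_def)
  define u' where "u' x = (exp (w * of_real x) * (s + A x) + exp (- w * of_real x) * (s + B x)) / 2" for x
  have ueq: "u x = (exp (w * of_real x) * (s + A x) - exp (- w * of_real x) * (s + B x)) / (2 * w)" if x: "x \<ge> 0" for x
  proof -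
    let ?e = "exp (w * of_real x)" and ?f = "exp (- w * of_real x)"
    define F1 where "F1 = ?i x (- w)"
    define F2 where "F2 = ?i x w"
    have F: "integrable lborel F1" "integrable lborel F2"
      using iI[of x "-w"] iI[of x w] unfolding F1_def F2_def set_integrable_def by auto
    have pt: "sinh_kernel w (max 0 (x - \<bar>y\<bar>)) * h y = (1 / (2 * w)) * (?e * F1 y - ?f * F2 y)" for y
    proof -
      consider "y \<le> 0" | "0 < y" "y \<le> x" | "x < y" by linarith
      then show ?thesis
      proof cases
        case 1 then show ?thesis using h(3)[of y] by (simp add: F1_def F2_def)
      next
        case 2
        then have "max 0 (x - \<bar>y\<bar>) = x - y" by simp
        moreover have "exp (w * of_real (x - y)) = ?e * exp (- w * of_real y)" "exp (- w * of_real (x - y)) = ?f * exp (w * of_real y)"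
          by (simp_all add: exp_add[symmetric] algebra_simps)
        ultimately show ?thesis using 2 w unfolding sinh_kernel_def F1_def F2_def by (simp add: field_simps)
      next
        case 3
        then have "max 0 (x - \<bar>y\<bar>) = 0" using x by simp
        then show ?thesis using 3 x by (simp add: F1_def F2_def sinh_kernel_def)
      qed
    qed
    have "(LINT y|lborel. sinh_kernel w (max 0 (x - \<bar>y\<bar>)) * h y) = (1 / (2 * w)) * (?e * (LINT y|lborel. F1 y) - ?f * (LINT y|lborel. F2 y))"
      unfolding pt using F by (simp del: times_divide_eq_left)
    then have I: "(LINT y|lborel. sinh_kernel w (max 0 (x - \<bar>y\<bar>)) * h y) = (1 / (2 * w)) * (?e * A x - ?f * B x)"
      unfolding F1_def F2_def eqI A_def B_def .
    show ?thesis unfolding u[OF x] I using w by (simp add: sinh_kernel_def field_simps)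
  qed
  note vp = variation_of_parameters[OF w(1) h(2), where \<alpha> = s and \<beta> = s, folded A_def B_def]
  have p1: "primitive u u'"
    by (rule primitive_cong[OF vp(1)]) (simp_all add: ueq u'_def)
  have p2: "primitive u' (\<lambda>x. w\<^sup>2 * u x + h x)"
    by (rule primitive_cong[OF vp(2)]) (simp_all add: ueq u'_def)
  have "u' 0 = s" by (simp add: u'_def A_def B_def)
  then show ?thesis using p1 p2 by blast
qed

context small_potential begin

text \<open>This supplies the matrix \<open>\<Phi>\<close> that \<open>is_Weyl_matrix\<close>
  demands. Smallness of \<open>q\<close> lets the contraction of
  \<open>integral_system_solution\<close> replace a Volterra iteration, once the growth
  \<open>exp (norm z x)\<close> is divided out.\<close>

lemma volterra_solution:
  assumes z: "z \<in> spectral_strip k" and st: "norm s \<le> 1" "norm t \<le> 1"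
  obtains u u' v v' :: "real \<Rightarrow> complex" where "primitive u u'" "primitive v v'"
    "primitive u' (\<lambda>x. - z\<^sup>2 * u x + rot_pot (q x) (u x) (v x))"
    "primitive v' (\<lambda>x. z\<^sup>2 * v x + rot_pot (q x) (v x) (u x))"
    "u 0 = 0" "v 0 = 0" "u' 0 = s" "v' 0 = t"
proof -
  have qm [measurable]: "q \<in> borel_measurable borel" using q by auto
  define L where "L = norm z"
  have zk: "norm z \<ge> k / 2" by (rule spectral_strip_norm[OF z])
  define g where "g w p y = sinh_kernel w (max 0 (\<bar>fst p\<bar> - \<bar>y\<bar>)) * exp (of_real (- (norm w * (max 0 (\<bar>fst p\<bar> - \<bar>y\<bar>)))))"
    for w :: complex and p :: "real \<times> complex" and y
  define f where "f s w p = s * (sinh_kernel w \<bar>fst p\<bar> * exp (of_real (- (norm w * \<bar>fst p\<bar>))))"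
    for s w :: complex and p :: "real \<times> complex"
  have gf: "continuous_on UNIV (\<lambda>p. g w p y)" "g w p \<in> borel_measurable lborel" "norm (g w p y) \<le> 2 / k"
    "continuous_on UNIV (f s w)" "norm s \<le> 1 \<Longrightarrow> norm (f s w p) \<le> 2 / k" if w: "norm w = L" for w p y s
  proof -
    have nz: "w \<noteq> 0" using w zk k unfolding L_def by auto
    show "continuous_on UNIV (\<lambda>p. g w p y)" unfolding g_def sinh_kernel_def
      by (intro continuous_intros) (use nz in auto)
    show "continuous_on UNIV (f s w)" unfolding f_def sinh_kernel_def by (intro continuous_intros) (use nz in auto)
    show "g w p \<in> borel_measurable lborel" unfolding g_def[abs_def] sinh_kernel_def by measurable
    have le: "1 / norm w \<le> 1 / (k / 2)" using zk k w unfolding L_def by (intro divide_left_mono mult_pos_pos) auto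
    then show "norm (g w p y) \<le> 2 / k"
      unfolding g_def by (intro order_trans[OF sinh_kernel_bound[OF nz]]) auto
    assume "norm s \<le> 1"
    then have "norm s * norm (sinh_kernel w \<bar>fst p\<bar> * exp (of_real (- (norm w * \<bar>fst p\<bar>)))) \<le> 1 * (1 / norm w)"
      using sinh_kernel_bound[OF nz, of "\<bar>fst p\<bar>"] by (intro mult_mono) auto
    then show "norm (f s w p) \<le> 2 / k" using le unfolding f_def norm_mult[of s] by simp
  qed
  define wa where "wa = - \<i> * z"
  have nw: "norm wa = L" "norm z = L" by (auto simp: wa_def L_def norm_mult)
  obtain U V :: "real \<times> complex \<Rightarrow> complex" where UV: "continuous_on UNIV U" "continuous_on UNIV V"
    "\<And>p. U p = f s wa p + (LINT y|lborel. g wa p y * rot_pot (q y) (U (y, snd p)) (V (y, snd p)))"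
    "\<And>p. V p = f t z p + (LINT y|lborel. g z p y * rot_pot (q y) (V (y, snd p)) (U (y, snd p)))"
  proof -
    note UV_obtain = that
    show ?thesis
    proof (rule integral_system_solution[OF q, of "2 / k" "g wa" "g z" "f s wa" "2 / k" "f t z"])
      show "8 * (2 / k) * (LINT y|lborel. norm (q y)) \<le> 1" using small k by (simp add: field_simps)
      show ?thesis if "continuous_on UNIV U" "continuous_on UNIV V" "\<And>p. norm (U p) \<le> 4 * (2 / k)" "\<And>p. norm (V p) \<le> 4 * (2 / k)"
        "\<And>p. U p = f s wa p + (LINT y|lborel. g wa p y * rot_pot (q y) (U (y, snd p)) (V (y, snd p)))"
        "\<And>p. V p = f t z p + (LINT y|lborel. g z p y * rot_pot (q y) (V (y, snd p)) (U (y, snd p)))" for U V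
        by (rule UV_obtain[OF that(1,2,5,6)])
    qed (rule gf[OF nw(1)] gf[OF nw(2)] st)+
  qed
  \<comment> \<open>Here \<open>z\<close> is fixed and the second argument of \<open>U\<close> and
    \<open>V\<close> is a dummy, set to 0.\<close>
  define u where "u x = exp (of_real (L * x)) * U (x, 0)" for x
  define v where "v x = exp (of_real (L * x)) * V (x, 0)" for x
  have sc: "continuous_on UNIV (\<lambda>x. U (x, 0))" "continuous_on UNIV (\<lambda>x. V (x, 0))"
    by (rule continuous_on_compose2[OF UV(1)], auto intro!: continuous_intros)
       (rule continuous_on_compose2[OF UV(2)], auto intro!: continuous_intros)
  have uc: "continuous_on UNIV u" "continuous_on UNIV v"
    unfolding u_def[abs_def] v_def[abs_def] by (intro continuous_intros sc)+
  have [measurable]: "u \<in> borel_measurable borel" "v \<in> borel_measurable borel"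
    using uc by (auto intro: borel_measurable_continuous_onI)
  have key: "exp (of_real (L * x)) * (LINT y|lborel. g w (x, 0) y * rot_pot (q y) (a y) (b y))
      = (LINT y|lborel. sinh_kernel w (max 0 (x - \<bar>y\<bar>)) * rot_pot (q y) (exp (of_real (L * y)) * a y) (exp (of_real (L * y)) * b y))"
    if "x \<ge> 0" and w: "norm w = L" for x w and a b :: "real \<Rightarrow> complex"
  proof -
    have "exp (of_real (L * x)) * (g w (x, 0) y * rot_pot (q y) (a y) (b y))
      = sinh_kernel w (max 0 (x - \<bar>y\<bar>)) * rot_pot (q y) (exp (of_real (L * y)) * a y) (exp (of_real (L * y)) * b y)" for y
    proof -
      consider "y \<le> 0" | "0 < y" "y \<le> x" | "x < y" by linarith
      then show ?thesis
      proof cases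
        case 1 then show ?thesis by (simp add: q0 rot_pot_def)
      next
        case 2
        have "exp (complex_of_real (L * x)) * exp (of_real (- (L * (x - y)))) = exp (complex_of_real (L * y))"
          by (simp add: exp_add[symmetric] algebra_simps)
        then show ?thesis using 2 unfolding rot_pot_mult g_def w by (simp add: max_def algebra_simps)
      next
        case 3
        then have "max 0 (x - \<bar>y\<bar>) = 0" using that by simp
        then show ?thesis using that by (simp add: g_def sinh_kernel_def)
      qed
    qed
    then show ?thesis by (simp flip: Bochner_Integration.integral_mult_right_zero)
  qed
  have fkey: "exp (of_real (L * x)) * f s w (x, 0) = s * sinh_kernel w x" if "x \<ge> 0" "norm w = L" for x w s
  proof -
    have "exp (complex_of_real (L * x)) * exp (of_real (- (L * x))) = 1" by (simp add: exp_add[symmetric])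
    then show ?thesis using that unfolding f_def by (simp add: algebra_simps)
  qed
  have ueq: "u x = s * sinh_kernel wa x + (LINT y|lborel. sinh_kernel wa (max 0 (x - \<bar>y\<bar>)) * rot_pot (q y) (u y) (v y))" if "x \<ge> 0" for x
  proof -
    have "u x = exp (of_real (L * x)) * f s wa (x, 0) + exp (of_real (L * x)) *
        (LINT y|lborel. g wa (x, 0) y * rot_pot (q y) (U (y, 0)) (V (y, 0)))"
      unfolding u_def by (subst UV(3)) (simp add: distrib_left)
    then show ?thesis unfolding fkey[OF that nw(1)] key[OF that nw(1)] u_def v_def by simp
  qed
  have veq: "v x = t * sinh_kernel z x + (LINT y|lborel. sinh_kernel z (max 0 (x - \<bar>y\<bar>)) * rot_pot (q y) (v y) (u y))" if "x \<ge> 0" for x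
  proof -
    have "v x = exp (of_real (L * x)) * f t z (x, 0) + exp (of_real (L * x)) *
        (LINT y|lborel. g z (x, 0) y * rot_pot (q y) (V (y, 0)) (U (y, 0)))"
      unfolding v_def by (subst UV(4)) (simp add: distrib_left)
    then show ?thesis unfolding fkey[OF that nw(2)] key[OF that nw(2)] u_def v_def by simp
  qed
  have zz: "sinh_kernel w (max 0 (0 - \<bar>y\<bar>)) = 0" for w y by (simp add: sinh_kernel_def max_def)
  have u0: "u 0 = 0" "v 0 = 0" using ueq[of 0] veq[of 0] unfolding zz by (simp_all add: sinh_kernel_def)
  have nz: "wa \<noteq> 0" "z \<noteq> 0" using spectral_strip_nz[OF z] by (auto simp: wa_def)
  have m: "(\<lambda>y. rot_pot (q y) (u y) (v y)) \<in> borel_measurable borel" "(\<lambda>y. rot_pot (q y) (v y) (u y)) \<in> borel_measurable borel"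
    by measurable
  have zero: "y \<le> 0 \<Longrightarrow> rot_pot (q y) a b = 0" for y a b by (simp add: q0 rot_pot_def)
  obtain u' where u': "primitive u u'" "primitive u' (\<lambda>x. wa\<^sup>2 * u x + rot_pot (q x) (u x) (v x))" "u' 0 = s"
    using volterra_solution_component[OF nz(1) m(1) absint_rot_pot[OF uc] zero ueq] by auto
  obtain v' where v': "primitive v v'" "primitive v' (\<lambda>x. z\<^sup>2 * v x + rot_pot (q x) (v x) (u x))" "v' 0 = t"
    using volterra_solution_component[OF nz(2) m(2) absint_rot_pot[OF uc(2,1)] zero veq] by auto
  have "wa\<^sup>2 = - z\<^sup>2" by (simp add: wa_def power_mult_distrib)
  with u' v' u0 show thesis by (intro that[of u u' v v']) auto
qed

end

section \<open>The Weyl matrix\<close>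

text \<open>The columns of the solutions: \<open>(f, g)\<close> satisfies \<open>f'' = cnj q f - \<mu> g\<close>,
  \<open>g'' = q g - \<mu> f\<close>. As the coefficient matrix is symmetric, the bilinear Wronskian is constant.\<close>

definition column_solution :: "(real \<Rightarrow> complex) \<Rightarrow> complex \<Rightarrow> (real \<Rightarrow> complex) \<Rightarrow> (real \<Rightarrow> complex) \<Rightarrow>
    (real \<Rightarrow> complex) \<Rightarrow> (real \<Rightarrow> complex) \<Rightarrow> bool" where
  "column_solution q \<mu> f g f' g' \<longleftrightarrow> primitive f f' \<and> primitive g g' \<and>
     primitive f' (\<lambda>x. cnj (q x) * f x - \<mu> * g x) \<and> primitive g' (\<lambda>x. q x * g x - \<mu> * f x)"

lemma rot_pot_half_sum: "1 / 2 * ((- \<mu> * u + rot_pot z u v) + (\<mu> * v + rot_pot z v u)) = cnj z * ((u + v) / 2) - \<mu> * ((u - v) / 2)"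
  by (simp add: rot_pot_def complex_eq_iff field_simps)

lemma rot_pot_half_diff: "1 / 2 * ((- \<mu> * u + rot_pot z u v) - (\<mu> * v + rot_pot z v u)) = z * ((u - v) / 2) - \<mu> * ((u + v) / 2)"
  by (simp add: rot_pot_def complex_eq_iff field_simps)

lemma column_solution_of_rotated:
  assumes "primitive u u'" "primitive v v'"
    "primitive u' (\<lambda>x. - \<mu> * u x + rot_pot (q x) (u x) (v x))"
    "primitive v' (\<lambda>x. \<mu> * v x + rot_pot (q x) (v x) (u x))"
  shows "column_solution q \<mu> (\<lambda>x. (u x + v x) / 2) (\<lambda>x. (u x - v x) / 2) (\<lambda>x. (u' x + v' x) / 2) (\<lambda>x. (u' x - v' x) / 2)"
proof -
  show ?thesis unfolding column_solution_def
  proof (intro conjI)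
    show "primitive (\<lambda>x. (u x + v x) / 2) (\<lambda>x. (u' x + v' x) / 2)"
      by (rule primitive_cong[OF primitive_cmult[OF primitive_add[OF assms(1,2)], of "1/2"]]) simp_all
    show "primitive (\<lambda>x. (u x - v x) / 2) (\<lambda>x. (u' x - v' x) / 2)"
      by (rule primitive_cong[OF primitive_cmult[OF primitive_diff[OF assms(1,2)], of "1/2"]]) simp_all
    show "primitive (\<lambda>x. (u' x + v' x) / 2) (\<lambda>x. cnj (q x) * ((u x + v x) / 2) - \<mu> * ((u x - v x) / 2))"
      by (rule primitive_cong[OF primitive_cmult[OF primitive_add[OF assms(3,4)], of "1/2"]])
         (simp_all only: rot_pot_half_sum, simp)
    show "primitive (\<lambda>x. (u' x - v' x) / 2) (\<lambda>x. q x * ((u x - v x) / 2) - \<mu> * ((u x + v x) / 2))"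
      by (rule primitive_cong[OF primitive_cmult[OF primitive_diff[OF assms(3,4)], of "1/2"]])
         (simp_all only: rot_pot_half_diff, simp)
  qed
qed

lemma column_solution_add:
  assumes "column_solution q \<mu> f g f' g'" "column_solution q \<mu> a b a' b'"
  shows "column_solution q \<mu> (\<lambda>x. f x + a x) (\<lambda>x. g x + b x) (\<lambda>x. f' x + a' x) (\<lambda>x. g' x + b' x)"
  using assms unfolding column_solution_def
  by (elim conjE, intro conjI primitive_add)
     (assumption | rule primitive_cong[OF primitive_add], assumption, assumption, simp, simp add: algebra_simps)+

lemma column_solution_cmult:
  assumes "column_solution q \<mu> f g f' g'"
  shows "column_solution q \<mu> (\<lambda>x. c * f x) (\<lambda>x. c * g x) (\<lambda>x. c * f' x) (\<lambda>x. c * g' x)"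
  using assms unfolding column_solution_def
  by (elim conjE, intro conjI)
     (rule primitive_cong[OF primitive_cmult[where c = c]], assumption, simp, simp add: algebra_simps)+

section \<open>From columns to matrix solutions and back\<close>

text \<open>It serves both directions between a matrix function and its entries: with the four
  positions as index set, and with a one-element index set.\<close>

lemma abs_cont_on_sum_bound:
  assumes I: "finite I" and f: "\<And>i. i \<in> I \<Longrightarrow> abs_cont_on a b (f i)"
    and le: "\<And>x y. norm (F x - F y) \<le> (\<Sum>i\<in>I. norm (f i x - f i y))"
  shows "abs_cont_on a b F"
  unfolding abs_cont_on_def
proof (intro allI impI)
  fix e :: real assume e: "e > 0"
  \<comment> \<open>The \<open>+ 1\<close> covers an empty index set and makes the final inequality
    strict.\<close>
  define e' where "e' = e / (real (card I) + 1)"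
  have e': "e' > 0" using e by (simp add: e'_def add_nonneg_pos)
  have "\<forall>i\<in>I. \<exists>\<delta>>0. \<forall>d T. d division_of T \<and> T \<subseteq> {a..b} \<and> (\<Sum>I\<in>d. Sup I - Inf I) < \<delta>
        \<longrightarrow> (\<Sum>J\<in>d. norm (f i (Sup J) - f i (Inf J))) < e'"
    using f e' unfolding abs_cont_on_def by simp
  from bchoice[OF this] obtain D where D: "\<forall>i\<in>I. D i > 0 \<and> (\<forall>d T. d division_of T \<and> T \<subseteq> {a..b} \<and> (\<Sum>I\<in>d. Sup I - Inf I) < D i
        \<longrightarrow> (\<Sum>J\<in>d. norm (f i (Sup J) - f i (Inf J))) < e')" by blast
  show "\<exists>\<delta>>0. \<forall>d T. d division_of T \<and> T \<subseteq> {a..b} \<and> (\<Sum>I\<in>d. Sup I - Inf I) < \<delta> \<longrightarrow> (\<Sum>J\<in>d. norm (F (Sup J) - F (Inf J))) < e"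
  proof (intro exI[of _ "Min (insert 1 (D ` I))"] conjI allI impI)
    show "Min (insert 1 (D ` I)) > 0" using D I by auto
    fix d T assume dT: "d division_of T \<and> T \<subseteq> {a..b} \<and> (\<Sum>I\<in>d. Sup I - Inf I) < Min (insert 1 (D ` I))"
    have "(\<Sum>J\<in>d. norm (F (Sup J) - F (Inf J))) \<le> (\<Sum>J\<in>d. \<Sum>i\<in>I. norm (f i (Sup J) - f i (Inf J)))"
      by (rule sum_mono) (rule le)
    also have "\<dots> = (\<Sum>i\<in>I. \<Sum>J\<in>d. norm (f i (Sup J) - f i (Inf J)))" by (rule sum.swap)
    also have "\<dots> \<le> (\<Sum>i\<in>I. e')"
    proof (rule sum_mono)
      fix i assume i: "i \<in> I"
      have "Min (insert 1 (D ` I)) \<le> D i" using i I by auto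
      then have "(\<Sum>I\<in>d. Sup I - Inf I) < D i" using dT by linarith
      then show "(\<Sum>J\<in>d. norm (f i (Sup J) - f i (Inf J))) \<le> e'"
        using D i dT by (intro less_imp_le) blast
    qed
    also have "\<dots> < e" using e by (simp add: e'_def field_simps)
    finally show "(\<Sum>J\<in>d. norm (F (Sup J) - F (Inf J))) < e" .
  qed
qed

lemma norm_cmat_le: "norm (A :: cmat) \<le> (\<Sum>p\<in>UNIV. norm (A $ fst p $ snd p))"
proof -
  have "norm A \<le> (\<Sum>i\<in>UNIV. norm (A $ i))" unfolding norm_vec_def by (rule L2_set_le_sum) auto
  also have "\<dots> \<le> (\<Sum>i\<in>UNIV. \<Sum>j\<in>UNIV. norm (A $ i $ j))"
    by (rule sum_mono) (subst norm_vec_def, rule L2_set_le_sum, auto)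
  also have "\<dots> = (\<Sum>p\<in>UNIV. norm (A $ fst p $ snd p))"
    by (simp add: sum.cartesian_product split_beta UNIV_Times_UNIV)
  finally show ?thesis .
qed

lemma has_vector_derivative_cmat:
  fixes F :: "real \<Rightarrow> cmat"
  assumes "\<And>i j. ((\<lambda>x. F x $ i $ j) has_vector_derivative D $ i $ j) (at x within S)"
  shows "(F has_vector_derivative D) (at x within S)"
  using assms unfolding has_vector_derivative_def has_derivative_within
  by (auto intro!: vec_tendstoI bounded_linear_scaleR_left)

lemma has_vector_derivative_cmat_nth:
  fixes F :: "real \<Rightarrow> cmat"
  assumes "(F has_vector_derivative D) (at x within S)"
  shows "((\<lambda>x. F x $ i $ j) has_vector_derivative D $ i $ j) (at x within S)"
  by (rule bounded_linear.has_vector_derivative[OF _ assms])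
     (rule bounded_linear_compose[OF bounded_linear_vec_nth bounded_linear_vec_nth, unfolded comp_def])

text \<open>\<open>eps\<close> exchanges the rows, so the first row of the equation determines the
  second row of \<open>G\<close> and conversely.\<close>

lemma ode_matrix_iff:
  fixes F G :: cmat
  shows "- (eps ** G) + Qmat z ** F = mat \<mu> ** F \<longleftrightarrow>
    (\<forall>j. G $ 1 $ j = cnj z * F $ 1 $ j - \<mu> * F $ 2 $ j \<and> G $ 2 $ j = z * F $ 2 $ j - \<mu> * F $ 1 $ j)"
  by (auto simp: vec_eq_iff forall_2 eps_def Qmat_def matrix_matrix_mult_def mat_def sum_2 algebra_simps add_eq_0_iff)
    
lemma solution_of_column_solution:
  assumes "\<And>j. column_solution q \<mu> (\<lambda>x. F x $ 1 $ j) (\<lambda>x. F x $ 2 $ j) (\<lambda>x. F' x $ 1 $ j) (\<lambda>x. F' x $ 2 $ j)"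
  shows "solution q \<mu> F F'"
proof -
  have p: "primitive (\<lambda>x. F x $ i $ j) (\<lambda>x. F' x $ i $ j)"
    and p2: "primitive (\<lambda>x. F' x $ 1 $ j) (\<lambda>x. cnj (q x) * F x $ 1 $ j - \<mu> * F x $ 2 $ j)"
     "primitive (\<lambda>x. F' x $ 2 $ j) (\<lambda>x. q x * F x $ 2 $ j - \<mu> * F x $ 1 $ j)" for i j
    using assms[of j] exhaust_2[of i] unfolding column_solution_def by auto
  have p3: "\<exists>h. primitive (\<lambda>x. F' x $ i $ j) h" for i j using p2[of j] exhaust_2[of i] by auto
  have c: "continuous_on {0..} (\<lambda>x. F' x $ i $ j)" for i j using p3[of i j] primitive_continuous by blast
  show ?thesis unfolding solution_def
  proof (intro conjI allI impI)
    show "(F has_vector_derivative F' x) (at x within {0..})" if "x \<ge> 0" for x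
      by (rule has_vector_derivative_cmat) (rule primitive_deriv[OF p c that])
    show "abs_cont_on 0 b F'" for b
    proof (rule abs_cont_on_sum_bound[where I = "UNIV :: (2 \<times> 2) set" and f = "\<lambda>p x. F' x $ fst p $ snd p"])
      show "abs_cont_on 0 b (\<lambda>x. F' x $ fst i $ snd i)" for i :: "2 \<times> 2"
        using p3 primitive_abs_cont by blast
      show "norm (F' x - F' y) \<le> (\<Sum>i\<in>UNIV. norm (F' x $ fst i $ snd i - F' y $ fst i $ snd i))" for x y
        using norm_cmat_le[of "F' x - F' y"] by simp
    qed auto
    have "AE x in lebesgue. \<forall>j\<in>UNIV. x > 0 \<longrightarrow> ((\<lambda>x. F' x $ 1 $ j) has_vector_derivative cnj (q x) * F x $ 1 $ j - \<mu> * F x $ 2 $ j) (at x)"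
      by (intro AE_finite_allI primitive_AE p2 finite)
    moreover have "AE x in lebesgue. \<forall>j\<in>UNIV. x > 0 \<longrightarrow> ((\<lambda>x. F' x $ 2 $ j) has_vector_derivative q x * F x $ 2 $ j - \<mu> * F x $ 1 $ j) (at x)"
      by (intro AE_finite_allI primitive_AE p2 finite)
    ultimately show "AE x in lebesgue. x > 0 \<longrightarrow>
        (\<exists>F''. (F' has_vector_derivative F'') (at x) \<and> - (eps ** F'') + Qmat (q x) ** F x = mat \<mu> ** F x)"
    proof eventually_elim
      case (elim x)
      define G :: cmat where "G = (\<chi> i j. if i = 1 then cnj (q x) * F x $ 1 $ j - \<mu> * F x $ 2 $ j else q x * F x $ 2 $ j - \<mu> * F x $ 1 $ j)"
      show ?case
      proof (intro impI exI[of _ G] conjI)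
        assume x: "x > 0"
        show "(F' has_vector_derivative G) (at x)"
        proof (rule has_vector_derivative_cmat)
          fix i j show "((\<lambda>x. F' x $ i $ j) has_vector_derivative G $ i $ j) (at x)"
            using elim x exhaust_2[of i] by (auto simp: G_def)
        qed
        show "- (eps ** G) + Qmat (q x) ** F x = mat \<mu> ** F x"
          unfolding ode_matrix_iff by (simp add: G_def)
      qed
    qed
  qed
qed

text \<open>\<open>F\<close> is continuous and \<open>q\<close> integrable, so the right-hand sides
  are absolutely integrable and the almost everywhere equation can be integrated by
  \<open>abs_cont_imp_primitive\<close>.\<close>

lemma column_solution_of_solution:
  assumes sol: "solution q \<mu> F F'" and q: "integrable lborel q"
  shows "column_solution q \<mu> (\<lambda>x. F x $ 1 $ j) (\<lambda>x. F x $ 2 $ j) (\<lambda>x. F' x $ 1 $ j) (\<lambda>x. F' x $ 2 $ j)"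
proof -
  have d: "((\<lambda>x. F x $ i $ j) has_vector_derivative F' x $ i $ j) (at x within {0..})" if "x \<ge> 0" for x i j
    using sol that unfolding solution_def by (intro has_vector_derivative_cmat_nth) auto
  have c: "continuous_on {0..b} (\<lambda>x. F x $ i $ j)" for i j b
    by (rule continuous_on_vector_derivative) (rule has_vector_derivative_within_subset[OF d], auto)
  have ac: "abs_cont_on 0 b (\<lambda>x. F' x $ i $ j)" if "b > 0" for b i j
  proof (rule abs_cont_on_sum_bound[where I = "{()}" and f = "\<lambda>_. F'"])
    show "abs_cont_on 0 b F'" using sol that unfolding solution_def by auto
    show "norm (F' x $ i $ j - F' y $ i $ j) \<le> (\<Sum>i\<in>{()}. norm (F' x - F' y))" for x y
      using order_trans[OF Finite_Cartesian_Product.norm_nth_le Finite_Cartesian_Product.norm_nth_le, of "F' x - F' y" i j] by simp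
  qed auto
  have sae: "AE x in lebesgue. x > 0 \<longrightarrow>
      (\<exists>F''. (F' has_vector_derivative F'') (at x) \<and> - (eps ** F'') + Qmat (q x) ** F x = mat \<mu> ** F x)"
    using sol unfolding solution_def by (elim conjE)
  have ae: "AE x in lebesgue. x > 0 \<longrightarrow> (\<forall>j. ((\<lambda>x. F' x $ 1 $ j) has_vector_derivative cnj (q x) * F x $ 1 $ j - \<mu> * F x $ 2 $ j) (at x) \<and>
      ((\<lambda>x. F' x $ 2 $ j) has_vector_derivative q x * F x $ 2 $ j - \<mu> * F x $ 1 $ j) (at x))"
    using sae
  proof eventually_elim
    case (elim x)
    show ?case
    proof (intro impI allI)
      fix j
      assume "x > 0"
      then obtain G where G: "(F' has_vector_derivative G) (at x)" "- (eps ** G) + Qmat (q x) ** F x = mat \<mu> ** F x"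
        using elim by blast
      then show "((\<lambda>x. F' x $ 1 $ j) has_vector_derivative cnj (q x) * F x $ 1 $ j - \<mu> * F x $ 2 $ j) (at x) \<and>
      ((\<lambda>x. F' x $ 2 $ j) has_vector_derivative q x * F x $ 2 $ j - \<mu> * F x $ 1 $ j) (at x)"
        using has_vector_derivative_cmat_nth[OF G(1), of 1 j] has_vector_derivative_cmat_nth[OF G(1), of 2 j]
        unfolding ode_matrix_iff by auto
    qed
  qed
  have qi: "q absolutely_integrable_on {0..x}" for x
    using q by (intro set_integrable_lborel_absint) (auto simp: set_integrable_def intro: integrable_mult_indicator)
  have qi': "(\<lambda>x. cnj (q x)) absolutely_integrable_on {0..x}" for x
    using absolutely_integrable_linear[OF qi bounded_linear_cnj] by (simp add: comp_def)
  have mu: "(\<lambda>x. \<mu> * F x $ i $ j) absolutely_integrable_on {0..b}" for i b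
    by (intro absolutely_integrable_continuous_real continuous_intros c)
  have i: "(\<lambda>x. cnj (q x) * F x $ 1 $ j - \<mu> * F x $ 2 $ j) absolutely_integrable_on {0..b}"
    "(\<lambda>x. q x * F x $ 2 $ j - \<mu> * F x $ 1 $ j) absolutely_integrable_on {0..b}" for b
    using absint_continuous_mult[OF c[of b 1 j] qi'] absint_continuous_mult[OF c[of b 2 j] qi]
      mu[of b 1] mu[of b 2]
    by (auto intro!: set_integral_diff(1) simp: mult.commute)
  have p1: "primitive (\<lambda>x. F' x $ 1 $ j) (\<lambda>x. cnj (q x) * F x $ 1 $ j - \<mu> * F x $ 2 $ j)"
    using ae by (intro abs_cont_imp_primitive ac i) (auto elim: eventually_mono)
  have p2: "primitive (\<lambda>x. F' x $ 2 $ j) (\<lambda>x. q x * F x $ 2 $ j - \<mu> * F x $ 1 $ j)"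
    using ae by (intro abs_cont_imp_primitive ac i) (auto elim: eventually_mono)
  show ?thesis unfolding column_solution_def
    using p1 p2 d by (auto intro!: primitive_of_deriv elim: primitive_continuous)
qed

section \<open>The Wronskian and square integrability\<close>

lemma integrable_on_halfline:
  fixes f :: "real \<Rightarrow> real"
  assumes "set_integrable lebesgue {0<..} f" shows "f integrable_on {0..}"
proof -
  have "f integrable_on {0<..}" using assms by (rule set_lebesgue_integral_eq_integral(1))
  then show ?thesis
    by (rule integrable_spike_set) (rule negligible_subset[of "{0::real}"], simp, force)+
qed

lemma wronskian_const:
  assumes "column_solution q \<mu> f g f' g'" "column_solution q \<mu> a b a' b'" "x \<ge> 0"
  shows "a x * f' x + b x * g' x - a' x * f x - b' x * g x = a 0 * f' 0 + b 0 * g' 0 - a' 0 * f 0 - b' 0 * g 0"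
proof -
  have p: "primitive f f'" "primitive g g'" "primitive f' (\<lambda>x. cnj (q x) * f x - \<mu> * g x)" "primitive g' (\<lambda>x. q x * g x - \<mu> * f x)"
    "primitive a a'" "primitive b b'" "primitive a' (\<lambda>x. cnj (q x) * a x - \<mu> * b x)" "primitive b' (\<lambda>x. q x * b x - \<mu> * a x)"
    using assms unfolding column_solution_def by auto
  have "primitive (\<lambda>x. a x * f' x + b x * g' x - a' x * f x - b' x * g x) (\<lambda>x. 0)"
    by (rule primitive_cong[OF primitive_diff[OF primitive_diff[OF primitive_add[OF primitive_mult[OF p(5,3)] primitive_mult[OF p(6,4)]]
        primitive_mult[OF p(7,1)]] primitive_mult[OF p(8,2)]]]) (simp_all add: algebra_simps)
  from primitive_zero[OF this assms(3)] show ?thesis .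
qed

text \<open>Let \<open>w\<close> be the constant Wronskian of a square integrable solution \<open>(f, g)\<close> with a decaying one
  \<open>(a, b)\<close>. The function \<open>a f + b g\<close> has derivative \<open>w + 2 (a' f + b' g)\<close>, so it would grow
  linearly if \<open>w\<close> were nonzero, and \<open>(f, g)\<close> could not be square integrable.\<close>

lemma L2_column_solution_wronskian_zero:
  assumes fg: "column_solution q \<mu> f g f' g'" "f 0 = 0" "g 0 = 0"
    and L2: "(\<lambda>x. (norm (f x))\<^sup>2 + (norm (g x))\<^sup>2) integrable_on {0..}"
    and ab: "column_solution q \<mu> a b a' b'" and c: "c > 0"
    and C: "\<And>x. x \<ge> 0 \<Longrightarrow> norm (a x) \<le> C" "\<And>x. x \<ge> 0 \<Longrightarrow> norm (b x) \<le> C"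
    and D: "\<And>x. x \<ge> 0 \<Longrightarrow> norm (a' x) \<le> D * exp (- (c * x))" "\<And>x. x \<ge> 0 \<Longrightarrow> norm (b' x) \<le> D * exp (- (c * x))"
  shows "a 0 * f' 0 + b 0 * g' 0 = 0"
proof (rule ccontr)
  define w where "w = a 0 * f' 0 + b 0 * g' 0"
  assume "a 0 * f' 0 + b 0 * g' 0 \<noteq> 0"
  then have w: "norm w > 0" by (simp add: w_def)
  define n where "n x = (norm (f x))\<^sup>2 + (norm (g x))\<^sup>2" for x
  \<comment> \<open>An integrable majorant of \<open>a' f + b' g\<close>: each product is at most
    half the sum of the squares of its factors.\<close>
  define h where "h x = D\<^sup>2 * exp (- (2 * c) * x) + n x" for x
  have C0: "C \<ge> 0" using C(1)[of 0] norm_ge_zero order_trans by blast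
  have p: "primitive f f'" "primitive g g'" "primitive a a'" "primitive b b'"
    using fg ab unfolding column_solution_def by auto
  have ni: "n integrable_on {0..}" unfolding n_def by (rule L2)
  have hi: "h integrable_on {0..}" unfolding h_def
    using integrable_on_exp_minus_to_infinity[of "2 * c" 0] c
    by (intro integrable_add ni integrable_on_mult_right) auto
  have n0: "n x \<ge> 0" for x by (simp add: n_def)
  have h0: "h x \<ge> 0" for x by (simp add: h_def n0)
  define H where "H = integral {0..} h"
  have H0: "H \<ge> 0" unfolding H_def by (rule Henstock_Kurzweil_Integration.integral_nonneg[OF hi]) (simp add: h0)
  have pt: "norm (a' x * f x + b' x * g x) \<le> h x" if "x \<ge> 0" for x
  proof -
    have y: "s * t \<le> (s\<^sup>2 + t\<^sup>2) / 2" for s t :: real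
      using sum_squares_bound[of s t] by simp
    have e: "(D * exp (- (c * x)))\<^sup>2 = D\<^sup>2 * exp (- (2 * c) * x)"
      by (simp add: power_mult_distrib power2_eq_square exp_add[symmetric])
    have sq: "(norm (a' x))\<^sup>2 \<le> (D * exp (- (c * x)))\<^sup>2" "(norm (b' x))\<^sup>2 \<le> (D * exp (- (c * x)))\<^sup>2"
      using D[OF that] by (auto intro!: power_mono)
    have tri: "norm (a' x * f x + b' x * g x) \<le> norm (a' x) * norm (f x) + norm (b' x) * norm (g x)"
      using norm_triangle_ineq[of "a' x * f x" "b' x * g x"] by (simp add: norm_mult)
    have lin: "P \<le> R + S \<Longrightarrow> R \<le> (A + F) / 2 \<Longrightarrow> S \<le> (B + G) / 2 \<Longrightarrow> A \<le> E \<Longrightarrow> B \<le> E \<Longrightarrow> 0 \<le> F \<Longrightarrow> 0 \<le> G \<Longrightarrow> P \<le> E + (F + G)"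
      for P R S A B E F G :: real by argo
    show ?thesis
      unfolding h_def n_def e[symmetric] by (rule lin[OF tri y y sq zero_le_power2 zero_le_power2])
  qed
  define G where "G x = a x * f x + b x * g x" for x
  have pG: "primitive (\<lambda>x. G x - w * of_real x) (\<lambda>x. 2 * (a' x * f x + b' x * g x))"
  proof (rule primitive_cong)
    have "primitive (\<lambda>x. complex_of_real x) (\<lambda>x. 1)"
      by (rule primitive_of_deriv) (auto intro!: derivative_eq_intros)
    then show "primitive (\<lambda>x. (a x * f x + b x * g x) - w * of_real x) (\<lambda>x. (a x * f' x + a' x * f x + (b x * g' x + b' x * g x)) - w * 1)"
      by (intro primitive_diff primitive_add primitive_mult primitive_cmult p)
    show "2 * (a' x * f x + b' x * g x) = (a x * f' x + a' x * f x + (b x * g' x + b' x * g x)) - w * 1" if "x \<ge> 0" for x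
      using wronskian_const[OF fg(1) ab that] fg(2,3) by (simp add: w_def algebra_simps)
  qed (simp add: G_def)
  have Gb: "norm (G x - w * of_real x) \<le> 2 * H" if x: "x \<ge> 0" for x
  proof -
    have "G x - w * of_real x = integral {0..x} (\<lambda>x. 2 * (a' x * f x + b' x * g x))"
      using primitive_eq[OF pG x] fg by (simp add: G_def)
    also have "norm \<dots> \<le> integral {0..x} (\<lambda>x. 2 * h x)"
    proof (rule Henstock_Kurzweil_Integration.integral_norm_bound_integral)
      show "(\<lambda>x. 2 * (a' x * f x + b' x * g x)) integrable_on {0..x}"
        using primitive_absint[OF pG] by (rule set_lebesgue_integral_eq_integral(1))
      show "(\<lambda>x. 2 * h x) integrable_on {0..x}"
        by (rule integrable_on_subinterval[of _ "{0..}"]) (use hi in auto)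
      show "norm (2 * (a' t * f t + b' t * g t)) \<le> 2 * h t" if "t \<in> {0..x}" for t
        using pt[of t] that by (subst norm_mult) simp
    qed
    also have "\<dots> \<le> integral {0..} (\<lambda>x. 2 * h x)"
      by (intro integral_subset_le integrable_on_subinterval[of _ "{0..}"])
         (use hi h0 in auto)
    also have "\<dots> = 2 * H" by (simp add: H_def)
    finally show ?thesis .
  qed
  \<comment> \<open>Beyond \<open>x0\<close> the linear term exceeds the remainder bound
    \<open>2 H\<close> by more than \<open>2 C\<close>, which forces
    \<open>norm f + norm g > 2\<close> and hence \<open>n \<ge> 1\<close>.\<close>
  define x0 where "x0 = (2 * H + 2 * C + 1) / norm w"
  have x0: "x0 \<ge> 0" using H0 C0 w by (simp add: x0_def)
  have n1: "n x \<ge> 1" if x: "x \<ge> x0" for x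
  proof -
    have x': "x \<ge> 0" using x x0 by simp
    have "norm w * x0 = 2 * H + 2 * C + 1" using w by (simp add: x0_def)
    then have "norm w * x \<ge> 2 * H + 2 * C + 1" using x w mult_left_mono[OF x, of "norm w"] by simp
    moreover have "norm (w * of_real x) \<le> norm (G x) + 2 * H"
      using Gb[OF x'] norm_triangle_ineq3[of "w * of_real x" "G x"] by (simp add: norm_minus_commute)
    moreover have "norm (w * of_real x) = norm w * x" using x' by (simp add: norm_mult)
    moreover have "norm (G x) \<le> C * (norm (f x) + norm (g x))"
    proof -
      have "norm (G x) \<le> norm (a x) * norm (f x) + norm (b x) * norm (g x)"
        unfolding G_def norm_mult[symmetric] by (rule norm_triangle_ineq)
      also have "\<dots> \<le> C * norm (f x) + C * norm (g x)"
        using C[OF x'] by (intro add_mono mult_right_mono) auto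
      finally show ?thesis by (simp add: algebra_simps)
    qed
    ultimately have "C * (norm (f x) + norm (g x)) > C * 2" by linarith
    then have "norm (f x) + norm (g x) > 2" using C0 by (simp add: mult_less_cancel_left)
    then have "(norm (f x) + norm (g x))\<^sup>2 \<ge> 2\<^sup>2" by (intro power_mono) auto
    moreover have "(norm (f x) + norm (g x))\<^sup>2 \<le> 2 * n x"
      using sum_squares_bound[of "norm (f x)" "norm (g x)"] by (simp add: n_def power2_sum)
    ultimately show ?thesis by simp
  qed
  define N where "N = integral {0..} n"
  \<comment> \<open>The interval from \<open>x0\<close> to \<open>X\<close> is longer than the total
    integral of \<open>n\<close>, although \<open>n \<ge> 1\<close> on it.\<close>
  define X where "X = x0 + (max 0 N + 1)"
  have i1: "n integrable_on {x0..X}" using x0 by (intro integrable_on_subinterval[OF ni]) auto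
  have "X - x0 = integral {x0..X} (\<lambda>_. 1)" by (simp add: X_def)
  also have "\<dots> \<le> integral {x0..X} n" using n1 i1 by (intro integral_le) auto
  also have "\<dots> \<le> N" unfolding N_def using x0 by (intro integral_subset_le i1 ni) (auto simp: n0)
  finally show False by (simp add: X_def)
qed

lemma norm_column_sq: "(norm (column j (A :: cmat)))\<^sup>2 = (norm (A $ 1 $ j))\<^sup>2 + (norm (A $ 2 $ j))\<^sup>2"
  by (simp add: norm_vec_def L2_set_def sum_2 column_def)

lemma column_solution_add_mult:
  fixes M :: cmat
  assumes "\<And>j. column_solution q \<mu> (\<lambda>x. T x $ 1 $ j) (\<lambda>x. T x $ 2 $ j) (\<lambda>x. T' x $ 1 $ j) (\<lambda>x. T' x $ 2 $ j)"
    and "\<And>j. column_solution q \<mu> (\<lambda>x. F x $ 1 $ j) (\<lambda>x. F x $ 2 $ j) (\<lambda>x. F' x $ 1 $ j) (\<lambda>x. F' x $ 2 $ j)"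
  shows "column_solution q \<mu> (\<lambda>x. (T x + F x ** M) $ 1 $ j) (\<lambda>x. (T x + F x ** M) $ 2 $ j) (\<lambda>x. (T' x + F' x ** M) $ 1 $ j) (\<lambda>x. (T' x + F' x ** M) $ 2 $ j)"
proof -
  have "column_solution q \<mu> (\<lambda>x. T x $ 1 $ j + (M $ 1 $ j * F x $ 1 $ 1 + M $ 2 $ j * F x $ 1 $ 2))
     (\<lambda>x. T x $ 2 $ j + (M $ 1 $ j * F x $ 2 $ 1 + M $ 2 $ j * F x $ 2 $ 2))
     (\<lambda>x. T' x $ 1 $ j + (M $ 1 $ j * F' x $ 1 $ 1 + M $ 2 $ j * F' x $ 1 $ 2))
     (\<lambda>x. T' x $ 2 $ j + (M $ 1 $ j * F' x $ 2 $ 1 + M $ 2 $ j * F' x $ 2 $ 2))"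
    by (intro column_solution_add column_solution_cmult assms)
  then show ?thesis by (simp add: matrix_matrix_mult_def sum_2 mult.commute)
qed

lemma in_L2_of_decay:
  fixes f :: "real \<Rightarrow> complex^2"
  assumes f: "continuous_on {0..} f" and c: "c > 0" and le: "\<And>x. x \<ge> 0 \<Longrightarrow> norm (f x) \<le> D * exp (- (c * x))"
  shows "in_L2 f"
  unfolding in_L2_def
proof
  have fc: "continuous_on {0<..} f" by (rule continuous_on_subset[OF f]) auto
  have "(\<lambda>x. indicator {0<..} x *\<^sub>R f x) \<in> borel_measurable borel"
    by (rule borel_measurable_continuous_on_indicator[OF _ fc]) simp
  then show "set_borel_measurable lebesgue {0<..} f"
    unfolding set_borel_measurable_def by (intro measurable_completion) simp
  have "(\<lambda>x. indicator {0<..} x *\<^sub>R (norm (f x))\<^sup>2) \<in> borel_measurable borel"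
    by (rule borel_measurable_continuous_on_indicator) (auto intro!: continuous_intros fc)
  then have m: "(\<lambda>x. indicator {0<..} x *\<^sub>R (norm (f x))\<^sup>2) \<in> borel_measurable lebesgue"
    by (intro measurable_completion) simp
  have "(\<lambda>x. D\<^sup>2 * exp (- (2 * c) * x)) integrable_on {0..}"
    using integrable_on_exp_minus_to_infinity[of "2 * c" 0] c by (intro integrable_on_mult_right) auto
  then have "(\<lambda>x. D\<^sup>2 * exp (- (2 * c) * x)) absolutely_integrable_on {0..}"
    by (rule nonnegative_absolutely_integrable_1) auto
  then have i: "set_integrable lebesgue {0<..} (\<lambda>x. D\<^sup>2 * exp (- (2 * c) * x))"
    by (rule set_integrable_subset) auto
  show "set_integrable lebesgue {0<..} (\<lambda>x. (norm (f x))\<^sup>2)"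
    unfolding set_integrable_def
  proof (rule Bochner_Integration.integrable_bound[OF i[unfolded set_integrable_def] m], rule AE_I2)
    fix x
    have e: "(D * exp (- (c * x)))\<^sup>2 = D\<^sup>2 * exp (- (2 * c) * x)"
      by (simp add: power_mult_distrib power2_eq_square exp_add[symmetric])
    have "x > 0 \<Longrightarrow> (norm (f x))\<^sup>2 \<le> (D * exp (- (c * x)))\<^sup>2" using le[of x] by (intro power_mono) auto
    then show "norm (indicator {0<..} x *\<^sub>R (norm (f x))\<^sup>2) \<le> norm (indicator {0<..} x *\<^sub>R (D\<^sup>2 * exp (- (2 * c) * x)))"
      unfolding e by (auto simp: indicator_def)
  qed
qed

context small_potential begin

section \<open>Identification of the Weyl matrix\<close>

lemma weyl_data_column_solution:
  assumes "weyl_data u u' v v' \<sigma> z" "Im z > 0"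
  defines "f \<equiv> \<lambda>x. (u x + v x) / 2" and "g \<equiv> \<lambda>x. (u x - v x) / 2"
    and "f' \<equiv> \<lambda>x. (u' x + v' x) / 2" and "g' \<equiv> \<lambda>x. (u' x - v' x) / 2"
  obtains D where "column_solution q (z\<^sup>2) f g f' g'" "f 0 = (1 + \<sigma>) / 2" "g 0 = (1 - \<sigma>) / 2" "D \<ge> 0"
    "\<And>x. x \<ge> 0 \<Longrightarrow> norm (f x) \<le> D * exp (- (Im z * x))" "\<And>x. x \<ge> 0 \<Longrightarrow> norm (g x) \<le> D * exp (- (Im z * x))"
    "\<And>x. x \<ge> 0 \<Longrightarrow> norm (f' x) \<le> D * exp (- (Im z * x))" "\<And>x. x \<ge> 0 \<Longrightarrow> norm (g' x) \<le> D * exp (- (Im z * x))"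
proof -
  obtain D where D: "\<forall>x\<ge>0. norm (u x) \<le> D * exp (- (Im z * x)) \<and> norm (v x) \<le> D * exp (- (Im z * x)) \<and>
       norm (u' x) \<le> D * exp (- (Im z * x)) \<and> norm (v' x) \<le> D * exp (- (Im z * x))"
    using assms unfolding weyl_data_def by blast
  have D0: "D \<ge> 0" using order_trans[OF norm_ge_zero, of "u 0" D] D by auto
  have avg: "norm ((a + b) / 2) \<le> L" "norm ((a - b) / 2) \<le> L" if "norm a \<le> L" "norm b \<le> L" for a b :: complex and L
    using that norm_triangle_ineq[of a b] norm_triangle_ineq4[of a b] by (auto simp: norm_divide)
  show thesis
  proof (rule that[OF _ _ _ D0])
    show "column_solution q (z\<^sup>2) f g f' g'" unfolding f_def g_def f'_def g'_def
      using assms(1) unfolding weyl_data_def by (intro column_solution_of_rotated) auto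
    show "f 0 = (1 + \<sigma>) / 2" "g 0 = (1 - \<sigma>) / 2" using assms(1) by (auto simp: weyl_data_def f_def g_def)
  qed (use D avg in \<open>auto simp: f_def g_def f'_def g'_def\<close>)
qed

text \<open>Let \<open>\<Psi>\<close> be the decaying solution with \<open>\<Psi> 0 = eps\<close>.
  Then \<open>\<Theta> - \<Phi> M = \<Psi>\<close> forces \<open>M = \<Psi>' 0\<close>, because
  \<open>\<Theta>' 0 = 0\<close> and \<open>\<Phi>' 0 = - mat 1\<close>; the definition of
  \<open>M\<close> lists these derivatives in the original coordinates. For another Weyl matrix
  \<open>N\<close>, the difference of the two square integrable solutions vanishes at 0 with
  derivative \<open>M - N\<close>, and its Wronskians with the columns of \<open>\<Psi>\<close> are
  the entries of \<open>M - N\<close>.\<close>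

lemma Weyl_M_eq:
  assumes z: "z \<in> spectral_strip k" "Im z > 0"
    and d1: "weyl_data u1 u1' v1 v1' (-1) z" and d2: "weyl_data u2 u2' v2 v2' 1 z"
  defines "M \<equiv> \<chi> i j. if j = 1 then (if i = 1 then (u1' 0 + v1' 0) / 2 else (u1' 0 - v1' 0) / 2)
                          else (if i = 1 then (u2' 0 + v2' 0) / 2 else (u2' 0 - v2' 0) / 2)"
  shows "Weyl_M q (z\<^sup>2) = M"
  unfolding Weyl_M_def
proof (rule the_equality)
  let ?\<mu> = "z\<^sup>2"
  define f where "f j x = (if j = (1::2) then (u1 x + v1 x) / 2 else (u2 x + v2 x) / 2)" for j x
  define g where "g j x = (if j = (1::2) then (u1 x - v1 x) / 2 else (u2 x - v2 x) / 2)" for j x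
  define f' where "f' j x = (if j = (1::2) then (u1' x + v1' x) / 2 else (u2' x + v2' x) / 2)" for j x
  define g' where "g' j x = (if j = (1::2) then (u1' x - v1' x) / 2 else (u2' x - v2' x) / 2)" for j x
  obtain D1 where D1: "column_solution q ?\<mu> (f 1) (g 1) (f' 1) (g' 1)" "f 1 0 = 0" "g 1 0 = 1" "D1 \<ge> 0"
    "\<And>x. x \<ge> 0 \<Longrightarrow> norm (f 1 x) \<le> D1 * exp (- (Im z * x))" "\<And>x. x \<ge> 0 \<Longrightarrow> norm (g 1 x) \<le> D1 * exp (- (Im z * x))"
    "\<And>x. x \<ge> 0 \<Longrightarrow> norm (f' 1 x) \<le> D1 * exp (- (Im z * x))" "\<And>x. x \<ge> 0 \<Longrightarrow> norm (g' 1 x) \<le> D1 * exp (- (Im z * x))"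
    by (rule weyl_data_column_solution[OF d1 z(2)]) (simp_all add: f_def[abs_def] g_def[abs_def] f'_def[abs_def] g'_def[abs_def])
  obtain D2 where D2: "column_solution q ?\<mu> (f 2) (g 2) (f' 2) (g' 2)" "f 2 0 = 1" "g 2 0 = 0" "D2 \<ge> 0"
    "\<And>x. x \<ge> 0 \<Longrightarrow> norm (f 2 x) \<le> D2 * exp (- (Im z * x))" "\<And>x. x \<ge> 0 \<Longrightarrow> norm (g 2 x) \<le> D2 * exp (- (Im z * x))"
    "\<And>x. x \<ge> 0 \<Longrightarrow> norm (f' 2 x) \<le> D2 * exp (- (Im z * x))" "\<And>x. x \<ge> 0 \<Longrightarrow> norm (g' 2 x) \<le> D2 * exp (- (Im z * x))"
    by (rule weyl_data_column_solution[OF d2 z(2)]) (simp_all add: f_def[abs_def] g_def[abs_def] f'_def[abs_def] g'_def[abs_def])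
  have Mf: "M $ 1 $ j = f' j 0" "M $ 2 $ j = g' j 0" for j by (auto simp: M_def f'_def g'_def)
  define \<Psi> :: "real \<Rightarrow> cmat" where "\<Psi> x = (\<chi> i j. if i = 1 then f j x else g j x)" for x
  define \<Psi>' :: "real \<Rightarrow> cmat" where "\<Psi>' x = (\<chi> i j. if i = 1 then f' j x else g' j x)" for x
  have \<Psi>n: "\<Psi> x $ 1 $ j = f j x" "\<Psi> x $ 2 $ j = g j x" "\<Psi>' x $ 1 $ j = f' j x" "\<Psi>' x $ 2 $ j = g' j x" for x j
    by (auto simp: \<Psi>_def \<Psi>'_def)
  have cs: "column_solution q ?\<mu> (\<lambda>x. \<Psi> x $ 1 $ j) (\<lambda>x. \<Psi> x $ 2 $ j) (\<lambda>x. \<Psi>' x $ 1 $ j) (\<lambda>x. \<Psi>' x $ 2 $ j)" for j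
    using D1(1) D2(1) exhaust_2[of j] by (auto simp: \<Psi>n)
  have \<Psi>L2: "in_L2 (\<lambda>x. column j (\<Psi> x))" for j
  proof (rule in_L2_of_decay[where c = "Im z" and D = "2 * (D1 + D2)"])
    have "continuous_on {0..} (\<lambda>x. \<Psi> x $ i $ j)" for i
      using cs[of j] exhaust_2[of i] by (auto simp: column_solution_def dest: primitive_continuous)
    then show "continuous_on {0..} (\<lambda>x. column j (\<Psi> x))"
      by (simp add: column_def continuous_on_vec_lambda)
    show "norm (column j (\<Psi> x)) \<le> 2 * (D1 + D2) * exp (- (Im z * x))" if x: "x \<ge> 0" for x
    proof -
      have "norm (column j (\<Psi> x)) \<le> (\<Sum>i\<in>UNIV. norm (column j (\<Psi> x) $ i))"
        unfolding norm_vec_def by (rule L2_set_le_sum) auto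
      also have "\<dots> = norm (f j x) + norm (g j x)" by (simp add: sum_2 column_def \<Psi>n)
      also have "\<dots> \<le> (D1 + D2) * exp (- (Im z * x)) + (D1 + D2) * exp (- (Im z * x))"
      proof -
        have "D1 * exp (- (Im z * x)) \<le> (D1 + D2) * exp (- (Im z * x))" "D2 * exp (- (Im z * x)) \<le> (D1 + D2) * exp (- (Im z * x))"
          using D1(4) D2(4) by (intro mult_right_mono; simp)+
        then have "norm (f 1 x) \<le> (D1 + D2) * exp (- (Im z * x))" "norm (g 1 x) \<le> (D1 + D2) * exp (- (Im z * x))"
          "norm (f 2 x) \<le> (D1 + D2) * exp (- (Im z * x))" "norm (g 2 x) \<le> (D1 + D2) * exp (- (Im z * x))"
          using D1(5,6)[OF x] D2(5,6)[OF x] by linarith+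
        then show ?thesis using exhaust_2[of j] by (elim disjE) (simp_all only: add_mono)
      qed
      finally show ?thesis by (simp add: algebra_simps)
    qed
  qed (rule z(2))
  obtain a a' b b' where ph1: "primitive a a'" "primitive b b'"
    "primitive a' (\<lambda>x. - z\<^sup>2 * a x + rot_pot (q x) (a x) (b x))" "primitive b' (\<lambda>x. z\<^sup>2 * b x + rot_pot (q x) (b x) (a x))"
    "a 0 = 0" "b 0 = 0" "a' 0 = -1" "b' 0 = -1" by (rule volterra_solution[OF z(1), of "-1" "-1"]) auto
  obtain c c' d d' where ph2: "primitive c c'" "primitive d d'"
    "primitive c' (\<lambda>x. - z\<^sup>2 * c x + rot_pot (q x) (c x) (d x))" "primitive d' (\<lambda>x. z\<^sup>2 * d x + rot_pot (q x) (d x) (c x))"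
    "c 0 = 0" "d 0 = 0" "c' 0 = -1" "d' 0 = 1" by (rule volterra_solution[OF z(1), of "-1" "1"]) auto
  define \<Phi> :: "real \<Rightarrow> cmat" where "\<Phi> x = (\<chi> i j. if j = 1 then (if i = 1 then (a x + b x) / 2 else (a x - b x) / 2)
      else (if i = 1 then (c x + d x) / 2 else (c x - d x) / 2))" for x
  define \<Phi>' :: "real \<Rightarrow> cmat" where "\<Phi>' x = (\<chi> i j. if j = 1 then (if i = 1 then (a' x + b' x) / 2 else (a' x - b' x) / 2)
      else (if i = 1 then (c' x + d' x) / 2 else (c' x - d' x) / 2))" for x
  have csp: "column_solution q ?\<mu> (\<lambda>x. \<Phi> x $ 1 $ j) (\<lambda>x. \<Phi> x $ 2 $ j) (\<lambda>x. \<Phi>' x $ 1 $ j) (\<lambda>x. \<Phi>' x $ 2 $ j)" for j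
    using column_solution_of_rotated[OF ph1(1-4)] column_solution_of_rotated[OF ph2(1-4)] exhaust_2[of j]
    by (auto simp: \<Phi>_def \<Phi>'_def)
  \<comment> \<open>\<open>\<Theta>\<close> is built from the other data as
    \<open>\<Psi> + \<Phi> M\<close>, so the required square integrability is that of
    \<open>\<Psi>\<close>.\<close>
  show "is_Weyl_matrix q ?\<mu> M"
    unfolding is_Weyl_matrix_def
  proof (rule exI[of _ \<Phi>], rule exI[of _ \<Phi>'], rule exI[of _ "\<lambda>x. \<Psi> x + \<Phi> x ** M"],
      rule exI[of _ "\<lambda>x. \<Psi>' x + \<Phi>' x ** M"], intro conjI allI)
    show "solution q ?\<mu> \<Phi> \<Phi>'" by (rule solution_of_column_solution) (rule csp)
    show "solution q ?\<mu> (\<lambda>x. \<Psi> x + \<Phi> x ** M) (\<lambda>x. \<Psi>' x + \<Phi>' x ** M)"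
      by (rule solution_of_column_solution) (rule column_solution_add_mult[OF cs csp])
    show p0: "\<Phi> 0 = 0" and p0': "\<Phi>' 0 = - mat 1"
      by (auto simp: vec_eq_iff forall_2 \<Phi>_def \<Phi>'_def ph1 ph2 mat_def)
    show "\<Psi> 0 + \<Phi> 0 ** M = eps"
      unfolding p0 by (auto simp: vec_eq_iff forall_2 \<Psi>n D1 D2 eps_def matrix_matrix_mult_def)
    show "\<Psi>' 0 + \<Phi>' 0 ** M = 0"
      unfolding p0' by (auto simp: vec_eq_iff forall_2 \<Psi>n Mf matrix_matrix_mult_def mat_def sum_2)
    fix j
    show "in_L2 (\<lambda>x. column j (\<Psi> x + \<Phi> x ** M - \<Phi> x ** M))" using \<Psi>L2 by simp
  qed
  fix N assume "is_Weyl_matrix q ?\<mu> N"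
  then obtain P P' T T' where N: "solution q ?\<mu> P P'" "P 0 = 0" "P' 0 = - mat 1" "solution q ?\<mu> T T'" "T 0 = eps" "T' 0 = 0"
    "\<And>j. in_L2 (\<lambda>x. column j (T x - P x ** N))" unfolding is_Weyl_matrix_def by blast
  \<comment> \<open>The difference of the two square integrable solutions, written with sums and
    right multiplications only, the form to which \<open>column_solution_add_mult\<close> applies
    twice.\<close>
  define E where "E x = \<Psi> x + (T x + P x ** (- N)) ** (- mat 1)" for x
  define E' where "E' x = \<Psi>' x + (T' x + P' x ** (- N)) ** (- mat 1)" for x
  have Eeq: "E x = \<Psi> x - (T x - P x ** N)" "E' x = \<Psi>' x - (T' x - P' x ** N)" for x
    by (simp_all add: E_def E'_def vec_eq_iff matrix_matrix_mult_def mat_def sum_2 forall_2)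
  have csE: "column_solution q ?\<mu> (\<lambda>x. E x $ 1 $ j) (\<lambda>x. E x $ 2 $ j) (\<lambda>x. E' x $ 1 $ j) (\<lambda>x. E' x $ 2 $ j)" for j
    unfolding E_def E'_def
    by (rule column_solution_add_mult[OF cs column_solution_add_mult[OF column_solution_of_solution[OF N(4) q] column_solution_of_solution[OF N(1) q]]])
  have E0: "E 0 = 0" unfolding Eeq N by (auto simp: vec_eq_iff forall_2 \<Psi>n D1 D2 eps_def matrix_matrix_mult_def)
  have E'0: "E' 0 = M - N" unfolding Eeq N by (auto simp: vec_eq_iff forall_2 \<Psi>n Mf matrix_matrix_mult_def mat_def sum_2)
  have L2: "(\<lambda>x. (norm (E x $ 1 $ j))\<^sup>2 + (norm (E x $ 2 $ j))\<^sup>2) integrable_on {0..}" for j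
  proof (rule measurable_bounded_by_integrable_imp_integrable)
    have cE: "continuous_on {0..} (\<lambda>x. E x $ i $ j)" for i
      using csE[of j] exhaust_2[of i] by (auto simp: column_solution_def dest: primitive_continuous)
    show "(\<lambda>x. (norm (E x $ 1 $ j))\<^sup>2 + (norm (E x $ 2 $ j))\<^sup>2) \<in> borel_measurable (lebesgue_on {0..})"
      by (intro continuous_imp_measurable_on_sets_lebesgue continuous_on_add continuous_on_power continuous_on_norm cE) auto
    from \<Psi>L2 have 1: "(\<lambda>x. (norm (column j (\<Psi> x)))\<^sup>2) integrable_on {0..}"
      unfolding in_L2_def by (intro integrable_on_halfline) auto
    have 2: "(\<lambda>x. (norm (column j (T x - P x ** N)))\<^sup>2) integrable_on {0..}"
      using N(7)[of j] unfolding in_L2_def by (intro integrable_on_halfline) auto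
    show "(\<lambda>x. 2 * (norm (column j (\<Psi> x)))\<^sup>2 + 2 * (norm (column j (T x - P x ** N)))\<^sup>2) integrable_on {0..}"
      by (intro integrable_add integrable_on_mult_right 1 2)
    show "norm ((norm (E x $ 1 $ j))\<^sup>2 + (norm (E x $ 2 $ j))\<^sup>2) \<le> 2 * (norm (column j (\<Psi> x)))\<^sup>2 + 2 * (norm (column j (T x - P x ** N)))\<^sup>2" for x
    proof -
      let ?s = "norm (column j (\<Psi> x))" and ?t = "norm (column j (T x - P x ** N))"
      have c: "column j (E x) = column j (\<Psi> x) - column j (T x - P x ** N)"
        unfolding Eeq by (simp add: column_def vec_eq_iff)
      have "(norm (column j (E x)))\<^sup>2 \<le> (?s + ?t)\<^sup>2"
        unfolding c by (intro power_mono norm_triangle_ineq4) auto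
      also have "\<dots> \<le> 2 * ?s\<^sup>2 + 2 * ?t\<^sup>2" using sum_squares_bound[of ?s ?t] by (simp add: power2_sum)
      finally show ?thesis unfolding norm_column_sq by simp
    qed
  qed auto
  have wz: "f i 0 * E' 0 $ 1 $ j + g i 0 * E' 0 $ 2 $ j = 0" for i j
  proof -
    have e1: "exp (- (Im z * x)) \<le> 1" if "x \<ge> 0" for x using that z by simp
    have b: "norm w \<le> L" if "norm w \<le> L * exp (- (Im z * x))" "x \<ge> 0" "L \<ge> 0" for w :: complex and L x
      using mult_left_mono[OF e1[OF that(2)] that(3)] that(1) by simp
    have "f 1 0 * E' 0 $ 1 $ j + g 1 0 * E' 0 $ 2 $ j = 0"
      by (rule L2_column_solution_wronskian_zero[OF csE _ _ L2 D1(1) z(2) b[OF D1(5) _ D1(4)] b[OF D1(6) _ D1(4)] D1(7,8)])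
         (simp_all add: E0)
    moreover have "f 2 0 * E' 0 $ 1 $ j + g 2 0 * E' 0 $ 2 $ j = 0"
      by (rule L2_column_solution_wronskian_zero[OF csE _ _ L2 D2(1) z(2) b[OF D2(5) _ D2(4)] b[OF D2(6) _ D2(4)] D2(7,8)])
         (simp_all add: E0)
    ultimately show ?thesis using exhaust_2[of i] by auto
  qed
  have "(M - N) $ i $ j = 0" for i j
    using wz[of 1 j] wz[of 2 j] exhaust_2[of i] unfolding D1 D2 E'0 by auto
  then show "N = M" by (simp add: vec_eq_iff)
qed

end

section \<open>Stieltjes inversion\<close>

text \<open>Uniqueness of measures, for vector-valued densities: half-lines generate the Borel sets
  and are stable under intersection, and complements are taken inside \<open>I\<close>, where the
  total integrals agree.\<close>

lemma set_integral_eq_on_borel: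
  fixes f g :: "real \<Rightarrow> 'a::{banach,second_countable_topology}"
  assumes M: "sets M = sets borel" and N: "sets N = sets borel" and I: "I \<in> sets borel"
    and f: "set_integrable M I f" and g: "set_integrable N I g"
    and eq: "\<And>d. (LINT t:I \<inter> {..d}|M. f t) = (LINT t:I \<inter> {..d}|N. g t)" "(LINT t:I|M. f t) = (LINT t:I|N. g t)"
    and A: "A \<in> sets borel"
  shows "(LINT t:I \<inter> A|M. f t) = (LINT t:I \<inter> A|N. g t)"
proof -
  have b: "sets borel = sigma_sets UNIV (range (\<lambda>a::real. {..a}))"
    by (subst borel_eq_atMost) simp
  have sub: "set_integrable M (I \<inter> B) f" "set_integrable N (I \<inter> B) g" if "B \<in> sets borel" for B
    using f g I that M N by (auto intro: set_integrable_subset)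
  have As: "A \<in> sigma_sets UNIV (range (\<lambda>a::real. {..a}))" using A b by simp
  have IS: "Int_stable (range (\<lambda>a::real. {..a}))"
  proof (rule Int_stableI_image)
    fix i j :: real
    have "{..i} \<inter> {..j} = {..min i j}" by auto
    then show "\<exists>k\<in>UNIV. {..i} \<inter> {..j} = {..k}" by blast
  qed
  have "range (\<lambda>a::real. {..a}) \<subseteq> Pow UNIV" by auto
  from IS this As show ?thesis
  proof (induction rule: sigma_sets_induct_disjoint)
    case (basic A)
    then show ?case using eq by auto
  next
    case empty
    then show ?case by (simp add: set_lebesgue_integral_def)
  next
    case (compl A)
    then have A: "A \<in> sets borel" using b by simp
    have AC: "UNIV - A \<in> sets borel" using A by auto
    have e: "I = (I \<inter> A) \<union> (I \<inter> (UNIV - A))" by auto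
    have "(LINT t:I|M. f t) = (LINT t:I \<inter> A|M. f t) + (LINT t:I \<inter> (UNIV - A)|M. f t)"
      by (subst e) (rule set_integral_Un[OF _ sub(1)[OF A] sub(1)[OF AC]], auto)
    moreover have "(LINT t:I|N. g t) = (LINT t:I \<inter> A|N. g t) + (LINT t:I \<inter> (UNIV - A)|N. g t)"
      by (subst e) (rule set_integral_Un[OF _ sub(2)[OF A] sub(2)[OF AC]], auto)
    ultimately show ?case using compl.IH eq(2) by (metis add_left_imp_eq)
  next
    case (union A)
    then have A: "A i \<in> sets borel" for i using b by auto
    have d: "i \<noteq> j \<Longrightarrow> (I \<inter> A i) \<inter> (I \<inter> A j) = {}" for i j
      using union.hyps(1) by (auto simp: disjoint_family_on_def)
    have U: "(\<Union>i. A i) \<in> sets borel" using A by auto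
    have "(LINT t:(\<Union>i. I \<inter> A i)|M. f t) = (\<Sum>i. (LINT t:I \<inter> A i|M. f t))"
      by (rule lebesgue_integral_countable_add) (use A I M d sub(1)[OF U] in auto)
    moreover have "(LINT t:(\<Union>i. I \<inter> A i)|N. g t) = (\<Sum>i. (LINT t:I \<inter> A i|N. g t))"
      by (rule lebesgue_integral_countable_add) (use A I N d sub(2)[OF U] in auto)
    ultimately show ?case using union.IH by simp
  qed
qed

text \<open>It rests on \<open>t\<^sup>2 \<le> 2 (t - x)\<^sup>2 + 2 x\<^sup>2\<close>, and lets the
  integrability of \<open>1 / (1 + t\<^sup>2)\<close> dominate Poisson kernels uniformly for bounded
  \<open>x\<close>.\<close>

lemma inverse_square_shift_bound:
  fixes t x y R :: real
  assumes "y > 0" "\<bar>x\<bar> \<le> R"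
  shows "1 / ((t - x)\<^sup>2 + y\<^sup>2) \<le> ((1 + 2 * R\<^sup>2) / y\<^sup>2 + 2) * (1 / (1 + t\<^sup>2))"
proof -
  have p: "(t - x)\<^sup>2 + y\<^sup>2 > 0" "1 + t\<^sup>2 > 0" using assms by (auto simp: sum_power2_gt_zero_iff intro!: add_pos_nonneg)
  have "x\<^sup>2 \<le> R\<^sup>2" using assms by (metis abs_ge_zero power2_abs power_mono)
  moreover have "t\<^sup>2 \<le> 2 * (t - x)\<^sup>2 + 2 * x\<^sup>2"
    using zero_le_power2[of "t - 2 * x"] by (simp add: power2_eq_square algebra_simps)
  ultimately have "1 + t\<^sup>2 \<le> (1 + 2 * R\<^sup>2) + 2 * (t - x)\<^sup>2" by linarith
  also have "\<dots> \<le> (1 + 2 * R\<^sup>2) * ((t - x)\<^sup>2 / y\<^sup>2 + 1) + 2 * ((t - x)\<^sup>2 + y\<^sup>2)"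
    by (intro add_mono) (auto simp: distrib_left)
  also have "\<dots> = ((1 + 2 * R\<^sup>2) / y\<^sup>2 + 2) * ((t - x)\<^sup>2 + y\<^sup>2)" using assms by (simp add: field_simps)
  finally show ?thesis using p by (simp add: divide_simps)
qed

lemma poisson_integral_Icc:
  fixes y t :: real
  assumes "y > 0" "c \<le> d"
  shows "(LINT x:{c..d}|lborel. y / ((t - x)\<^sup>2 + y\<^sup>2)) = arctan ((d - t) / y) - arctan ((c - t) / y)"
    and "set_integrable lborel {c..d} (\<lambda>x. y / ((t - x)\<^sup>2 + y\<^sup>2))"
proof -
  have p: "(t - x)\<^sup>2 + y\<^sup>2 > 0" for x using assms by (auto simp: sum_power2_gt_zero_iff)
  have c: "continuous_on {c..d} (\<lambda>x. y / ((t - x)\<^sup>2 + y\<^sup>2))"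
    using assms(1) by (intro continuous_intros) (auto simp: sum_power2_eq_zero_iff)
  then show i: "set_integrable lborel {c..d} (\<lambda>x. y / ((t - x)\<^sup>2 + y\<^sup>2))"
    by (rule borel_integrable_atLeastAtMost')
  have "((\<lambda>x. y / ((t - x)\<^sup>2 + y\<^sup>2)) has_integral arctan ((d - t) / y) - arctan ((c - t) / y)) {c..d}"
  proof (rule fundamental_theorem_of_calculus[OF assms(2)])
    fix x
    have "((\<lambda>x. arctan ((x - t) / y)) has_real_derivative y / ((t - x)\<^sup>2 + y\<^sup>2)) (at x within {c..d})"
      using assms(1) p[of x]
      by (auto intro!: derivative_eq_intros simp: divide_simps power2_commute) (simp_all add: power2_eq_square algebra_simps)
    then show "((\<lambda>x. arctan ((x - t) / y)) has_vector_derivative y / ((t - x)\<^sup>2 + y\<^sup>2)) (at x within {c..d})"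
      by (simp add: has_real_derivative_iff_has_vector_derivative)
  qed
  then show "(LINT x:{c..d}|lborel. y / ((t - x)\<^sup>2 + y\<^sup>2)) = arctan ((d - t) / y) - arctan ((c - t) / y)"
    using set_borel_integral_eq_integral(2)[OF i] by (simp add: integral_unique)
qed

text \<open>A majorant independent of \<open>y\<close>, for dominated convergence as
  \<open>y\<close> tends to 0. If \<open>\<bar>t\<bar> \<le> R + 1\<close>, the difference is at
  most \<open>pi\<close>. Otherwise \<open>\<bar>t - x\<bar> \<ge> 1\<close> on the interval, and
  the difference is the integral of a Poisson kernel that the shift bound at height 1 compares with
  \<open>1 / (1 + t\<^sup>2)\<close>; there \<open>3 + 2 R\<^sup>2\<close> arises.\<close>

lemma arctan_diff_bound:
  fixes y t c d y0 R :: real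
  assumes y: "0 < y" "y \<le> y0" and cd: "c \<le> d" "\<bar>c\<bar> \<le> R" "\<bar>d\<bar> \<le> R"
  shows "\<bar>arctan ((d - t) / y) - arctan ((c - t) / y)\<bar> \<le> (pi * (1 + (R + 1)\<^sup>2) + (d - c) * (2 * y0 * (3 + 2 * R\<^sup>2))) * (1 / (1 + t\<^sup>2))"
proof -
  have p: "1 + t\<^sup>2 > 0" by (auto intro!: add_pos_nonneg)
  have R0: "R \<ge> 0" using cd by linarith
  have nn: "pi * (1 + (R + 1)\<^sup>2) \<ge> 0" "(d - c) * (2 * y0 * (3 + 2 * R\<^sup>2)) \<ge> 0" using y cd by auto
  show ?thesis
  proof (cases "\<bar>t\<bar> \<le> R + 1")
    case True
    have "\<bar>arctan ((d - t) / y) - arctan ((c - t) / y)\<bar> \<le> pi"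
      using arctan_bounded[of "(d - t) / y"] arctan_bounded[of "(c - t) / y"] by linarith
    also have "t\<^sup>2 \<le> (R + 1)\<^sup>2" using True by (metis abs_ge_zero power2_abs power_mono)
    then have "pi \<le> pi * (1 + (R + 1)\<^sup>2) * (1 / (1 + t\<^sup>2))" using p by (simp add: field_simps)
    also have "\<dots> \<le> (pi * (1 + (R + 1)\<^sup>2) + (d - c) * (2 * y0 * (3 + 2 * R\<^sup>2))) * (1 / (1 + t\<^sup>2))"
      using nn p by (intro mult_right_mono) auto
    finally show ?thesis .
  next
    case False
    have pt: "y / ((t - x)\<^sup>2 + y\<^sup>2) \<le> 2 * y0 * (3 + 2 * R\<^sup>2) * (1 / (1 + t\<^sup>2))" if "x \<in> {c..d}" for x
    proof -
      have x: "\<bar>x\<bar> \<le> R" using that cd by auto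
      have "1 \<le> \<bar>t - x\<bar>" using False x by linarith
      then have "1 \<le> (t - x)\<^sup>2" by (metis one_le_power power2_abs)
      then have "(t - x)\<^sup>2 + 1\<^sup>2 \<le> 2 * ((t - x)\<^sup>2 + y\<^sup>2)"
        using zero_le_power2[of y] unfolding power_one distrib_left by linarith
      moreover have p1: "(t - x)\<^sup>2 + 1\<^sup>2 > 0" by (auto intro!: add_nonneg_pos)
      moreover have p2: "(t - x)\<^sup>2 + y\<^sup>2 > 0" using y by (simp add: sum_power2_gt_zero_iff)
      ultimately have "1 / ((t - x)\<^sup>2 + y\<^sup>2) \<le> 2 * (1 / ((t - x)\<^sup>2 + 1\<^sup>2))"
        by (simp add: field_simps)
      then have "y * (1 / ((t - x)\<^sup>2 + y\<^sup>2)) \<le> y0 * (2 * (1 / ((t - x)\<^sup>2 + 1\<^sup>2)))"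
        using y p2 by (intro mult_mono) auto
      then have "y / ((t - x)\<^sup>2 + y\<^sup>2) \<le> y0 * (2 * (1 / ((t - x)\<^sup>2 + 1\<^sup>2)))" by simp
      also have "\<dots> \<le> y0 * (2 * (((1 + 2 * R\<^sup>2) / 1\<^sup>2 + 2) * (1 / (1 + t\<^sup>2))))"
        using y x by (intro mult_left_mono inverse_square_shift_bound) auto
      also have "\<dots> = 2 * y0 * (3 + 2 * R\<^sup>2) * (1 / (1 + t\<^sup>2))" by simp
      finally show ?thesis .
    qed
    have "norm (LINT x:{c..d}|lborel. y / ((t - x)\<^sup>2 + y\<^sup>2)) \<le> 2 * y0 * (3 + 2 * R\<^sup>2) * (1 / (1 + t\<^sup>2)) * (d - c)"
    proof -
      have "norm (integral {c..d} (\<lambda>x. y / ((t - x)\<^sup>2 + y\<^sup>2))) \<le> 2 * y0 * (3 + 2 * R\<^sup>2) * (1 / (1 + t\<^sup>2)) * (d - c)"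
      proof (rule integral_bound[OF cd(1)])
        show "continuous_on {c..d} (\<lambda>x. y / ((t - x)\<^sup>2 + y\<^sup>2))"
          using y by (intro continuous_intros) (auto simp: sum_power2_eq_zero_iff)
        show "norm (y / ((t - x)\<^sup>2 + y\<^sup>2)) \<le> 2 * y0 * (3 + 2 * R\<^sup>2) * (1 / (1 + t\<^sup>2))" if "x \<in> {c..d}" for x
          using pt[OF that] y by simp
      qed
      then show ?thesis using set_borel_integral_eq_integral(2)[OF poisson_integral_Icc(2)[OF y(1) cd(1)]] by simp
    qed
    then have "\<bar>arctan ((d - t) / y) - arctan ((c - t) / y)\<bar> \<le> (d - c) * (2 * y0 * (3 + 2 * R\<^sup>2)) * (1 / (1 + t\<^sup>2))"
      unfolding poisson_integral_Icc(1)[OF y(1) cd(1)] by (simp only: real_norm_def ac_simps)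
    also have "\<dots> \<le> (pi * (1 + (R + 1)\<^sup>2) + (d - c) * (2 * y0 * (3 + 2 * R\<^sup>2))) * (1 / (1 + t\<^sup>2))"
      using nn p by (intro mult_right_mono) auto
    finally show ?thesis .
  qed
qed

text \<open>Integrate \<open>H\<close> over an interval and exchange the integrals: the Poisson
  kernel becomes an arctangent difference, which tends to \<open>pi\<close> times the indicator of
  the interval off its end points. Continuity of \<open>H\<close> up to \<open>y = 0\<close> gives
  the limit of the other side and also excludes mass of \<open>f\<close> at the end points.\<close>

lemma stieltjes_inversion:
  fixes \<nu> :: "real measure" and f :: "real \<Rightarrow> 'a::{banach,second_countable_topology}" and H :: "real \<Rightarrow> real \<Rightarrow> 'a"
  assumes \<nu>: "sets \<nu> = sets borel" "integrable \<nu> (\<lambda>t. 1 / (1 + t\<^sup>2))"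
    and fm: "f \<in> borel_measurable borel" and fB: "AE t in \<nu>. norm (f t) \<le> B"
    and ab: "a \<le> b" and y0: "y0 > 0"
    and Hc: "continuous_on ({a..b} \<times> {0..y0}) (\<lambda>p. H (fst p) (snd p))"
    and H: "\<And>x y. x \<in> {a..b} \<Longrightarrow> 0 < y \<Longrightarrow> y \<le> y0 \<Longrightarrow> H x y = (LINT t|\<nu>. (y / ((t - x)\<^sup>2 + y\<^sup>2)) *\<^sub>R f t)"
    and A: "A \<in> sets borel" "A \<subseteq> {a..b}"
  shows "(LINT t:A|\<nu>. f t) = (LINT t:A|lborel. (1 / pi) *\<^sub>R H t 0)"
proof -
  define R where "R = max \<bar>a\<bar> \<bar>b\<bar>"
  have R: "\<bar>x\<bar> \<le> R" if "x \<in> {a..b}" for x using that by (auto simp: R_def)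
  define B' where "B' = max B 0"
  have fB': "AE t in \<nu>. norm (f t) \<le> B'" using fB by (auto simp: B'_def elim: eventually_mono)
  have B'0: "B' \<ge> 0" by (simp add: B'_def)
  note m\<nu> = measurable_cong_sets[OF \<nu>(1) refl]
  have [measurable]: "f \<in> borel_measurable \<nu>" by (simp add: m\<nu> fm)
  have sp: "space \<nu> = UNIV" using sets_eq_imp_space_eq[OF \<nu>(1)] by simp
  have dom: "integrable \<nu> (\<lambda>t. C * (1 / (1 + t\<^sup>2)))" for C using \<nu>(2) by (rule integrable_mult_right)
  have intI: "integrable \<nu> (\<lambda>t. g t *\<^sub>R f t)" if gm: "g \<in> borel_measurable borel" and g: "\<And>t. \<bar>g t\<bar> \<le> C * (1 / (1 + t\<^sup>2))" for g :: "real \<Rightarrow> real" and C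
  proof (rule Bochner_Integration.integrable_bound[OF dom[of "C * B'"]])
    have [measurable]: "g \<in> borel_measurable \<nu>" by (simp add: m\<nu> gm)
    show "(\<lambda>t. g t *\<^sub>R f t) \<in> borel_measurable \<nu>" by measurable
    show "AE t in \<nu>. norm (g t *\<^sub>R f t) \<le> norm (C * B' * (1 / (1 + t\<^sup>2)))"
      using fB'
    proof eventually_elim
      case (elim t)
      have "norm (g t *\<^sub>R f t) \<le> C * (1 / (1 + t\<^sup>2)) * B'"
        unfolding norm_scaleR using g[of t] elim order_trans[OF abs_ge_zero g[of t]] by (intro mult_mono) auto
      also have "\<dots> = C * B' * (1 / (1 + t\<^sup>2))" by (simp only: ac_simps)
      also have "\<dots> \<le> norm (C * B' * (1 / (1 + t\<^sup>2)))" unfolding real_norm_def by (rule abs_ge_self)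
      finally show ?case .
    qed
  qed
  have ind: "indicator {-r..r} t \<le> (1 + r\<^sup>2) * (1 / (1 + t\<^sup>2))" for r t :: real
  proof (cases "\<bar>t\<bar> \<le> r")
    case True
    then have "t\<^sup>2 \<le> r\<^sup>2" by (metis abs_ge_zero power2_abs power_mono)
    then show ?thesis by (auto simp: field_simps indicator_def add_pos_nonneg)
  next
    case False
    then have "indicator {-r..r} t = (0::real)" by (auto simp: indicator_def)
    then show ?thesis by (simp add: add_nonneg_nonneg)
  qed
  have indi: "integrable \<nu> (indicator {-r..r} :: real \<Rightarrow> real)" for r
    by (rule Bochner_Integration.integrable_bound[OF dom[of "1 + r\<^sup>2"]])
       (use ind[of r] \<nu>(1) in \<open>auto simp: m\<nu> add_nonneg_nonneg intro!: AE_I2\<close>)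
  have fin: "emeasure \<nu> {-r..r} < \<infinity>" for r
    using indi[of r] \<nu>(1) by (simp add: integrable_indicator_iff sp)
  \<comment> \<open>Fubini asks for a sigma-finite \<open>\<nu>\<close>, which follows from the
    integrability of \<open>1 / (1 + t\<^sup>2)\<close>.\<close>
  interpret sigma_finite_measure \<nu>
  proof
    have "(\<Union>n. {- real n..real n}) = UNIV"
    proof (intro equalityI subsetI UNIV_I UN_I)
      fix x :: real show "x \<in> {- real (nat \<lceil>\<bar>x\<bar>\<rceil>)..real (nat \<lceil>\<bar>x\<bar>\<rceil>)}" by (auto simp: abs_le_iff) linarith+
    qed
    then show "\<exists>A. countable A \<and> A \<subseteq> sets \<nu> \<and> \<Union> A = space \<nu> \<and> (\<forall>a\<in>A. emeasure \<nu> a \<noteq> \<infinity>)"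
      using fin \<nu>(1) sp by (intro exI[of _ "range (\<lambda>n. {- real n..real n})"]) (auto simp: less_top[symmetric])
  qed
  interpret P: pair_sigma_finite \<nu> lborel ..
  define yn where "yn n = y0 / real (Suc n)" for n
  have yn: "0 < yn n" "yn n \<le> y0" for n using y0 by (auto simp: yn_def field_simps)
  have ynl: "yn \<longlonglongrightarrow> 0"
    unfolding yn_def using LIMSEQ_Suc[OF lim_const_over_n[of y0]] by simp
  have Hl: "(\<lambda>n. H x (yn n)) \<longlonglongrightarrow> H x 0" if x: "x \<in> {a..b}" for x
  proof -
    have m: "(x, 0) \<in> {a..b} \<times> {0..y0}" using x y0 by auto
    have ev: "\<forall>\<^sub>F n in sequentially. (x, yn n) \<in> {a..b} \<times> {0..y0}"
      using x yn by (intro always_eventually) (auto intro: less_imp_le)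
    have lim: "(\<lambda>n. (x, yn n)) \<longlonglongrightarrow> (x, 0)" by (intro tendsto_Pair tendsto_const ynl)
    from continuous_on_tendsto_compose[OF Hc lim m ev] show ?thesis by simp
  qed
  \<comment> \<open>\<open>y H x y\<close> tends to 0 because \<open>H x\<close> has a finite limit;
    as a \<open>\<nu>\<close>-integral it tends to the mass of \<open>x\<close> times
    \<open>f x\<close>.\<close>
  have atom: "AE t in \<nu>. t = x \<longrightarrow> f t = 0" if x: "x \<in> {a..b}" for x
  proof -
    define K where "K = ((1 + 2 * R\<^sup>2) / y0\<^sup>2 + 2) * y0\<^sup>2"
    \<comment> \<open>The quotient increases with \<open>yn n\<close>, so its value at
      \<open>y0\<close> is a majorant.\<close>
    have gb: "(yn n)\<^sup>2 / ((t - x)\<^sup>2 + (yn n)\<^sup>2) \<le> K * (1 / (1 + t\<^sup>2))" for n t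
    proof -
      have p: "(t - x)\<^sup>2 + (yn n)\<^sup>2 > 0" "(t - x)\<^sup>2 + y0\<^sup>2 > 0" using yn[of n] y0 by (auto simp: sum_power2_gt_zero_iff)
      have "(yn n)\<^sup>2 \<le> y0\<^sup>2" using yn[of n] by (intro power_mono) auto
      then have "(t - x)\<^sup>2 * (yn n)\<^sup>2 \<le> (t - x)\<^sup>2 * y0\<^sup>2" by (intro mult_left_mono) auto
      then have "(yn n)\<^sup>2 / ((t - x)\<^sup>2 + (yn n)\<^sup>2) \<le> y0\<^sup>2 * (1 / ((t - x)\<^sup>2 + y0\<^sup>2))"
        using p by (simp add: divide_simps) (simp add: algebra_simps)
      also have "\<dots> \<le> y0\<^sup>2 * (((1 + 2 * R\<^sup>2) / y0\<^sup>2 + 2) * (1 / (1 + t\<^sup>2)))"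
        using y0 R[OF x] by (intro mult_left_mono inverse_square_shift_bound) auto
      finally show ?thesis by (simp add: K_def mult.commute mult.left_commute)
    qed
    have lim: "(\<lambda>n. LINT t|\<nu>. ((yn n)\<^sup>2 / ((t - x)\<^sup>2 + (yn n)\<^sup>2)) *\<^sub>R f t) \<longlonglongrightarrow> (LINT t|\<nu>. indicator {x} t *\<^sub>R f t)"
    proof (rule integral_dominated_convergence[where w = "\<lambda>t. K * B' * (1 / (1 + t\<^sup>2))"])
      show "integrable \<nu> (\<lambda>t. K * B' * (1 / (1 + t\<^sup>2)))" by (rule dom)
      show "(\<lambda>t. indicator {x} t *\<^sub>R f t) \<in> borel_measurable \<nu>" using \<nu>(1) by measurable
      show "(\<lambda>t. ((yn n)\<^sup>2 / ((t - x)\<^sup>2 + (yn n)\<^sup>2)) *\<^sub>R f t) \<in> borel_measurable \<nu>" for n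
        unfolding m\<nu> using fm by measurable
      show "AE t in \<nu>. norm (((yn n)\<^sup>2 / ((t - x)\<^sup>2 + (yn n)\<^sup>2)) *\<^sub>R f t) \<le> K * B' * (1 / (1 + t\<^sup>2))" for n
        using fB'
      proof eventually_elim
        case (elim t)
        have "norm (((yn n)\<^sup>2 / ((t - x)\<^sup>2 + (yn n)\<^sup>2)) *\<^sub>R f t) \<le> (K * (1 / (1 + t\<^sup>2))) * B'"
          unfolding norm_scaleR using gb[of n t] elim order_trans[OF _ gb[of n t], of 0] by (intro mult_mono) auto
        then show ?case by (simp add: mult.commute mult.left_commute)
      qed
      have "(\<lambda>n. (yn n)\<^sup>2 / ((t - x)\<^sup>2 + (yn n)\<^sup>2)) \<longlonglongrightarrow> indicator {x} t" for t
      proof (cases "t = x")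
        case True
        have "yn n \<noteq> 0" for n using yn[of n] by simp
        then show ?thesis using True by simp
      next
        case False
        have "(\<lambda>n. (yn n)\<^sup>2 / ((t - x)\<^sup>2 + (yn n)\<^sup>2)) \<longlonglongrightarrow> 0\<^sup>2 / ((t - x)\<^sup>2 + 0\<^sup>2)"
          using False by (intro tendsto_intros ynl) auto
        then show ?thesis using False by simp
      qed
      then show "AE t in \<nu>. (\<lambda>n. ((yn n)\<^sup>2 / ((t - x)\<^sup>2 + (yn n)\<^sup>2)) *\<^sub>R f t) \<longlonglongrightarrow> indicator {x} t *\<^sub>R f t"
        by (intro AE_I2 tendsto_scaleR tendsto_const) auto
    qed
    have "(LINT t|\<nu>. ((yn n)\<^sup>2 / ((t - x)\<^sup>2 + (yn n)\<^sup>2)) *\<^sub>R f t) = yn n *\<^sub>R H x (yn n)" for n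
      unfolding H[OF x yn] by (subst Bochner_Integration.integral_scaleR_right[symmetric]) (simp add: power2_eq_square)
    then have "(\<lambda>n. yn n *\<^sub>R H x (yn n)) \<longlonglongrightarrow> (LINT t|\<nu>. indicator {x} t *\<^sub>R f t)" using lim by simp
    moreover have "(\<lambda>n. yn n *\<^sub>R H x (yn n)) \<longlonglongrightarrow> 0 *\<^sub>R H x 0"
      by (intro tendsto_intros ynl Hl x)
    ultimately have "(LINT t|\<nu>. indicator {x} t *\<^sub>R f t) = 0" using LIMSEQ_unique by fastforce
    moreover have "(LINT t|\<nu>. indicator {x} t *\<^sub>R f t) = (LINT t|\<nu>. indicator {x} t *\<^sub>R f x)"
      by (rule Bochner_Integration.integral_cong) (auto simp: indicator_def)
    moreover have "\<dots> = measure \<nu> {x} *\<^sub>R f x"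
    proof -
      have "emeasure \<nu> {x} \<le> emeasure \<nu> {-\<bar>x\<bar>..\<bar>x\<bar>}" using \<nu>(1) by (intro emeasure_mono) auto
      then have "emeasure \<nu> {x} < \<infinity>" using fin[of "\<bar>x\<bar>"] by (rule le_less_trans)
      then show ?thesis using \<nu>(1) by (subst integral_scaleR_left) (auto simp: integrable_indicator_iff sp)
    qed
    ultimately consider "measure \<nu> {x} = 0" | "f x = 0" by auto
    then show ?thesis
    proof cases
      case 1
      have "emeasure \<nu> {x} \<le> emeasure \<nu> {-\<bar>x\<bar>..\<bar>x\<bar>}" using \<nu>(1) by (intro emeasure_mono) auto
      then have "emeasure \<nu> {x} < \<infinity>" using fin[of "\<bar>x\<bar>"] by (rule le_less_trans)
      then have "{x} \<in> null_sets \<nu>" using 1 \<nu>(1) by (auto simp: null_sets_def emeasure_eq_ennreal_measure less_top)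
      from AE_not_in[OF this] show ?thesis by (rule eventually_mono) auto
    qed (auto intro: AE_I2)
  qed
  have Icc: "(LINT t:{c..d}|\<nu>. f t) = (LINT t:{c..d}|lborel. (1 / pi) *\<^sub>R H t 0)" if cd: "c \<in> {a..b}" "d \<in> {a..b}" "c \<le> d" for c d
  proof -
    have R1: "\<bar>c\<bar> \<le> R" "\<bar>d\<bar> \<le> R" using R cd by auto
    define ar where "ar n t = arctan ((d - t) / yn n) - arctan ((c - t) / yn n)" for n t
    define K where "K = pi * (1 + (R + 1)\<^sup>2) + (d - c) * (2 * y0 * (3 + 2 * R\<^sup>2))"
    have ab1: "\<bar>ar n t\<bar> \<le> K * (1 / (1 + t\<^sup>2))" for n t
      unfolding ar_def K_def by (rule arctan_diff_bound[OF yn cd(3) R1])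
    have fub: "(LINT x:{c..d}|lborel. H x (yn n)) = (LINT t|\<nu>. ar n t *\<^sub>R f t)" for n
    proof -
      let ?y = "yn n"
      define L where "L = ((1 + 2 * R\<^sup>2) / ?y\<^sup>2 + 2) * ?y"
      define F where "F t x = indicator {c..d} x *\<^sub>R ((?y / ((t - x)\<^sup>2 + ?y\<^sup>2)) *\<^sub>R f t)" for t x
      have F0: "F t x = (indicator {c..d} x * (?y / ((t - x)\<^sup>2 + ?y\<^sup>2))) *\<^sub>R f t" for t x by (simp add: F_def)
      have kb: "norm (indicator {c..d} x * (?y / ((t - x)\<^sup>2 + ?y\<^sup>2))) \<le> indicator {c..d} x * (L * (1 / (1 + t\<^sup>2)))" for t x
      proof (cases "x \<in> {c..d}")
        case True
        then have "\<bar>x\<bar> \<le> R" using cd R by auto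
        then have "?y * (1 / ((t - x)\<^sup>2 + ?y\<^sup>2)) \<le> ?y * (((1 + 2 * R\<^sup>2) / ?y\<^sup>2 + 2) * (1 / (1 + t\<^sup>2)))"
          using yn[of n] by (intro mult_left_mono inverse_square_shift_bound) auto
        then show ?thesis using True yn[of n] by (simp add: L_def mult.commute mult.left_commute)
      qed simp
      have L0: "L \<ge> 0" using yn[of n] by (simp add: L_def)
      have mF: "case_prod F \<in> borel_measurable (\<nu> \<Otimes>\<^sub>M lborel)"
      proof -
        have "(\<lambda>p. F (fst p) (snd p)) \<in> borel_measurable (borel \<Otimes>\<^sub>M borel)"
          unfolding F_def using fm by measurable
        moreover have sets_eq: "sets (\<nu> \<Otimes>\<^sub>M lborel) = sets (borel \<Otimes>\<^sub>M (borel :: real measure))"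
          by (rule sets_pair_measure_cong) (auto simp: \<nu>(1))
        ultimately show ?thesis unfolding split_beta' measurable_cong_sets[OF sets_eq refl] by simp
      qed
      have iF: "integrable lborel (\<lambda>x. F t x)" for t
        using set_integrable_scaleR_left[OF poisson_integral_Icc(2)[OF yn(1) cd(3), of n t], of "f t"]
        unfolding F_def set_integrable_def by simp
      have FI: "integrable (\<nu> \<Otimes>\<^sub>M lborel) (case_prod F)"
      proof (rule P.Fubini_integrable[OF mF])
        show "AE t in \<nu>. integrable lborel (\<lambda>x. case (t, x) of (t, x) \<Rightarrow> F t x)" using iF by simp
        show "integrable \<nu> (\<lambda>t. LINT x|lborel. norm (case (t, x) of (t, x) \<Rightarrow> F t x))"
        proof (rule Bochner_Integration.integrable_bound[OF dom[of "(d - c) * L * B'"]])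
          show "(\<lambda>t. LINT x|lborel. norm (case (t, x) of (t, x) \<Rightarrow> F t x)) \<in> borel_measurable \<nu>"
            using mF by measurable
          show "AE t in \<nu>. norm (LINT x|lborel. norm (case (t, x) of (t, x) \<Rightarrow> F t x)) \<le> norm ((d - c) * L * B' * (1 / (1 + t\<^sup>2)))"
            using fB'
          proof eventually_elim
            case (elim t)
            have "(LINT x|lborel. norm (F t x)) \<le> (LINT x|lborel. indicator {c..d} x * (L * (1 / (1 + t\<^sup>2)) * B'))"
            proof (rule integral_mono)
              show "integrable lborel (\<lambda>x. norm (F t x))" using iF by simp
              show "integrable lborel (\<lambda>x. indicator {c..d} x * (L * (1 / (1 + t\<^sup>2)) * B'))"
                by (intro integrable_mult_left integrable_real_indicator) (auto simp: emeasure_lborel_Icc_eq)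
              show "norm (F t x) \<le> indicator {c..d} x * (L * (1 / (1 + t\<^sup>2)) * B')" for x
              proof -
                have "norm (F t x) \<le> (indicator {c..d} x * (L * (1 / (1 + t\<^sup>2)))) * B'"
                  unfolding F0 norm_scaleR using kb[of x t] elim L0 by (intro mult_mono) (auto simp: add_nonneg_nonneg)
                then show ?thesis by (simp add: mult.assoc)
              qed
            qed
            also have "\<dots> = (d - c) * L * B' * (1 / (1 + t\<^sup>2))" using cd by simp
            finally have "(LINT x|lborel. norm (F t x)) \<le> (d - c) * L * B' * (1 / (1 + t\<^sup>2))" .
            moreover have "(LINT x|lborel. norm (F t x)) \<ge> 0" by (intro integral_nonneg_AE) auto
            moreover have "norm r \<le> norm s" if "r \<le> s" "0 \<le> r" for r s :: real using that by simp
            ultimately show ?case unfolding prod.case by blast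
          qed
        qed
      qed
      have "(LINT x|lborel. LINT t|\<nu>. F t x) = (LINT t|\<nu>. LINT x|lborel. F t x)"
        by (rule P.Fubini_integral[OF FI])
      moreover have "(LINT x|lborel. F t x) = ar n t *\<^sub>R f t" for t
      proof -
        have "(LINT x|lborel. F t x) = (LINT x|lborel. indicator {c..d} x * (?y / ((t - x)\<^sup>2 + ?y\<^sup>2))) *\<^sub>R f t"
          unfolding F0 using poisson_integral_Icc(2)[OF yn(1) cd(3), of n t]
          by (intro integral_scaleR_left) (simp add: set_integrable_def)
        then show ?thesis using poisson_integral_Icc(1)[OF yn(1) cd(3), of n t]
          by (simp add: ar_def set_lebesgue_integral_def)
      qed
      moreover have "(LINT t|\<nu>. F t x) = indicator {c..d} x *\<^sub>R H x ?y" for x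
        using H[of x ?y] yn[of n] cd by (cases "x \<in> {c..d}") (auto simp: F_def)
      ultimately show ?thesis by (simp add: set_lebesgue_integral_def)
    qed
    have r: "(\<lambda>n. LINT t|\<nu>. ar n t *\<^sub>R f t) \<longlonglongrightarrow> (LINT t|\<nu>. pi *\<^sub>R (indicator {c..d} t *\<^sub>R f t))"
    proof (rule integral_dominated_convergence[where w = "\<lambda>t. K * B' * (1 / (1 + t\<^sup>2))"])
      show "integrable \<nu> (\<lambda>t. K * B' * (1 / (1 + t\<^sup>2)))" by (rule dom)
      show "(\<lambda>t. pi *\<^sub>R (indicator {c..d} t *\<^sub>R f t)) \<in> borel_measurable \<nu>" using \<nu>(1) by measurable
      show "(\<lambda>t. ar n t *\<^sub>R f t) \<in> borel_measurable \<nu>" for n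
        unfolding m\<nu> ar_def using fm by measurable
      show "AE t in \<nu>. norm (ar n t *\<^sub>R f t) \<le> K * B' * (1 / (1 + t\<^sup>2))" for n
        using fB'
      proof eventually_elim
        case (elim t)
        have "norm (ar n t *\<^sub>R f t) \<le> (K * (1 / (1 + t\<^sup>2))) * B'"
          unfolding norm_scaleR using ab1[of n t] elim order_trans[OF abs_ge_zero ab1[of n t]] by (intro mult_mono) auto
        then show ?case by (simp add: mult.commute mult.left_commute)
      qed
      have at: "(\<lambda>n. arctan (s / yn n)) \<longlonglongrightarrow> sgn s * (pi / 2)" for s
      proof -
        have inf: "filterlim (\<lambda>n. 1 / yn n) at_top sequentially"
        proof -
          have "filterlim (\<lambda>n. (1 / y0) * real (Suc n)) at_top sequentially"
            using y0 by (intro filterlim_tendsto_pos_mult_at_top[OF tendsto_const]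
                filterlim_compose[OF filterlim_real_sequentially filterlim_Suc]) auto
          then show ?thesis by (simp add: yn_def)
        qed
        consider "s = 0" | "s > 0" | "s < 0" by linarith
        then show ?thesis
        proof cases
          case 2
          have "filterlim (\<lambda>n. s * (1 / yn n)) at_top sequentially"
            by (rule filterlim_tendsto_pos_mult_at_top[OF tendsto_const 2 inf])
          from filterlim_compose[OF tendsto_arctan_at_top this] show ?thesis using 2 by simp
        next
          case 3
          have "filterlim (\<lambda>n. s * (1 / yn n)) at_bot sequentially"
            by (rule filterlim_tendsto_neg_mult_at_bot[OF tendsto_const 3 inf])
          from filterlim_compose[OF tendsto_arctan_at_bot this] show ?thesis using 3 by simp
        qed simp
      qed
      \<comment> \<open>At \<open>c\<close> and \<open>d\<close> the limit is a different one; there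
        \<open>atom\<close> makes the product with \<open>f\<close> vanish almost
        everywhere.\<close>
      have arl: "(\<lambda>n. ar n t) \<longlonglongrightarrow> pi * indicator {c..d} t" if "t \<noteq> c" "t \<noteq> d" for t
      proof -
        have "(\<lambda>n. ar n t) \<longlonglongrightarrow> sgn (d - t) * (pi / 2) - sgn (c - t) * (pi / 2)"
          unfolding ar_def by (intro tendsto_diff at)
        moreover have "sgn (d - t) * (pi / 2) - sgn (c - t) * (pi / 2) = pi * indicator {c..d} t"
          using that cd by (auto simp: sgn_if indicator_def)
        ultimately show ?thesis by simp
      qed
      show "AE t in \<nu>. (\<lambda>n. ar n t *\<^sub>R f t) \<longlonglongrightarrow> pi *\<^sub>R (indicator {c..d} t *\<^sub>R f t)"
        using atom[OF cd(1)] atom[OF cd(2)]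
      proof eventually_elim
        case (elim t)
        show ?case
        proof (cases "t = c \<or> t = d")
          case True then show ?thesis using elim by auto
        next
          case False
          then have "(\<lambda>n. ar n t *\<^sub>R f t) \<longlonglongrightarrow> (pi * indicator {c..d} t) *\<^sub>R f t"
            by (intro tendsto_scaleR arl tendsto_const) auto
          then show ?thesis by simp
        qed
      qed
    qed
    have l: "(\<lambda>n. LINT x:{c..d}|lborel. H x (yn n)) \<longlonglongrightarrow> (LINT x:{c..d}|lborel. H x 0)"
    proof -
      have "compact ({a..b} \<times> {0..y0})" by (intro compact_Times) auto
      then have "bounded ((\<lambda>p. H (fst p) (snd p)) ` ({a..b} \<times> {0..y0}))"
        using Hc by (intro compact_imp_bounded compact_continuous_image)
      then obtain C where "\<forall>z\<in>(\<lambda>p. H (fst p) (snd p)) ` ({a..b} \<times> {0..y0}). norm z \<le> C"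
        unfolding bounded_iff by blast
      then have C: "norm (H x y) \<le> C" if "x \<in> {a..b}" "y \<in> {0..y0}" for x y
        using that by force
      have mH: "(\<lambda>x. indicator {c..d} x *\<^sub>R H x y) \<in> borel_measurable lborel" if y: "y \<in> {0..y0}" for y
      proof -
        have "continuous_on {c..d} (\<lambda>x. H (fst (x, y)) (snd (x, y)))"
          by (rule continuous_on_compose2[OF Hc]) (use cd y in \<open>auto intro!: continuous_intros\<close>)
        then have "(\<lambda>x. indicator {c..d} x *\<^sub>R H x y) \<in> borel_measurable borel"
          by (intro borel_measurable_continuous_on_indicator) auto
        then show ?thesis by simp
      qed
      show ?thesis unfolding set_lebesgue_integral_def
      proof (rule integral_dominated_convergence[where w = "\<lambda>x. indicator {c..d} x * C"])
        show "(\<lambda>x. indicator {c..d} x *\<^sub>R H x 0) \<in> borel_measurable lborel" using mH[of 0] y0 by simp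
        show "(\<lambda>x. indicator {c..d} x *\<^sub>R H x (yn n)) \<in> borel_measurable lborel" for n
          using mH[of "yn n"] yn[of n] by simp
        show "integrable lborel (\<lambda>x. indicator {c..d} x * C)" by (intro integrable_mult_left integrable_real_indicator) (auto simp: emeasure_lborel_Icc_eq)
        show "AE x in lborel. (\<lambda>n. indicator {c..d} x *\<^sub>R H x (yn n)) \<longlonglongrightarrow> indicator {c..d} x *\<^sub>R H x 0"
        proof (rule AE_I2)
          fix x show "(\<lambda>n. indicator {c..d} x *\<^sub>R H x (yn n)) \<longlonglongrightarrow> indicator {c..d} x *\<^sub>R H x 0"
            using Hl[of x] cd by (cases "x \<in> {c..d}") (auto intro!: tendsto_scaleR)
        qed
        show "AE x in lborel. norm (indicator {c..d} x *\<^sub>R H x (yn n)) \<le> indicator {c..d} x * C" for n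
          using C[of _ "yn n"] yn[of n] cd by (intro AE_I2) (auto simp: indicator_def)
      qed
    qed
    have "(LINT x:{c..d}|lborel. H x 0) = (LINT t|\<nu>. pi *\<^sub>R (indicator {c..d} t *\<^sub>R f t))"
      using LIMSEQ_unique[OF l] r unfolding fub by blast
    also have "\<dots> = pi *\<^sub>R (LINT t:{c..d}|\<nu>. f t)"
      unfolding set_lebesgue_integral_def by (rule integral_scaleR_right)
    finally have "(1 / pi) *\<^sub>R (LINT x:{c..d}|lborel. H x 0) = (LINT t:{c..d}|\<nu>. f t)" by simp
    then show ?thesis by (simp only: set_integral_scaleR_right)
  qed
  have "continuous_on {a..b} (\<lambda>x. H (fst (x, 0::real)) (snd (x, 0::real)))"
    by (rule continuous_on_compose2[OF Hc]) (use y0 in \<open>auto intro!: continuous_intros\<close>)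
  then have ci: "continuous_on {a..b} (\<lambda>x. (1 / pi) *\<^sub>R H x 0)" by (auto intro!: continuous_on_scaleR)
  \<comment> \<open>A half-line meets \<open>{a..b}\<close> in the empty set or in an interval
    covered by \<open>Icc\<close>, so equality on intervals passes to all Borel sets.\<close>
  have "(LINT t:{a..b} \<inter> A|\<nu>. f t) = (LINT t:{a..b} \<inter> A|lborel. (1 / pi) *\<^sub>R H t 0)"
  proof (rule set_integral_eq_on_borel[OF \<nu>(1) _ _ _ _ _ _ A(1)])
    show "set_integrable \<nu> {a..b} f"
      unfolding set_integrable_def
    proof (rule intI[where C = "1 + R\<^sup>2"])
      fix t :: real
      have "indicator {a..b} t \<le> (indicator {-R..R} t :: real)" using R[of t] by (auto simp: indicator_def)
      then show "\<bar>indicator {a..b} t\<bar> \<le> (1 + R\<^sup>2) * (1 / (1 + t\<^sup>2))" using ind[of R t] by simp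
    qed auto
    show "set_integrable lborel {a..b} (\<lambda>t. (1 / pi) *\<^sub>R H t 0)"
      by (rule borel_integrable_atLeastAtMost'[OF ci])
    show "(LINT t:{a..b}|\<nu>. f t) = (LINT t:{a..b}|lborel. (1 / pi) *\<^sub>R H t 0)" using Icc[of a b] ab by simp
    fix d
    consider "d < a" | "a \<le> d" "d \<le> b" | "b < d" by linarith
    then show "(LINT t:{a..b} \<inter> {..d}|\<nu>. f t) = (LINT t:{a..b} \<inter> {..d}|lborel. (1 / pi) *\<^sub>R H t 0)"
    proof cases
      case 1
      then have "{a..b} \<inter> {..d} = {}" by auto
      then show ?thesis by (simp add: set_lebesgue_integral_def)
    next
      case 2
      then have "{a..b} \<inter> {..d} = {a..d}" by auto
      then show ?thesis using Icc[of a d] 2 ab by simp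
    next
      case 3
      then have "{a..b} \<inter> {..d} = {a..b}" by auto
      then show ?thesis using Icc[of a b] ab by simp
    qed
  qed auto
  moreover have "{a..b} \<inter> A = A" using A by auto
  ultimately show ?thesis by simp
qed

section \<open>The spectral density\<close>

text \<open>The imaginary part in the sense of hermitian matrices,
  \<open>(A - adjmat A) / (2 \<i>)\<close>, not the entrywise one.\<close>

definition im_mat :: "cmat \<Rightarrow> cmat" where
  "im_mat A = (\<chi> i j. (A $ i $ j - cnj (A $ j $ i)) / (2 * \<i>))"

lemma bounded_linear_im_mat: "bounded_linear im_mat"
proof (rule linear_conv_bounded_linear[THEN iffD1], rule linearI)
  show "im_mat (A + B) = im_mat A + im_mat B" for A B
    by (simp add: im_mat_def vec_eq_iff add_divide_distrib[symmetric] algebra_simps)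
  show "im_mat (r *\<^sub>R A) = r *\<^sub>R im_mat A" for r A
    by (simp add: im_mat_def vec_eq_iff complex_eq_iff Re_divide Im_divide algebra_simps)
qed

text \<open>This removes the additive constant of the Herglotz-Nevanlinna formula.\<close>

lemma im_mat_Re_mat: "im_mat (Re_mat A) = 0"
  by (simp add: im_mat_def Re_mat_def adjmat_def vec_eq_iff add.commute)

lemma pair_mat_nth [simp]:
  "pair_mat p $ 1 $ 1 = 1" "pair_mat p $ 1 $ 2 = p" "pair_mat p $ 2 $ 1 = cnj p" "pair_mat p $ 2 $ 2 = 1"
  by (simp_all add: pair_mat_def)

lemma mat_pair_mat_nth:
  "(mat a ** pair_mat p) $ i $ j = a * pair_mat p $ i $ j"
  using exhaust_2[of i] by (auto simp: matrix_matrix_mult_def mat_def sum_2)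

text \<open>\<open>pair_mat p\<close> is hermitian, so only the imaginary part of the scalar factor
  survives.\<close>

lemma im_mat_mat_pair_mat: "im_mat (mat a ** pair_mat p) = Im a *\<^sub>R pair_mat p"
  by (auto simp: im_mat_def vec_eq_iff forall_2 mat_pair_mat_nth complex_eq_iff Re_divide Im_divide)

lemma continuous_on_cmat:
  fixes f :: "'a::topological_space \<Rightarrow> cmat"
  assumes "\<And>i j. continuous_on S (\<lambda>x. f x $ i $ j)" shows "continuous_on S f"
proof -
  have "continuous_on S (\<lambda>x. \<chi> i. \<chi> j. f x $ i $ j)" using assms by (intro continuous_on_vec_lambda)
  then show ?thesis by simp
qed

lemma continuous_on_pair_mat: "continuous_on S pair_mat"
proof (rule continuous_on_cmat)
  fix i j :: 2
  show "continuous_on S (\<lambda>p. pair_mat p $ i $ j)"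
    using exhaust_2[of i] exhaust_2[of j]
    by (elim disjE) (simp_all add: continuous_on_cnj[OF continuous_on_id] continuous_on_id)
qed

lemma norm_pair_mat_le:
  assumes "norm p \<le> 1" shows "norm (mat a ** pair_mat p) \<le> 4 * norm a"
proof -
  have "norm (pair_mat p $ i $ j) \<le> 1" for i j
    using exhaust_2[of i] exhaust_2[of j] assms by auto
  then have "norm (mat a ** pair_mat p) \<le> (\<Sum>z\<in>(UNIV :: (2 \<times> 2) set). norm a)"
    by (intro order_trans[OF norm_cmat_le] sum_mono) (simp add: mat_pair_mat_nth norm_mult mult_left_le)
  also have "\<dots> = 4 * norm a" by simp
  finally show ?thesis .
qed

text \<open>The kernel equals \<open>((1 + \<mu>\<^sup>2) / (t - \<mu>) + \<mu>) / (1 +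
  t\<^sup>2)\<close>, and the distance from \<open>t\<close> to \<open>\<mu>\<close> is at least
  \<open>Im \<mu>\<close>.\<close>

lemma herglotz_kernel_bound:
  assumes "Im \<mu> > 0"
  shows "norm (1 / (complex_of_real t - \<mu>) - complex_of_real (t / (1 + t\<^sup>2))) \<le> (norm (1 + \<mu>\<^sup>2) / Im \<mu> + norm \<mu>) * (1 / (1 + t\<^sup>2))"
proof -
  have nz: "complex_of_real t - \<mu> \<noteq> 0" using assms by (auto simp: complex_eq_iff)
  have p: "1 + t\<^sup>2 > 0" by (auto intro!: add_pos_nonneg)
  then have nz2: "complex_of_real (1 + t\<^sup>2) \<noteq> 0" by (metis of_real_eq_0_iff less_irrefl)
  have im: "Im \<mu> \<le> norm (complex_of_real t - \<mu>)" using abs_Im_le_cmod[of "complex_of_real t - \<mu>"] by simp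
  have "1 / (complex_of_real t - \<mu>) - complex_of_real (t / (1 + t\<^sup>2)) = ((1 + \<mu>\<^sup>2) / (complex_of_real t - \<mu>) + \<mu>) * complex_of_real (1 / (1 + t\<^sup>2))"
    using nz nz2 by (simp add: field_simps power2_eq_square)
  also have "norm \<dots> = norm ((1 + \<mu>\<^sup>2) / (complex_of_real t - \<mu>) + \<mu>) * (1 / (1 + t\<^sup>2))"
    using p by (simp only: norm_mult norm_of_real) simp
  also have "\<dots> \<le> (norm (1 + \<mu>\<^sup>2) / Im \<mu> + norm \<mu>) * (1 / (1 + t\<^sup>2))"
  proof (rule mult_right_mono)
    have "norm ((1 + \<mu>\<^sup>2) / (complex_of_real t - \<mu>)) \<le> norm (1 + \<mu>\<^sup>2) / Im \<mu>"
      unfolding norm_divide using im assms by (intro divide_left_mono mult_pos_pos) auto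
    then show "norm ((1 + \<mu>\<^sup>2) / (complex_of_real t - \<mu>) + \<mu>) \<le> norm (1 + \<mu>\<^sup>2) / Im \<mu> + norm \<mu>"
      by (intro order_trans[OF norm_triangle_ineq]) simp
  qed (use p in auto)
  finally show ?thesis .
qed

lemma Im_herglotz_kernel:
  "Im (1 / (complex_of_real t - Complex x y) - complex_of_real (t / (1 + t\<^sup>2))) = y / ((t - x)\<^sup>2 + y\<^sup>2)"
  by (simp add: Im_divide)

text \<open>The imaginary part of the scalar kernel is the Poisson kernel. Most of the work is
  integrability of the matrix integrand, which allows \<open>im_mat\<close> to be moved under the
  integral.\<close>

lemma im_mat_Weyl_M:
  assumes sp: "spectral_pair q \<nu> \<psi>" and y: "y > 0"
  shows "im_mat (Weyl_M q (Complex x y)) = (LINT t|\<nu>. (y / ((t - x)\<^sup>2 + y\<^sup>2)) *\<^sub>R pair_mat (\<psi> t))"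
proof -
  let ?\<mu> = "Complex x y"
  define g where "g t = 1 / (complex_of_real t - ?\<mu>) - complex_of_real (t / (1 + t\<^sup>2))" for t
  have s: "sets \<nu> = sets borel" "integrable \<nu> (\<lambda>t. 1 / (1 + t\<^sup>2))" "\<psi> \<in> borel_measurable borel" "AE t in \<nu>. cmod (\<psi> t) \<le> 1"
    using sp unfolding spectral_pair_def by blast+
  have M: "Weyl_M q ?\<mu> = Re_mat (Weyl_M q \<i>) + (LINT t|\<nu>. mat (g t) ** pair_mat (\<psi> t))"
    using sp y unfolding spectral_pair_def g_def by (elim conjE allE[of _ ?\<mu>]) simp
  have gm: "g \<in> borel_measurable borel" unfolding g_def[abs_def] by measurable
  have i: "integrable \<nu> (\<lambda>t. mat (g t) ** pair_mat (\<psi> t))"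
  proof (rule Bochner_Integration.integrable_bound)
    show "integrable \<nu> (\<lambda>t. 4 * ((norm (1 + ?\<mu>\<^sup>2) / Im ?\<mu> + norm ?\<mu>) * (1 / (1 + t\<^sup>2))))"
      using s(2) by (intro integrable_mult_right)
    have c: "continuous_on UNIV (\<lambda>z. mat (fst z) ** pair_mat (snd z))"
    proof (rule continuous_on_cmat)
      fix i j :: 2
      have "continuous_on UNIV (\<lambda>z :: complex \<times> complex. pair_mat (snd z) $ i $ j)"
        using exhaust_2[of i] exhaust_2[of j]
        by (elim disjE) (simp_all add: continuous_on_cnj continuous_on_snd continuous_on_id)
      then show "continuous_on UNIV (\<lambda>z. (mat (fst z) ** pair_mat (snd z)) $ i $ j)"
        unfolding mat_pair_mat_nth by (intro continuous_on_mult continuous_on_fst continuous_on_id)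
    qed
    have "(\<lambda>t. (g t, \<psi> t)) \<in> borel_measurable borel" using gm s(3) by measurable
    from borel_measurable_continuous_on[OF c this]
    show "(\<lambda>t. mat (g t) ** pair_mat (\<psi> t)) \<in> borel_measurable \<nu>"
      by (simp add: measurable_cong_sets[OF s(1) refl])
    show "AE t in \<nu>. norm (mat (g t) ** pair_mat (\<psi> t)) \<le> norm (4 * ((norm (1 + ?\<mu>\<^sup>2) / Im ?\<mu> + norm ?\<mu>) * (1 / (1 + t\<^sup>2))))"
      using s(4)
    proof eventually_elim
      case (elim t)
      have "norm (mat (g t) ** pair_mat (\<psi> t)) \<le> 4 * norm (g t)" by (rule norm_pair_mat_le[OF elim])
      also have "\<dots> \<le> 4 * ((norm (1 + ?\<mu>\<^sup>2) / Im ?\<mu> + norm ?\<mu>) * (1 / (1 + t\<^sup>2)))"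
        unfolding g_def using y by (intro mult_left_mono herglotz_kernel_bound) auto
      finally show ?case unfolding real_norm_def by (rule order_trans[OF _ abs_ge_self])
    qed
  qed
  have "im_mat (Weyl_M q ?\<mu>) = im_mat (LINT t|\<nu>. mat (g t) ** pair_mat (\<psi> t))"
    unfolding M linear_add[OF bounded_linear.linear[OF bounded_linear_im_mat]] im_mat_Re_mat by simp
  also have "\<dots> = (LINT t|\<nu>. im_mat (mat (g t) ** pair_mat (\<psi> t)))"
    by (rule integral_bounded_linear[OF bounded_linear_im_mat i, symmetric])
  also have "\<dots> = (LINT t|\<nu>. (y / ((t - x)\<^sup>2 + y\<^sup>2)) *\<^sub>R pair_mat (\<psi> t))"
    unfolding im_mat_mat_pair_mat g_def Im_herglotz_kernel ..
  finally show ?thesis .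
qed

text \<open>For the root \<open>z\<close>,
  \<open>(Re z)\<^sup>2 = x + (Im z)\<^sup>2 \<ge> k\<^sup>2 / 4\<close> and
  \<open>Im z = y / (2 Re z) \<le> k / 4\<close>. The case \<open>y = 0\<close> is included because
  boundary values are taken there.\<close>

lemma csqrt_spectral_strip:
  assumes k: "k > 0" and x: "3 * k\<^sup>2 / 4 \<le> x" and y: "0 \<le> y" "y \<le> k\<^sup>2 / 4"
  shows "csqrt (Complex x y) \<in> spectral_strip k" "y > 0 \<Longrightarrow> Im (csqrt (Complex x y)) > 0"
proof -
  define z where "z = csqrt (Complex x y)"
  have z2: "z\<^sup>2 = Complex x y" by (simp add: z_def)
  have re: "(Re z)\<^sup>2 - (Im z)\<^sup>2 = x" and im: "2 * Re z * Im z = y"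
    using arg_cong[OF z2, of Re] arg_cong[OF z2, of Im] by (simp_all add: power2_eq_square algebra_simps)
  have R0: "Re z \<ge> 0" unfolding z_def using csqrt_principal[of "Complex x y"] by auto
  have "k\<^sup>2 / 4 \<le> (Re z)\<^sup>2" using re x zero_le_power2[of "Im z"] zero_le_power2[of k] by linarith
  then have "(k / 2)\<^sup>2 \<le> (Re z)\<^sup>2" by (simp add: power_divide)
  then have Rk: "k / 2 \<le> Re z" using R0 by (rule power2_le_imp_le)
  then have Rp: "Re z > 0" using k by simp
  have I0: "Im z \<ge> 0" 
  proof (rule ccontr)
    assume "\<not> Im z \<ge> 0"
    then have "(2 * Re z) * Im z < 0" using Rp by (intro mult_pos_neg) auto
    then show False using im y by simp
  qed
  have "k * Im z \<le> 2 * Re z * Im z" using Rk I0 by (intro mult_right_mono) auto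
  then have "k * Im z \<le> k * (k / 4)" using im y by (simp add: power2_eq_square)
  then have "Im z \<le> k / 4" using k by simp
  then show "csqrt (Complex x y) \<in> spectral_strip k" using Rk I0 k by (auto simp: spectral_strip_def z_def)
  assume "y > 0"
  then have "Im z \<noteq> 0" using im by auto
  then show "Im (csqrt (Complex x y)) > 0" unfolding z_def[symmetric] using I0 by simp
qed

section \<open>Uniqueness of the density and passage to a Borel potential\<close>

text \<open>Both values are the right derivative at \<open>a\<close> of the same primitive.\<close>

lemma continuous_density_unique:
  fixes g h :: "real \<Rightarrow> 'a::euclidean_space"
  assumes r: "r > 0" and g: "continuous_on {a..a + r} g" and h: "continuous_on {a..a + r} h"
    and eq: "\<And>x. x \<in> {a..a + r} \<Longrightarrow> (LINT t:{a..x}|lborel. g t) = (LINT t:{a..x}|lborel. h t)"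
  shows "g a = h a"
proof -
  have i: "(LINT t:{a..x}|lborel. f t) = integral {a..x} f" if "continuous_on {a..a + r} f" "x \<in> {a..a + r}" for f :: "real \<Rightarrow> 'a" and x
    using that by (intro set_borel_integral_eq_integral(2) borel_integrable_atLeastAtMost' continuous_on_subset[OF that(1)]) auto
  have dg: "((\<lambda>x. integral {a..x} g) has_vector_derivative g a) (at a within {a..a + r})"
    using g r by (intro integral_has_vector_derivative) auto
  have dh: "((\<lambda>x. integral {a..x} h) has_vector_derivative h a) (at a within {a..a + r})"
    using h r by (intro integral_has_vector_derivative) auto
  have "((\<lambda>x. integral {a..x} g) has_vector_derivative h a) (at a within {a..a + r})"
    by (rule has_vector_derivative_transform[OF _ _ dh]) (use r i[OF g] i[OF h] eq in auto)
  then have d: "((\<lambda>x. integral {a..x} g) has_vector_derivative h a) (at a within cbox a (a + r))" by simp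
  have dg': "((\<lambda>x. integral {a..x} g) has_vector_derivative g a) (at a within cbox a (a + r))" using dg by simp
  show ?thesis
    by (rule vector_derivative_unique_within_closed_interval[OF _ _ dg' d]) (use r in auto)
qed

text \<open>The theorem allows Lebesgue measurable \<open>q\<close>, while the fixed point argument
  works with Borel functions and \<open>lborel\<close>. Real and imaginary parts are replaced
  separately.\<close>

lemma borel_representative:
  fixes q :: "real \<Rightarrow> complex"
  assumes q: "set_integrable lebesgue {0<..} q"
  obtains q0 where "integrable lborel q0" "\<And>y. y \<le> 0 \<Longrightarrow> q0 y = 0" "AE y in lebesgue. y > 0 \<longrightarrow> q y = q0 y"
proof -
  define p where "p y = indicator {0<..} y *\<^sub>R q y" for y :: real
  have p: "integrable lebesgue p" using q unfolding set_integrable_def p_def .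
  have [measurable]: "p \<in> borel_measurable lebesgue" using p by auto
  obtain a where a: "a \<in> borel_measurable lborel" "AE y in lborel. Re (p y) = a y"
    using completion_ex_borel_measurable_real[of "\<lambda>y. Re (p y)" lborel] by auto
  obtain b where b: "b \<in> borel_measurable lborel" "AE y in lborel. Im (p y) = b y"
    using completion_ex_borel_measurable_real[of "\<lambda>y. Im (p y)" lborel] by auto
  define q0 where "q0 y = indicator {0<..} y *\<^sub>R (of_real (a y) + \<i> * of_real (b y))" for y
  have m [measurable]: "q0 \<in> borel_measurable lborel" unfolding q0_def using a(1) b(1) by measurable
  have "AE y in lborel. p y = q0 y"
    using a(2) b(2)
  proof eventually_elim
    case (elim y) then show ?case
      by (cases "y > 0") (auto simp: q0_def p_def complex_eq_iff)
  qed
  then have ae: "AE y in lebesgue. p y = q0 y" by (rule AE_completion)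
  show thesis
  proof
    have "integrable lebesgue q0"
      using integrable_cong_AE[of p lebesgue q0] ae p measurable_completion[OF m] by simp
    then show "integrable lborel q0" using integrable_completion[OF m] by simp
    show "y \<le> 0 \<Longrightarrow> q0 y = 0" for y by (simp add: q0_def)
    show "AE y in lebesgue. y > 0 \<longrightarrow> q y = q0 y" using ae by eventually_elim (auto simp: p_def)
  qed
qed

text \<open>One transfer for the L1 norm and for both first order integrals, with \<open>L\<close>
  being \<open>norm\<close>, \<open>Re\<close> and \<open>Im\<close>.\<close>

lemma set_integral_representative:
  fixes q q0 :: "real \<Rightarrow> complex" and L :: "complex \<Rightarrow> real"
  assumes q: "set_integrable lebesgue {0<..} q" and q0: "integrable lborel q0" "\<And>y. y \<le> 0 \<Longrightarrow> q0 y = 0"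
    and ae: "AE y in lebesgue. y > 0 \<longrightarrow> q y = q0 y"
    and c: "c \<in> borel_measurable borel" and L: "continuous_on UNIV L" "L 0 = 0"
  shows "(LINT y:{0<..}|lebesgue. c y * L (q y)) = (LINT y|lborel. c y * L (q0 y))"
proof -
  have m: "(\<lambda>y. c y * L (q0 y)) \<in> borel_measurable lborel"
    using c borel_measurable_continuous_on[OF L(1), of q0 lborel] q0(1) by measurable
  have [measurable]: "(\<lambda>y. indicator {0<..} y *\<^sub>R q y) \<in> borel_measurable lebesgue"
    using q unfolding set_integrable_def by auto
  have [measurable]: "c \<in> borel_measurable lebesgue" using c by (intro measurable_completion) simp
  have "(\<lambda>y. L (indicator {0<..} y *\<^sub>R q y)) \<in> borel_measurable lebesgue"
    by (rule borel_measurable_continuous_on[OF L(1)]) measurable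
  then have "(\<lambda>y. c y * L (indicator {0<..} y *\<^sub>R q y)) \<in> borel_measurable lebesgue" by measurable
  moreover have "(\<lambda>y. c y * L (indicator {0<..} y *\<^sub>R q y)) = (\<lambda>y. indicator {0<..} y *\<^sub>R (c y * L (q y)))"
    by (auto simp: indicator_def L(2))
  ultimately have m1: "(\<lambda>y. indicator {0<..} y *\<^sub>R (c y * L (q y))) \<in> borel_measurable lebesgue" by simp
  have "(LINT y:{0<..}|lebesgue. c y * L (q y)) = (LINT y|lebesgue. c y * L (q0 y))"
    unfolding set_lebesgue_integral_def
  proof (rule integral_cong_AE[OF m1 measurable_completion[OF m]])
    show "AE y in lebesgue. indicator {0<..} y *\<^sub>R (c y * L (q y)) = c y * L (q0 y)"
      using ae by eventually_elim (auto simp: indicator_def q0(2) L(2))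
  qed
  also have "\<dots> = (LINT y|lborel. c y * L (q0 y))" by (rule integral_completion[OF m])
  finally show ?thesis .
qed

lemma solution_cong_AE:
  assumes "AE y in lebesgue. y > 0 \<longrightarrow> q y = q0 y"
  shows "solution q \<mu> F F' \<longleftrightarrow> solution q0 \<mu> F F'"
proof -
  have "(AE x in lebesgue. x > 0 \<longrightarrow> (\<exists>F''. (F' has_vector_derivative F'') (at x) \<and> - (eps ** F'') + Qmat (q x) ** F x = mat \<mu> ** F x))
    \<longleftrightarrow> (AE x in lebesgue. x > 0 \<longrightarrow> (\<exists>F''. (F' has_vector_derivative F'') (at x) \<and> - (eps ** F'') + Qmat (q0 x) ** F x = mat \<mu> ** F x))"
    by (rule eventually_subst) (use assms in \<open>eventually_elim, auto\<close>)
  then show ?thesis unfolding solution_def by simp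
qed

text \<open>\<open>q\<close> enters \<open>spectral_pair\<close> only through the equation in
  \<open>solution\<close>, which is required almost everywhere.\<close>

lemma spectral_pair_cong_AE:
  assumes "AE y in lebesgue. y > 0 \<longrightarrow> q y = q0 y"
  shows "spectral_pair q \<nu> \<psi> \<longleftrightarrow> spectral_pair q0 \<nu> \<psi>"
  unfolding spectral_pair_def Weyl_M_def is_Weyl_matrix_def solution_cong_AE[OF assms] ..

section \<open>Boundary values and first order terms\<close>

context small_potential begin

definition "nu_correction = (LINT y|lborel. sin (2 * k * y) * Re (q y))"
definition "psi_correction = (LINT y|lborel. exp (- (k * y)) * sin (k * y) * Im (q y))"

lemma integrable_decaying_potential:
  assumes w: "Re w \<ge> 0"
  shows "integrable lborel (\<lambda>y. exp (- w * of_real y) * of_real (Re (q y)))" (is ?A)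
    and "integrable lborel (\<lambda>y. exp (- w * of_real y) * of_real (Im (q y)))" (is ?B)
proof -
  have [measurable]: "q \<in> borel_measurable borel" using q by auto
  have e: "norm (exp (- w * of_real y) * of_real r) \<le> norm (q y)" if "\<bar>r\<bar> \<le> norm (q y)" for r y
  proof (cases "y \<le> 0")
    case True then show ?thesis using that by (simp add: q0)
  next
    case False
    then show ?thesis using mult_mono[OF norm_exp_decay[OF w, of y] that] by (simp add: norm_mult)
  qed
  show ?A by (rule Bochner_Integration.integrable_bound[OF integrable_norm[OF q]])
      (measurable, rule AE_I2, unfold real_norm_def abs_norm_cancel, rule e, rule abs_Re_le_cmod)
  show ?B by (rule Bochner_Integration.integrable_bound[OF integrable_norm[OF q]])
      (measurable, rule AE_I2, unfold real_norm_def abs_norm_cancel, rule e, rule abs_Im_le_cmod)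
qed

text \<open>Write \<open>S\<close> and \<open>E\<close> for the two corrections. At
  \<open>z = k\<close> the four derivatives give \<open>pi n = (k - S) / 2 + e1\<close> on the
  diagonal of the density and \<open>pi m = (k - S) / 2 + \<i> E + e2\<close> off it, with errors at
  most \<open>e = 32 Q\<^sup>2 / k\<close>. Then \<open>p = m / n\<close>, and division by
  \<open>pi n \<ge> k / 4\<close> turns the collected error \<open>69 Q\<^sup>2 / k\<close> into
  \<open>276 Q\<^sup>2 / k\<^sup>2\<close>.\<close>

lemma pair_values_asymptotics:
  assumes sp: "spectral_pair q \<nu> \<psi>"
  defines "Q \<equiv> LINT y|lborel. norm (q y)"
  shows "\<exists>n p. pair_values \<nu> \<psi> (k\<^sup>2) n p"
    and "pair_values \<nu> \<psi> (k\<^sup>2) n p \<Longrightarrow> \<bar>n - 1 / (2 * pi) * (k - nu_correction)\<bar> \<le> 32 / k * Q\<^sup>2"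
    and "pair_values \<nu> \<psi> (k\<^sup>2) n p \<Longrightarrow> norm (p - (1 + 2 * \<i> / of_real k * of_real psi_correction)) \<le> 276 / k\<^sup>2 * Q\<^sup>2"
proof -
  have [measurable]: "q \<in> borel_measurable borel" using q by auto
  have Q0: "Q \<ge> 0" unfolding Q_def by (rule integral_nonneg_AE) auto
  have Qk: "16 * Q \<le> k" using small by (simp add: Q_def)
  obtain u1 u1' v1 v1' where s1:
    "\<And>z. z \<in> spectral_strip k \<Longrightarrow> weyl_data (\<lambda>x. u1 x z) (\<lambda>x. u1' x z) (\<lambda>x. v1 x z) (\<lambda>x. v1' x z) (-1) z"
    "continuous_on (spectral_strip k) (u1' 0)" "continuous_on (spectral_strip k) (v1' 0)"
    "\<And>z. z \<in> spectral_strip k \<Longrightarrow> norm (u1' 0 z - (\<i> * z - (LINT y|lborel. exp (\<i> * z * of_real y) *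
        rot_pot (q y) (exp (\<i> * z * of_real y)) (-1 * exp (- z * of_real y))))) \<le> 32 / k * Q\<^sup>2"
    "\<And>z. z \<in> spectral_strip k \<Longrightarrow> norm (v1' 0 z - (- (-1) * z - (LINT y|lborel. exp (- z * of_real y) *
        rot_pot (q y) (-1 * exp (- z * of_real y)) (exp (\<i> * z * of_real y))))) \<le> 32 / k * Q\<^sup>2"
    unfolding Q_def by (rule weyl_solution[of "-1"]) (simp, blast)
  obtain u2 u2' v2 v2' where s2:
    "\<And>z. z \<in> spectral_strip k \<Longrightarrow> weyl_data (\<lambda>x. u2 x z) (\<lambda>x. u2' x z) (\<lambda>x. v2 x z) (\<lambda>x. v2' x z) 1 z"
    "continuous_on (spectral_strip k) (u2' 0)" "continuous_on (spectral_strip k) (v2' 0)"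
    "\<And>z. z \<in> spectral_strip k \<Longrightarrow> norm (u2' 0 z - (\<i> * z - (LINT y|lborel. exp (\<i> * z * of_real y) *
        rot_pot (q y) (exp (\<i> * z * of_real y)) (1 * exp (- z * of_real y))))) \<le> 32 / k * Q\<^sup>2"
    "\<And>z. z \<in> spectral_strip k \<Longrightarrow> norm (v2' 0 z - (- 1 * z - (LINT y|lborel. exp (- z * of_real y) *
        rot_pot (q y) (1 * exp (- z * of_real y)) (exp (\<i> * z * of_real y))))) \<le> 32 / k * Q\<^sup>2"
    unfolding Q_def by (rule weyl_solution[of "1"]) (simp, blast)
  define M where "M z = (\<chi> i j. if j = (1::2) then (if i = (1::2) then (u1' 0 z + v1' 0 z) / 2 else (u1' 0 z - v1' 0 z) / 2)
                          else (if i = 1 then (u2' 0 z + v2' 0 z) / 2 else (u2' 0 z - v2' 0 z) / 2))" for z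
  have Mn: "M z $ 1 $ 1 = (u1' 0 z + v1' 0 z) / 2" "M z $ 2 $ 1 = (u1' 0 z - v1' 0 z) / 2" "M z $ 1 $ 2 = (u2' 0 z + v2' 0 z) / 2" for z
    by (simp_all add: M_def)
  have Weyl: "Weyl_M q (z\<^sup>2) = M z" if z: "z \<in> spectral_strip k" "Im z > 0" for z
    unfolding M_def
    by (rule Weyl_M_eq[OF z s1(1)[OF z(1)] s2(1)[OF z(1)]])
  have Mc: "continuous_on (spectral_strip k) M"
  proof (rule continuous_on_cmat)
    fix i j :: 2
    show "continuous_on (spectral_strip k) (\<lambda>z. M z $ i $ j)"
      using exhaust_2[of i] exhaust_2[of j] by (auto simp: M_def intro!: continuous_intros s1(2,3) s2(2,3))
  qed
  \<comment> \<open>Half the width and also the height of a rectangle above \<open>k\<^sup>2\<close>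
    whose square roots lie in the strip.\<close>
  define r where "r = k\<^sup>2 / 4"
  have r: "r > 0" using k by (simp add: r_def)
  define H where "H x y = im_mat (M (csqrt (Complex x y)))" for x y
  have str: "csqrt (Complex x y) \<in> spectral_strip k" "y > 0 \<Longrightarrow> Im (csqrt (Complex x y)) > 0"
    if "x \<in> {k\<^sup>2 - r..k\<^sup>2 + r}" "y \<in> {0..r}" for x y
    using csqrt_spectral_strip[OF k, of x y] that by (auto simp: r_def)
  have Hc: "continuous_on ({k\<^sup>2 - r..k\<^sup>2 + r} \<times> {0..r}) (\<lambda>p. H (fst p) (snd p))"
  proof -
    have csqrt_cont: "continuous_on {z. Re z > 0} csqrt"
      by (rule continuous_at_imp_continuous_on) (auto intro!: isCont_csqrt' simp: complex_nonpos_Reals_iff)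
    have "continuous_on ({k\<^sup>2 - r..k\<^sup>2 + r} \<times> {0..r}) (\<lambda>p. csqrt (Complex (fst p) (snd p)))"
    proof (rule continuous_on_compose2[OF csqrt_cont])
      show "continuous_on ({k\<^sup>2 - r..k\<^sup>2 + r} \<times> {0..r}) (\<lambda>p. Complex (fst p) (snd p))" by (intro continuous_intros)
      show "(\<lambda>p. Complex (fst p) (snd p)) ` ({k\<^sup>2 - r..k\<^sup>2 + r} \<times> {0..r}) \<subseteq> {z. Re z > 0}"
        using k by (auto simp: r_def intro: less_le_trans[of 0 "k\<^sup>2 - k\<^sup>2 / 4"])
    qed
    then have "continuous_on ({k\<^sup>2 - r..k\<^sup>2 + r} \<times> {0..r}) (\<lambda>p. M (csqrt (Complex (fst p) (snd p))))"
      by (rule continuous_on_compose2[OF Mc]) (use str in auto)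
    then show ?thesis unfolding H_def
      by (rule bounded_linear.continuous_on[OF bounded_linear_im_mat])
  qed
  have Heq: "H x y = (LINT t|\<nu>. (y / ((t - x)\<^sup>2 + y\<^sup>2)) *\<^sub>R pair_mat (\<psi> t))"
    if "x \<in> {k\<^sup>2 - r..k\<^sup>2 + r}" "0 < y" "y \<le> r" for x y
    using Weyl[of "csqrt (Complex x y)"] str[of x y] that im_mat_Weyl_M[OF sp, of y x] unfolding H_def by simp
  define \<rho> where "\<rho> t = (1 / pi) *\<^sub>R H t 0" for t
  have spd: "sets \<nu> = sets borel" "integrable \<nu> (\<lambda>t. 1 / (1 + t\<^sup>2))" "\<psi> \<in> borel_measurable borel" "AE t in \<nu>. cmod (\<psi> t) \<le> 1"
    using sp unfolding spectral_pair_def by blast+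
  have Sig: "Sigma_measure \<nu> \<psi> A = (LINT t:A|lborel. \<rho> t)" if A: "A \<in> sets borel" "A \<subseteq> cball (k\<^sup>2) r" for A
    unfolding Sigma_measure_def \<rho>_def
  proof (rule stieltjes_inversion[OF spd(1,2) _ _ _ r Hc Heq A(1)])
    show "(\<lambda>t. pair_mat (\<psi> t)) \<in> borel_measurable borel"
      by (rule borel_measurable_continuous_on[OF continuous_on_pair_mat spd(3)])
    show "AE t in \<nu>. norm (pair_mat (\<psi> t)) \<le> 4"
      using spd(4)
    proof eventually_elim
      case (elim t)
      have "mat 1 ** pair_mat (\<psi> t) = pair_mat (\<psi> t)" by simp
      then show ?case using norm_pair_mat_le[OF elim, of 1] by simp
    qed
  qed (use A r in \<open>auto simp: cball_eq_atLeastAtMost\<close>)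
  have \<rho>c: "continuous_on (cball (k\<^sup>2) r) \<rho>"
  proof -
    have "continuous_on {k\<^sup>2 - r..k\<^sup>2 + r} (\<lambda>x. H (fst (x, 0::real)) (snd (x, 0::real)))"
      by (rule continuous_on_compose2[OF Hc]) (use r in \<open>auto intro!: continuous_intros\<close>)
    then show ?thesis unfolding \<rho>_def cball_eq_atLeastAtMost by (auto intro!: continuous_on_scaleR)
  qed
  \<comment> \<open>At positive height \<open>H\<close> is a Poisson integral of
    \<open>pair_mat\<close>, whose diagonal entries agree; continuity carries this to the real
    axis.\<close>
  have H11: "H (k\<^sup>2) 0 $ 1 $ 1 = H (k\<^sup>2) 0 $ 2 $ 2"
  proof -
    define yn where "yn n = r / real (Suc n)" for n
    have yn: "0 < yn n" "yn n \<le> r" for n using r by (auto simp: yn_def field_simps)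
    have ynl: "yn \<longlonglongrightarrow> 0" unfolding yn_def using LIMSEQ_Suc[OF lim_const_over_n[of r]] by simp
    have m: "(k\<^sup>2, 0) \<in> {k\<^sup>2 - r..k\<^sup>2 + r} \<times> {0..r}" using r by auto
    have ev: "\<forall>\<^sub>F n in sequentially. (k\<^sup>2, yn n) \<in> {k\<^sup>2 - r..k\<^sup>2 + r} \<times> {0..r}"
      using r yn by (intro always_eventually) (auto intro: less_imp_le)
    have lim: "(\<lambda>n. (k\<^sup>2, yn n)) \<longlonglongrightarrow> (k\<^sup>2, 0)" by (intro tendsto_Pair tendsto_const ynl)
    have l: "(\<lambda>n. H (k\<^sup>2) (yn n)) \<longlonglongrightarrow> H (k\<^sup>2) 0"
      using continuous_on_tendsto_compose[OF Hc lim m ev] by simp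
    have "H (k\<^sup>2) (yn n) $ 1 $ 1 = H (k\<^sup>2) (yn n) $ 2 $ 2" for n
    proof -
      have bl: "bounded_linear (\<lambda>A :: cmat. A $ i $ i)" for i
        by (rule bounded_linear_compose[OF bounded_linear_vec_nth bounded_linear_vec_nth, unfolded comp_def])
      have "(LINT t|\<nu>. (yn n / ((t - k\<^sup>2)\<^sup>2 + (yn n)\<^sup>2)) *\<^sub>R pair_mat (\<psi> t)) $ 1 $ 1
          = (LINT t|\<nu>. (yn n / ((t - k\<^sup>2)\<^sup>2 + (yn n)\<^sup>2)) *\<^sub>R pair_mat (\<psi> t)) $ 2 $ 2"
      proof (cases "integrable \<nu> (\<lambda>t. (yn n / ((t - k\<^sup>2)\<^sup>2 + (yn n)\<^sup>2)) *\<^sub>R pair_mat (\<psi> t))")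
        case True
        from integral_bounded_linear[OF bl[of 1] this] integral_bounded_linear[OF bl[of 2] this] show ?thesis by simp
      qed (simp add: not_integrable_integral_eq)
      then show ?thesis using Heq[of "k\<^sup>2" "yn n"] yn[of n] r by simp
    qed
    moreover have "(\<lambda>n. H (k\<^sup>2) (yn n) $ 1 $ 1) \<longlonglongrightarrow> H (k\<^sup>2) 0 $ 1 $ 1" "(\<lambda>n. H (k\<^sup>2) (yn n) $ 2 $ 2) \<longlonglongrightarrow> H (k\<^sup>2) 0 $ 2 $ 2"
      by (intro tendsto_vec_nth l)+
    ultimately show ?thesis using LIMSEQ_unique by fastforce
  qed
  have ck: "csqrt (Complex (k\<^sup>2) 0) = of_real k"
    using k by (metis complex_of_real_def of_real_sqrt csqrt_of_real_nonneg less_imp_le real_sqrt_unique zero_le_power2)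
  let ?z = "complex_of_real k"
  have zs: "?z \<in> spectral_strip k" using k by (simp add: spectral_strip_def)
  \<comment> \<open>\<open>n0\<close> and \<open>m0\<close> are the entries \<open>1 1\<close> and
    \<open>1 2\<close> of the density \<open>im_mat (M k) / pi\<close> at
    \<open>k\<^sup>2\<close>.\<close>
  define n0 where "n0 = Im (M ?z $ 1 $ 1) / pi"
  define m0 where "m0 = (M ?z $ 1 $ 2 - cnj (M ?z $ 2 $ 1)) / (2 * \<i>) / of_real pi"
  have \<rho>n: "\<rho> (k\<^sup>2) $ i $ j = (M ?z $ i $ j - cnj (M ?z $ j $ i)) / (2 * \<i>) / of_real pi" for i j
    unfolding \<rho>_def vector_scaleR_component by (simp add: H_def ck im_mat_def scaleR_conv_of_real)
  have Im_eq: "(a - cnj a) / (2 * \<i>) = of_real (Im a)" for a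
    by (simp add: complex_eq_iff Re_divide Im_divide)
  have \<rho>1: "\<rho> (k\<^sup>2) $ 1 $ 1 = of_real n0" "\<rho> (k\<^sup>2) $ 1 $ 2 = m0"
    unfolding \<rho>n n0_def m0_def by (simp_all only: Im_eq of_real_divide)
  have \<rho>2: "\<rho> (k\<^sup>2) $ 2 $ 2 = of_real n0" "\<rho> (k\<^sup>2) $ 2 $ 1 = cnj m0"
  proof -
    show "\<rho> (k\<^sup>2) $ 2 $ 2 = of_real n0"
      using H11 unfolding \<rho>1(1)[symmetric] \<rho>_def vector_scaleR_component by simp
    show "\<rho> (k\<^sup>2) $ 2 $ 1 = cnj m0"
      unfolding \<rho>n m0_def by (simp add: field_simps)
  qed
  \<comment> \<open>The exponentials are \<open>exp (2 \<i> k y)\<close>,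
    \<open>exp (- 2 k y)\<close> and \<open>exp ((\<i> - 1) k y)\<close>, written as
    \<open>exp (- w y)\<close> to fit \<open>integrable_decaying_potential\<close>.
    \<open>Im I1\<close> and \<open>Im J\<close> are the two corrections, and \<open>I2\<close> is
    real.\<close>
  define I1 where "I1 = (LINT y|lborel. exp (- (- 2 * \<i> * of_real k) * of_real y) * of_real (Re (q y)))"
  define I2 where "I2 = (LINT y|lborel. exp (- (2 * of_real k) * of_real y) * complex_of_real (Re (q y)))"
  define J where "J = (LINT y|lborel. exp (- (of_real k - \<i> * of_real k) * of_real y) * of_real (Im (q y)))"
  have iI1: "integrable lborel (\<lambda>y. exp (- (- 2 * \<i> * of_real k) * of_real y) * complex_of_real (Re (q y)))"
    and iI2: "integrable lborel (\<lambda>y. exp (- (2 * of_real k) * of_real y) * complex_of_real (Re (q y)))"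
    and iJ: "integrable lborel (\<lambda>y. exp (- (of_real k - \<i> * of_real k) * of_real y) * complex_of_real (Im (q y)))"
    using k by - (rule integrable_decaying_potential; simp)+
  have U: "(LINT y|lborel. exp (\<i> * ?z * of_real y) * rot_pot (q y) (exp (\<i> * ?z * of_real y)) (\<sigma> * exp (- ?z * of_real y))) = I1 - \<i> * \<sigma> * J" for \<sigma>
  proof -
    have "exp (\<i> * ?z * of_real y) * rot_pot (q y) (exp (\<i> * ?z * of_real y)) (\<sigma> * exp (- ?z * of_real y))
       = exp (- (- 2 * \<i> * of_real k) * of_real y) * of_real (Re (q y)) - (\<i> * \<sigma>) * (exp (- (of_real k - \<i> * of_real k) * of_real y) * of_real (Im (q y)))" for y
    proof -
      have "exp (- (- 2 * \<i> * of_real k) * of_real y) = exp (\<i> * ?z * of_real y) * exp (\<i> * ?z * of_real y)"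
        "exp (- (of_real k - \<i> * of_real k) * of_real y) = exp (\<i> * ?z * of_real y) * exp (- ?z * of_real y)"
        by (simp_all add: exp_add[symmetric] algebra_simps)
      then show ?thesis by (simp add: rot_pot_def algebra_simps)
    qed
    then show ?thesis unfolding I1_def J_def using iI1 iJ by simp
  qed
  have V: "(LINT y|lborel. exp (- ?z * of_real y) * rot_pot (q y) (\<sigma> * exp (- ?z * of_real y)) (exp (\<i> * ?z * of_real y))) = \<sigma> * I2 - \<i> * J" for \<sigma>
  proof -
    have "exp (- ?z * of_real y) * rot_pot (q y) (\<sigma> * exp (- ?z * of_real y)) (exp (\<i> * ?z * of_real y))
       = \<sigma> * (exp (- (2 * of_real k) * of_real y) * of_real (Re (q y))) - \<i> * (exp (- (of_real k - \<i> * of_real k) * of_real y) * of_real (Im (q y)))" for y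
    proof -
      have "exp (- (2 * of_real k) * of_real y) = exp (- ?z * of_real y) * exp (- ?z * of_real y)"
        "exp (- (of_real k - \<i> * of_real k) * of_real y) = exp (\<i> * ?z * of_real y) * exp (- ?z * of_real y)"
        by (simp_all add: exp_add[symmetric] algebra_simps)
      then show ?thesis by (simp add: rot_pot_def algebra_simps)
    qed
    then show ?thesis unfolding I2_def J_def using iI2 iJ by simp
  qed
  have ImI1: "Im I1 = nu_correction"
    unfolding I1_def nu_correction_def integral_Im[OF iI1, symmetric]
    by (rule Bochner_Integration.integral_cong) (auto simp: Im_exp mult.commute mult.left_commute)
  have ImI2: "Im I2 = 0"
    unfolding I2_def integral_Im[OF iI2, symmetric] by (simp add: Im_exp)
  have ImJ: "Im J = psi_correction"
    unfolding J_def psi_correction_def integral_Im[OF iJ, symmetric]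
    by (rule Bochner_Integration.integral_cong) (auto simp: Im_exp mult.commute mult.left_commute)
  define e where "e = 32 / k * Q\<^sup>2"
  \<comment> \<open>The errors of the four derivatives at 0; index 1 belongs to
    \<open>\<sigma> = -1\<close>, index 2 to \<open>\<sigma> = 1\<close>.\<close>
  define a1 where "a1 = u1' 0 ?z - (\<i> * ?z - (I1 + \<i> * J))"
  define b1 where "b1 = v1' 0 ?z - (?z - (- I2 - \<i> * J))"
  define a2 where "a2 = u2' 0 ?z - (\<i> * ?z - (I1 - \<i> * J))"
  define b2 where "b2 = v2' 0 ?z - (- ?z - (I2 - \<i> * J))"
  have ab: "norm a1 \<le> e" "norm b1 \<le> e" "norm a2 \<le> e" "norm b2 \<le> e"
    using s1(4)[OF zs, unfolded U] s1(5)[OF zs, unfolded V] s2(4)[OF zs, unfolded U] s2(5)[OF zs, unfolded V]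
    unfolding a1_def b1_def a2_def b2_def e_def by simp_all
  have e0: "e \<ge> 0" using k by (simp add: e_def)
  define S where "S = nu_correction"
  define E where "E = psi_correction"
  define e1 where "e1 = Im (a1 + b1) / 2"
  define e2 where "e2 = ((a2 + b2) - cnj (a1 - b1)) / (4 * \<i>)"
  \<comment> \<open>\<open>J\<close> cancels between the two components, so \<open>Im q\<close> does
    not enter the density of \<open>\<nu>\<close> at first order.\<close>
  have pn: "pi * n0 = (k - S) / 2 + e1"
  proof -
    have "pi * n0 = Im (M ?z $ 1 $ 1)" by (simp add: n0_def)
    also have "\<dots> = Im ((\<i> * ?z - (I1 + \<i> * J) + a1 + (?z - (- I2 - \<i> * J) + b1)) / 2)"
      unfolding Mn a1_def b1_def by simp
    also have "\<dots> = (k - S) / 2 + e1" using ImI1 ImI2 by (simp add: e1_def S_def field_simps)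
    finally show ?thesis .
  qed
  \<comment> \<open>Subtracting the conjugate of the transposed entry leaves
    \<open>\<i> (k - Im I1)\<close> and \<open>\<i> (J - cnj J) = - 2 E\<close>, besides the errors;
    division by \<open>2 \<i>\<close> gives the right-hand side.\<close>
  have pm: "of_real pi * m0 = of_real ((k - S) / 2) + \<i> * of_real E + e2"
  proof -
    have "of_real pi * m0 = (M ?z $ 1 $ 2 - cnj (M ?z $ 2 $ 1)) / (2 * \<i>)" by (simp add: m0_def)
    also have "\<dots> = ((\<i> * ?z - (I1 - \<i> * J) + a2 + (- ?z - (I2 - \<i> * J) + b2)) / 2
        - cnj ((\<i> * ?z - (I1 + \<i> * J) + a1 - (?z - (- I2 - \<i> * J) + b1)) / 2)) / (2 * \<i>)"
      unfolding Mn a1_def b1_def a2_def b2_def by simp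
    also have "\<dots> = of_real ((k - S) / 2) + \<i> * of_real E + e2"
      using ImI1 ImI2 ImJ unfolding e2_def S_def E_def complex_eq_iff
      by (simp add: Re_divide Im_divide field_simps)
    finally show ?thesis .
  qed
  have e1b: "\<bar>e1\<bar> \<le> e"
    using abs_Im_le_cmod[of "a1 + b1"] norm_triangle_ineq[of a1 b1] ab unfolding e1_def by simp
  have e2b: "norm e2 \<le> e"
  proof -
    have "norm ((a2 + b2) - cnj (a1 - b1)) \<le> (norm a2 + norm b2) + (norm a1 + norm b1)"
      by (intro order_trans[OF norm_triangle_ineq4] add_mono norm_triangle_ineq)
         (simp only: complex_mod_cnj norm_triangle_ineq4)
    then show ?thesis using ab unfolding e2_def by (simp add: norm_divide norm_mult)
  qed
  have SQ: "\<bar>S\<bar> \<le> Q" unfolding S_def nu_correction_def Q_def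
  proof -
    have "norm (LINT y|lborel. sin (2 * k * y) * Re (q y)) \<le> (LINT y|lborel. norm (q y))"
    proof (rule norm_integral_le)
      show "norm (sin (2 * k * y) * Re (q y)) \<le> norm (q y)" for y
        using mult_mono[OF abs_sin_le_one[of "2 * k * y"] abs_Re_le_cmod[of "q y"]] by (simp add: abs_mult)
    qed (use q in simp)
    then show "\<bar>LINT y|lborel. sin (2 * k * y) * Re (q y)\<bar> \<le> (LINT y|lborel. norm (q y))" by simp
  qed
  have EQ: "\<bar>E\<bar> \<le> Q" unfolding E_def psi_correction_def Q_def
  proof -
    have "norm (LINT y|lborel. exp (- (k * y)) * sin (k * y) * Im (q y)) \<le> (LINT y|lborel. norm (q y))"
    proof (rule norm_integral_le)
      show "norm (exp (- (k * y)) * sin (k * y) * Im (q y)) \<le> norm (q y)" for y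
      proof (cases "y \<le> 0")
        case True then show ?thesis by (simp add: q0)
      next
        case False
        then have "exp (- (k * y)) * \<bar>sin (k * y)\<bar> \<le> 1 * 1" using k by (intro mult_mono) auto
        then have "(exp (- (k * y)) * \<bar>sin (k * y)\<bar>) * \<bar>Im (q y)\<bar> \<le> 1 * norm (q y)"
          by (intro mult_mono abs_Im_le_cmod) auto
        then show ?thesis by (simp add: abs_mult)
      qed
    qed (use q in simp)
    then show "\<bar>LINT y|lborel. exp (- (k * y)) * sin (k * y) * Im (q y)\<bar> \<le> (LINT y|lborel. norm (q y))" by simp
  qed
  \<comment> \<open>The quadratic error is also bounded linearly, by \<open>16 Q \<le> k\<close>.
    This enters the lower bound on \<open>n0\<close> and the mixed term \<open>E * e1\<close>
    below.\<close>
  have eQ: "e \<le> 2 * Q"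
  proof -
    have "32 * Q * Q \<le> (2 * k) * Q" using Qk Q0 by (intro mult_right_mono) auto
    then show ?thesis using k by (simp add: e_def power2_eq_square field_simps)
  qed
  have pn4: "pi * n0 \<ge> k / 4"
    unfolding pn using SQ e1b eQ Qk by (simp add: field_simps)
  then have n0p: "n0 > 0" using k pi_gt_zero by (smt (verit) divide_pos_pos mult_nonneg_nonpos)
  have n0est: "\<bar>n0 - 1 / (2 * pi) * (k - S)\<bar> \<le> 32 / k * Q\<^sup>2"
  proof -
    have "pi * (n0 - 1 / (2 * pi) * (k - S)) = e1" using pn by (simp add: field_simps)
    then have "pi * \<bar>n0 - 1 / (2 * pi) * (k - S)\<bar> = \<bar>e1\<bar>" by (metis abs_mult abs_of_nonneg pi_ge_zero)
    then have "1 * \<bar>n0 - 1 / (2 * pi) * (k - S)\<bar> \<le> e"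
      using e1b pi_ge_two mult_right_mono[of 1 pi "\<bar>n0 - 1 / (2 * pi) * (k - S)\<bar>"] by linarith
    then show ?thesis by (simp add: e_def)
  qed
  have pest: "norm (p - (1 + 2 * \<i> / of_real k * of_real E)) \<le> 276 / k\<^sup>2 * Q\<^sup>2" if p: "of_real n0 * p = m0" for p
  proof -
    define D where "D = p - (1 + 2 * \<i> / of_real k * of_real E)"
    have kn: "complex_of_real k \<noteq> 0" using k by simp
    \<comment> \<open>The first order term of \<open>p\<close> gets multiplied by
      \<open>pi * n0\<close> in place of \<open>k / 2\<close>; the discrepancy consists of these
      products of two small quantities.\<close>
    have bd: "\<bar>E * S / k - 2 * E * e1 / k\<bar> \<le> Q\<^sup>2 / k + 4 * Q\<^sup>2 / k"
    proof -
      have "\<bar>E * S\<bar> \<le> Q * Q" unfolding abs_mult using EQ SQ by (intro mult_mono) auto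
      moreover have "\<bar>2 * E * e1\<bar> \<le> 4 * Q * Q"
      proof -
        have "\<bar>E\<bar> * \<bar>e1\<bar> \<le> Q * (2 * Q)" using EQ e1b eQ Q0 by (intro mult_mono) auto
        then show ?thesis by (simp add: abs_mult)
      qed
      ultimately have "\<bar>E * S - 2 * E * e1\<bar> \<le> 5 * Q\<^sup>2" by (simp add: power2_eq_square)
      then have "\<bar>(E * S - 2 * E * e1) / k\<bar> \<le> 5 * Q\<^sup>2 / k" using k by (simp add: abs_divide divide_right_mono)
      then show ?thesis by (simp add: diff_divide_distrib add_divide_distrib[symmetric])
    qed
    have "of_real (pi * n0) * D = of_real pi * m0 - of_real (pi * n0) - 2 * \<i> / of_real k * of_real E * of_real (pi * n0)"
      unfolding D_def p[symmetric] by (simp add: algebra_simps)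
    also have "\<dots> = e2 - of_real e1 + \<i> * of_real (E * S / k - 2 * E * e1 / k)"
      unfolding pm pn using kn by (simp add: field_simps)
    also have "norm \<dots> \<le> norm e2 + \<bar>e1\<bar> + \<bar>E * S / k - 2 * E * e1 / k\<bar>"
      by (intro order_trans[OF norm_triangle_ineq] add_mono order_trans[OF norm_triangle_ineq4]) (simp_all add: norm_mult del: of_real_diff of_real_divide of_real_mult)
    also have "\<dots> \<le> 69 * Q\<^sup>2 / k"
    proof -
      \<comment> \<open>The count is \<open>32 + 32 + 1 + 4\<close>.\<close>
      have "e + e + (Q\<^sup>2 / k + 4 * Q\<^sup>2 / k) = 69 * Q\<^sup>2 / k" by (simp add: e_def)
      then show ?thesis using e1b e2b bd by linarith
    qed
    finally have "norm (complex_of_real (pi * n0) * D) \<le> 69 * Q\<^sup>2 / k" .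
    moreover have "norm (complex_of_real (pi * n0) * D) = (pi * n0) * norm D"
      using n0p unfolding norm_mult norm_of_real by simp
    ultimately have b: "(pi * n0) * norm D \<le> 69 * Q\<^sup>2 / k" by simp
    have "k / 4 * norm D \<le> (pi * n0) * norm D" by (rule mult_right_mono[OF pn4]) simp
    then have "k / 4 * norm D \<le> 69 * Q\<^sup>2 / k" using b by linarith
    then show ?thesis unfolding D_def[symmetric] using k by (simp add: field_simps power2_eq_square)
  qed
  show "\<exists>n p. pair_values \<nu> \<psi> (k\<^sup>2) n p"
    unfolding pair_values_def
  proof (intro exI conjI)
    show "r > 0" by (rule r)
    show "continuous_on (cball (k\<^sup>2) r) \<rho>" by (rule \<rho>c)
    show "\<forall>A\<in>sets borel. A \<subseteq> cball (k\<^sup>2) r \<longrightarrow> Sigma_measure \<nu> \<psi> A = (LINT t:A|lborel. \<rho> t)" using Sig by blast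
    show "\<rho> (k\<^sup>2) = n0 *\<^sub>R pair_mat (m0 / of_real n0)"
      using n0p unfolding vec_eq_iff forall_2 vector_scaleR_component \<rho>1 \<rho>2 by (simp add: scaleR_conv_of_real)
  qed
  have uniq: "n = n0 \<and> of_real n0 * p = m0" if pv: "pair_values \<nu> \<psi> (k\<^sup>2) n p" for n p
  proof -
    obtain s \<rho>' where s: "s > 0" "continuous_on (cball (k\<^sup>2) s) \<rho>'"
      "\<And>A. A \<in> sets borel \<Longrightarrow> A \<subseteq> cball (k\<^sup>2) s \<Longrightarrow> Sigma_measure \<nu> \<psi> A = (LINT t:A|lborel. \<rho>' t)"
      "\<rho>' (k\<^sup>2) = n *\<^sub>R pair_mat p"
      using pv unfolding pair_values_def by blast
    \<comment> \<open>A one-sided interval inside both neighbourhoods suffices, since the densities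
      are compared through right derivatives at \<open>k\<^sup>2\<close>.\<close>
    define l where "l = min r s"
    have l: "l > 0" "{k\<^sup>2..k\<^sup>2 + l} \<subseteq> cball (k\<^sup>2) r" "{k\<^sup>2..k\<^sup>2 + l} \<subseteq> cball (k\<^sup>2) s"
      using r s(1) by (auto simp: l_def cball_eq_atLeastAtMost)
    have "\<rho>' (k\<^sup>2) = \<rho> (k\<^sup>2)"
    proof (rule continuous_density_unique[OF l(1)])
      show "continuous_on {k\<^sup>2..k\<^sup>2 + l} \<rho>'" "continuous_on {k\<^sup>2..k\<^sup>2 + l} \<rho>"
        using continuous_on_subset[OF s(2) l(3)] continuous_on_subset[OF \<rho>c l(2)] by auto
      fix x assume x: "x \<in> {k\<^sup>2..k\<^sup>2 + l}"
      then have "{k\<^sup>2..x} \<subseteq> {k\<^sup>2..k\<^sup>2 + l}" by auto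
      then have "{k\<^sup>2..x} \<subseteq> cball (k\<^sup>2) r" "{k\<^sup>2..x} \<subseteq> cball (k\<^sup>2) s" using l by (meson order_trans)+
      then show "(LINT t:{k\<^sup>2..x}|lborel. \<rho>' t) = (LINT t:{k\<^sup>2..x}|lborel. \<rho> t)"
        using Sig[of "{k\<^sup>2..x}"] s(3)[of "{k\<^sup>2..x}"] by simp
    qed
    then have eq: "n *\<^sub>R pair_mat p = \<rho> (k\<^sup>2)" using s(4) by simp
    have "complex_of_real n = of_real n0" using arg_cong[OF eq, of "\<lambda>A. A $ 1 $ 1"] unfolding vector_scaleR_component \<rho>1 by (simp add: scaleR_conv_of_real)
    moreover have "complex_of_real n * p = m0" using arg_cong[OF eq, of "\<lambda>A. A $ 1 $ 2"] unfolding vector_scaleR_component \<rho>1 by (simp add: scaleR_conv_of_real)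
    ultimately show ?thesis by simp
  qed
  show "\<bar>n - 1 / (2 * pi) * (k - nu_correction)\<bar> \<le> 32 / k * Q\<^sup>2" if "pair_values \<nu> \<psi> (k\<^sup>2) n p"
    using uniq[OF that] n0est by (simp add: S_def)
  show "norm (p - (1 + 2 * \<i> / of_real k * of_real psi_correction)) \<le> 276 / k\<^sup>2 * Q\<^sup>2" if "pair_values \<nu> \<psi> (k\<^sup>2) n p"
    using uniq[OF that] pest[of p] by (simp add: E_def)
qed

end

theorem proposition3p8:
  fixes k :: real
  assumes "k > 0"
  shows "\<exists>C \<delta>. \<delta> > 0 \<and>
    (\<forall>(q :: real \<Rightarrow> complex) (\<nu> :: real measure) (\<psi> :: real \<Rightarrow> complex).
       set_integrable lebesgue {0<..} q \<and> L1_norm q < \<delta> \<and> spectral_pair q \<nu> \<psi> \<longrightarrow>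
       (\<exists>n p. pair_values \<nu> \<psi> (k\<^sup>2) n p) \<and>
       (\<forall>n p. pair_values \<nu> \<psi> (k\<^sup>2) n p \<longrightarrow>
          \<bar>n - 1 / (2 * pi) * (k - (LINT y:{0<..}|lebesgue. sin (2 * k * y) * Re (q y)))\<bar>
            \<le> C * (L1_norm q)\<^sup>2 \<and>
          cmod (p - (1 + 2 * \<i> / complex_of_real k *
                  complex_of_real (LINT y:{0<..}|lebesgue. exp (- (k * y)) * sin (k * y) * Im (q y))))
            \<le> C * (L1_norm q)\<^sup>2))"
proof (rule exI[of _ "32 / k + 276 / k\<^sup>2"], rule exI[of _ "k / 16"], rule conjI)
  \<comment> \<open>\<open>k / 16\<close> is the smallness required by
    \<open>small_potential\<close>; the constant adds \<open>32 / k\<close> and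
    \<open>276 / k\<^sup>2\<close> so that one value serves both estimates.\<close>
  show "k / 16 > 0" using assms by simp
  show "\<forall>(q :: real \<Rightarrow> complex) (\<nu> :: real measure) (\<psi> :: real \<Rightarrow> complex).
       set_integrable lebesgue {0<..} q \<and> L1_norm q < k / 16 \<and> spectral_pair q \<nu> \<psi> \<longrightarrow>
       (\<exists>n p. pair_values \<nu> \<psi> (k\<^sup>2) n p) \<and>
       (\<forall>n p. pair_values \<nu> \<psi> (k\<^sup>2) n p \<longrightarrow>
          \<bar>n - 1 / (2 * pi) * (k - (LINT y:{0<..}|lebesgue. sin (2 * k * y) * Re (q y)))\<bar>
            \<le> (32 / k + 276 / k\<^sup>2) * (L1_norm q)\<^sup>2 \<and>
          cmod (p - (1 + 2 * \<i> / complex_of_real k *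
                  complex_of_real (LINT y:{0<..}|lebesgue. exp (- (k * y)) * sin (k * y) * Im (q y))))
            \<le> (32 / k + 276 / k\<^sup>2) * (L1_norm q)\<^sup>2)"
  proof (rule allI, rule allI, rule allI, rule impI)
    fix q :: "real \<Rightarrow> complex" and \<nu> :: "real measure" and \<psi> :: "real \<Rightarrow> complex"
    assume a: "set_integrable lebesgue {0<..} q \<and> L1_norm q < k / 16 \<and> spectral_pair q \<nu> \<psi>"
    then have q: "set_integrable lebesgue {0<..} q" by simp
    obtain q0 where rep0: "integrable lborel q0" "\<And>y. y \<le> 0 \<Longrightarrow> q0 y = 0" "AE y in lebesgue. y > 0 \<longrightarrow> q y = q0 y"
      using borel_representative[OF q] by metis
    have rep: "(LINT y:{0<..}|lebesgue. c y * L (q y)) = (LINT y|lborel. c y * L (q0 y))"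
      if "c \<in> borel_measurable borel" "continuous_on UNIV L" "L 0 = 0" for c and L :: "complex \<Rightarrow> real"
      by (rule set_integral_representative[OF q rep0 that])
    have L1: "L1_norm q = (LINT y|lborel. norm (q0 y))"
      using rep[of "\<lambda>_. 1" norm] unfolding L1_norm_def by (simp add: continuous_on_norm_id)
    interpret small_potential q0 k
      by unfold_locales (use assms rep0 a L1 in auto)
    have S: "(LINT y:{0<..}|lebesgue. sin (2 * k * y) * Re (q y)) = nu_correction"
      unfolding nu_correction_def by (rule rep) (auto intro!: continuous_intros)
    have E: "(LINT y:{0<..}|lebesgue. exp (- (k * y)) * sin (k * y) * Im (q y)) = psi_correction"
      unfolding psi_correction_def by (rule rep) (auto intro!: continuous_intros)
    have sp: "spectral_pair q0 \<nu> \<psi>" using a spectral_pair_cong_AE[OF rep0(3)] by simp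
    have C: "32 / k * (L1_norm q)\<^sup>2 \<le> (32 / k + 276 / k\<^sup>2) * (L1_norm q)\<^sup>2"
      "276 / k\<^sup>2 * (L1_norm q)\<^sup>2 \<le> (32 / k + 276 / k\<^sup>2) * (L1_norm q)\<^sup>2"
      using assms by (intro mult_right_mono; simp)+
    show "(\<exists>n p. pair_values \<nu> \<psi> (k\<^sup>2) n p) \<and>
         (\<forall>n p. pair_values \<nu> \<psi> (k\<^sup>2) n p \<longrightarrow>
            \<bar>n - 1 / (2 * pi) * (k - (LINT y:{0<..}|lebesgue. sin (2 * k * y) * Re (q y)))\<bar>
              \<le> (32 / k + 276 / k\<^sup>2) * (L1_norm q)\<^sup>2 \<and>
            cmod (p - (1 + 2 * \<i> / complex_of_real k *
                    complex_of_real (LINT y:{0<..}|lebesgue. exp (- (k * y)) * sin (k * y) * Im (q y))))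
              \<le> (32 / k + 276 / k\<^sup>2) * (L1_norm q)\<^sup>2)"
      unfolding S E using pair_values_asymptotics[OF sp, folded L1] C by (meson order_trans)
  qed
qed

end
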